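(* Let $n\ge 2$ be an integer and write $C=C_{W,n}(\mathbb{S}^n_+)$. The Neumann eigenvalues $\mu_k=\mu_k(\mathbb{S}^n_+)$ of the hemisphere satisfy, for all $k\ge 0$, $$C\,(k+1)^{2/n}-2\sqrt{C}\,(k+1)^{1/n}-\frac{(n-2)(n+5)}{6}\ \le\ \mu_k(\mathbb{S}^n_+)\ \le\ C\,k^{2/n},$$ with equality in the right-hand inequality when $k=0$, and, when $n=2$, for all $k$ of the form $j(j+1)/2$. Furthermore, along the subsequence $k=k'_-(K)$ of lowest orders of each chain, $$C\,k^{2/n}-\mu_k(\mathbb{S}^n_+)\ \longrightarrow\ \frac{(n-1)(n-2)}{6}\qquad (k\to\infty).$$ The left-hand inequality is asymptotically sharp, in the sense that $$\frac{C\,(k+1)^{2/n}-\mu_k(\mathbb{S}^n_+)}{2\sqrt{C}\,(k+1)^{1/n}}\ \longrightarrow\ 1$$ along the subsequence $k=k'_+(K)$, $K\to\infty$, of highest orders of each chain.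
   Context: $\mathbb{S}^n_+=\{x\in\mathbb{R}^{n+1}:\|x\|=1,\ x_{n+1}>0\}$ is the unit hemisphere with the round metric. Its Neumann eigenvalues ($\Delta u+\mu u=0$ in $\mathbb{S}^n_+$, $\partial u/\partial\nu=0$ on the boundary), repeated according to multiplicity, are $0=\mu_0<\mu_1\le\mu_2\le\dots$. The Weyl constant of an $n$-dimensional manifold $M$ is $C_{W,n}(M)=4\pi^2/(\omega_n|M|)^{2/n}$, where $\omega_n$ is the volume of the unit ball in $\mathbb{R}^n$ and $|M|$ the volume of $M$; for the hemisphere $C_{W,n}(\mathbb{S}^n_+)=(n!)^{2/n}$. Known facts and notation: the distinct Neumann eigenvalues of $\mathbb{S}^n_+$ are $\overline{\lambda}_K=K(K+n-1)$, $K=0,1,2,\dots$, with multiplicity $m'(K)=\binom{n+K-1}{n-1}$. The $K$-chain is the set of eigenvalues $\mu_k$ with $k'_-(K)\le k\le k'_+(K)$, all equal to $\overline{\lambda}_K$, where $k'_-(K)=\sum_{i=0}^{K-1}m'(i)=\frac{K(K+1)\cdots(K+n-1)}{n!}$ and $k'_+(K)=\sum_{i=0}^{K}m'(i)-1$; these are its lowest and highest orders. *)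

theory Defs
  imports "HOL-Analysis.Analysis" "HOL-Library.Function_Algebras" "HOL-Library.Equipollence"
begin

text \<open>
  The ambient space \<open>\<real>\<^sup>n\<^sup>+\<^sup>1\<close> is rendered as \<open>\<real>\<^sup>n \<times> \<real>\<close>, that is \<open>(real ^ 'n) \<times> real\<close> with
  \<open>n = CARD('n)\<close>; the last coordinate \<open>x\<^sub>n\<^sub>+\<^sub>1\<close> is \<^term>\<open>snd x\<close>, and the norm is Euclidean.
\<close>

definition hemisphere :: "((real ^ 'n) \<times> real) set" where
  "hemisphere = {x. norm x = 1 \<and> snd x > 0}"

definition closed_hemisphere :: "((real ^ 'n) \<times> real) set" where
  "closed_hemisphere = {x. norm x = 1 \<and> snd x \<ge> 0}"

definition hemisphere_boundary :: "((real ^ 'n) \<times> real) set" where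
  "hemisphere_boundary = {x. norm x = 1 \<and> snd x = 0}"


subsection \<open>Volume on the sphere and the Weyl constant\<close>

text \<open>
  Surface measure on the unit sphere of a \<open>d\<close>-dimensional Euclidean space, by polar coordinates:
  the cone over \<open>A\<close> with apex \<open>0\<close> has volume \<open>\<integral>\<^sub>0\<^sup>1 r\<^sup>d\<^sup>-\<^sup>1 dr = 1/d\<close> times the surface measure of \<open>A\<close>.
\<close>

definition sphere_measure :: "'a::euclidean_space set \<Rightarrow> real" where
  "sphere_measure A =
     real DIM('a) * measure lebesgue {r *\<^sub>R x | r x. 0 < r \<and> r \<le> 1 \<and> x \<in> A}"

definition weyl_constant :: "nat \<Rightarrow> real \<Rightarrow> real" where
  "weyl_constant n V = 4 * pi\<^sup>2 / ((unit_ball_vol (real n) * V) powr (2 / real n))"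


subsection \<open>The Neumann problem on the hemisphere\<close>

definition laplacian :: "('a::euclidean_space \<Rightarrow> real) \<Rightarrow> 'a \<Rightarrow> real" where
  "laplacian f x = (\<Sum>b\<in>Basis. (deriv ^^ 2) (\<lambda>s. f (x + s *\<^sub>R b)) 0)"

text \<open>
  The Laplace-Beltrami operator of the round unit sphere is the Euclidean Laplacian of the
  extension that is constant along rays, evaluated on the sphere.
\<close>

definition sphere_laplacian :: "('a::euclidean_space \<Rightarrow> real) \<Rightarrow> 'a \<Rightarrow> real" where
  "sphere_laplacian u x = laplacian (\<lambda>y. u (y /\<^sub>R norm y)) x"

definition C2_on_open :: "('a::euclidean_space \<Rightarrow> real) \<Rightarrow> 'a set \<Rightarrow> bool" where
  "C2_on_open f U \<longleftrightarrow> open U \<and>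
     (\<exists>G H. (\<forall>x\<in>U. (f has_derivative (\<lambda>h. G x \<bullet> h)) (at x)) \<and>
            (\<forall>x\<in>U. (G has_derivative H x) (at x)) \<and>
            (\<forall>h. continuous_on U (\<lambda>x. H x h)))"

text \<open>Class \<open>C\<^sup>2\<close> on a subset of Euclidean space (here: up to the boundary): being the
  restriction of a \<open>C\<^sup>2\<close> function defined on an open neighbourhood.\<close>

definition C2_on :: "('a::euclidean_space \<Rightarrow> real) \<Rightarrow> 'a set \<Rightarrow> bool" where
  "C2_on u S \<longleftrightarrow> (\<exists>f U. C2_on_open f U \<and> S \<subseteq> U \<and> (\<forall>x\<in>S. f x = u x))"

text \<open>
  The outward unit normal of the hemisphere at each boundary point \<open>x\<close> is \<open>\<nu> = -e\<^sub>n\<^sub>+\<^sub>1\<close>, and the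
  geodesic through \<open>x\<close> with velocity \<open>\<nu>\<close> is \<open>s \<mapsto> cos s x + sin s \<nu>\<close>. It lies in the closed
  hemisphere for \<open>s \<le> 0\<close> near \<open>0\<close>, whence the one-sided derivative.
\<close>

definition has_normal_derivative ::
    "((real ^ 'n) \<times> real \<Rightarrow> real) \<Rightarrow> real \<Rightarrow> (real ^ 'n) \<times> real \<Rightarrow> bool" where
  "has_normal_derivative u D x \<longleftrightarrow>
     ((\<lambda>s. u (cos s *\<^sub>R x + sin s *\<^sub>R (0, -1))) has_real_derivative D) (at 0 within {..0})"

text \<open>
  A function on the closed hemisphere is represented by its extension by \<open>0\<close> to the ambient space,
  so that distinct representatives are distinct functions on the closed hemisphere. The zero
  function belongs to the eigenspace, for every \<open>\<kappa>\<close>.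
\<close>

definition neumann_eigenspace :: "real \<Rightarrow> ((real ^ 'n) \<times> real \<Rightarrow> real) set" where
  "neumann_eigenspace \<kappa> =
     {u. (\<forall>x. x \<notin> closed_hemisphere \<longrightarrow> u x = 0) \<and>
         C2_on u closed_hemisphere \<and>
         (\<forall>x\<in>hemisphere. sphere_laplacian u x + \<kappa> * u x = 0) \<and>
         (\<forall>x\<in>hemisphere_boundary. has_normal_derivative u 0 x)}"

interpretation real_fun: vector_space "\<lambda>(c::real) (f :: 'a \<Rightarrow> real) x. c * f x"
  by unfold_locales (auto simp: fun_eq_iff algebra_simps)

text \<open>
  \<open>\<mu>\<close> lists the eigenvalues in nondecreasing order, starting at index \<open>0\<close> and repeated according to
  multiplicity: each real \<open>\<kappa>\<close> occurs as many times as a basis of its eigenspace has elements (not at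
  all, if \<open>\<kappa>\<close> is not an eigenvalue).
\<close>

definition neumann_spectrum_enum :: "'n::finite itself \<Rightarrow> (nat \<Rightarrow> real) \<Rightarrow> bool" where
  "neumann_spectrum_enum _ \<mu> \<longleftrightarrow> mono \<mu> \<and>
     (\<forall>\<kappa>. \<exists>B :: ((real ^ 'n) \<times> real \<Rightarrow> real) set.
        real_fun.independent B \<and> real_fun.span B = neumann_eigenspace \<kappa> \<and>
        {k. \<mu> k = \<kappa>} \<approx> B)"

definition neumann_eigenvalue :: "'n::finite itself \<Rightarrow> nat \<Rightarrow> real" where
  "neumann_eigenvalue T = (THE \<mu>. neumann_spectrum_enum T \<mu>)"


subsection \<open>Chains\<close>

definition chain_mult :: "nat \<Rightarrow> nat \<Rightarrow> nat" where
  "chain_mult n K = (n + K - 1) choose (n - 1)"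

definition chain_lowest :: "nat \<Rightarrow> nat \<Rightarrow> nat" where
  "chain_lowest n K = (\<Sum>i<K. chain_mult n i)"

definition chain_highest :: "nat \<Rightarrow> nat \<Rightarrow> nat" where
  "chain_highest n K = (\<Sum>i\<le>K. chain_mult n i) - 1"

end

theory Submission
  imports Defs
begin

text \<open>
  A function on the closed hemisphere is a function of \<open>x' = (x\<^sub>1, \<dots>, x\<^sub>n)\<close> alone. On
  homogeneous polynomials \<open>p\<close> in \<open>x'\<close> of degree \<open>d\<close> the Laplace-Beltrami operator is \<open>\<Delta>p - d (d + n - 1) p\<close>,
  and all of them satisfy the Neumann condition. The operator is thus triangular with respect to the degree,
  and every monomial of degree \<open>K\<close> is the leading term of an eigenfunction for \<open>K (K + n - 1)\<close>. By
  Green's identity an arbitrary eigenfunction is orthogonal to all these eigenpolynomials with other eigenvalues. As they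
  span the polynomials, which are dense by the Stone-Weierstrass theorem, there are no further
  eigenfunctions.

  Surface integrals are avoided: functions are extended to the half-space homogeneously of degree \<open>0\<close>, and
  orthogonality is meant with respect to a radial weight supported in a half-annulus.

  With \<open>k\<close> the lowest order of the \<open>K\<close>-chain, \<open>C k\<^bsup>2/n\<^esup>\<close> is the square of the geometric mean of
  \<open>K, \<dots>, K + n - 1\<close>. Pairing the factors symmetrically, the inequality between the means gives the sharp bounds
  and the limits.
\<close>

subsection \<open>Functions of class \<open>C\<^sup>2\<close>\<close>

text \<open>The Neumann condition stands for evenness in the last coordinate, and on the sphere even
  powers of that coordinate are polynomials in the others. This is why arbitrary polynomials in n
  variables take the place of spherical harmonics, and why the multiplicity of a chain is the plain
  count of monomials of degree \<open>K\<close>. Eigenfunctions are only assumed to be of class C^2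
  up to the boundary, and nothing about the spectrum is given in advance. Completeness is reduced to
  one eigenspace at a time: after subtracting its projection onto the finitely many eigenpolynomials
  with the same eigenvalue, an eigenfunction is orthogonal to every polynomial, hence zero. Since
  \<open>neumann_eigenvalue\<close> is a definite description, the enumeration must be shown to be
  unique as well as to exist. For the lower estimate, \<open>t\<^sup>2 - 2 * t\<close> increases for
  \<open>t \<ge> 1\<close>, so the highest order of a chain is the worst case; there
  \<open>k + 1\<close> is the lowest order of the next chain. For the upper estimate the worst case
  is the lowest order.\<close>

lemma C2_on_open_const: "open U \<Longrightarrow> C2_on_open (\<lambda>x. c) U"
  unfolding C2_on_open_def
  by (intro conjI exI[where x="\<lambda>_. 0"] exI[where x="\<lambda>_ _. 0"]) (auto simp: fun_eq_iff intro!: has_derivative_eq_rhs[OF has_derivative_const])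

lemma C2_on_open_inner: "open U \<Longrightarrow> C2_on_open (\<lambda>x. x \<bullet> a) U"
  unfolding C2_on_open_def
  by (intro conjI exI[where x="\<lambda>_. a"] exI[where x="\<lambda>_ _. 0"])
    (auto intro!: derivative_eq_intros simp: inner_commute)

lemma C2_on_open_add:
  assumes "C2_on_open f U" "C2_on_open g U"
  shows "C2_on_open (\<lambda>x. f x + g x) U"
proof -
  from assms obtain G H G' H' where *: "open U"
    "\<forall>x\<in>U. (f has_derivative (\<lambda>h. G x \<bullet> h)) (at x)" "\<forall>x\<in>U. (G has_derivative H x) (at x)"
    "\<And>h. continuous_on U (\<lambda>x. H x h)"
    "\<forall>x\<in>U. (g has_derivative (\<lambda>h. G' x \<bullet> h)) (at x)" "\<forall>x\<in>U. (G' has_derivative H' x) (at x)"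
    "\<And>h. continuous_on U (\<lambda>x. H' x h)"
    unfolding C2_on_open_def by metis
  show ?thesis unfolding C2_on_open_def
    apply (intro conjI exI[where x="\<lambda>x. G x + G' x"] exI[where x="\<lambda>x h. H x h + H' x h"])
    using * by (auto intro!: derivative_eq_intros continuous_intros simp: inner_add_left)
qed

lemma C2_on_open_mult:
  assumes "C2_on_open f U" "C2_on_open g U"
  shows "C2_on_open (\<lambda>x. f x * g x) U"
proof -
  from assms obtain G H G' H' where *: "open U"
    "\<forall>x\<in>U. (f has_derivative (\<lambda>h. G x \<bullet> h)) (at x)" "\<forall>x\<in>U. (G has_derivative H x) (at x)"
    "\<And>h. continuous_on U (\<lambda>x. H x h)"
    "\<forall>x\<in>U. (g has_derivative (\<lambda>h. G' x \<bullet> h)) (at x)" "\<forall>x\<in>U. (G' has_derivative H' x) (at x)"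
    "\<And>h. continuous_on U (\<lambda>x. H' x h)"
    unfolding C2_on_open_def by metis
  have c: "continuous_on U f" "continuous_on U g" "continuous_on U G" "continuous_on U G'"
    using * by (meson continuous_at_imp_continuous_on has_derivative_continuous)+
  show ?thesis unfolding C2_on_open_def
    apply (intro conjI exI[where x="\<lambda>x. f x *\<^sub>R G' x + g x *\<^sub>R G x"]
      exI[where x="\<lambda>x h. (f x *\<^sub>R H' x h + (G x \<bullet> h) *\<^sub>R G' x) + (g x *\<^sub>R H x h + (G' x \<bullet> h) *\<^sub>R G x)"])
    using * c by (auto intro!: derivative_intros derivative_eq_intros continuous_intros simp: inner_add_left)
qed

lemma C2_on_open_cmult: "C2_on_open f U \<Longrightarrow> C2_on_open (\<lambda>x. c * f x) U"
  by (rule C2_on_open_mult[OF C2_on_open_const]) (auto simp: C2_on_open_def)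

lemma C2_on_open_power: "C2_on_open f U \<Longrightarrow> C2_on_open (\<lambda>x. f x ^ k) U"
proof (induction k)
  case 0
  then show ?case using C2_on_open_const[of U 1] by (simp add: C2_on_open_def[of f])
next
  case (Suc k)
  then show ?case using C2_on_open_mult[of f U "\<lambda>x. f x ^ k"] by simp
qed

lemma C2_on_open_prod:
  assumes "finite I" "open U" "\<And>i. i \<in> I \<Longrightarrow> C2_on_open (f i) U"
  shows "C2_on_open (\<lambda>x. \<Prod>i\<in>I. f i x) U"
  using assms
proof (induction I)
  case empty
  then show ?case by (simp add: C2_on_open_const)
next
  case (insert i I)
  then show ?case using C2_on_open_mult[of "f i" U "\<lambda>x. \<Prod>i\<in>I. f i x"] by simp
qed

lemma C2_on_open_subset: "C2_on_open f U \<Longrightarrow> open V \<Longrightarrow> V \<subseteq> U \<Longrightarrow> C2_on_open f V"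
  unfolding C2_on_open_def by (meson continuous_on_subset subsetD)

lemma C2_on_add:
  assumes "C2_on f S" "C2_on g S" shows "C2_on (\<lambda>x. f x + g x) S"
proof -
  from assms obtain f' U g' V where *: "C2_on_open f' U" "S \<subseteq> U" "\<forall>x\<in>S. f' x = f x"
    "C2_on_open g' V" "S \<subseteq> V" "\<forall>x\<in>S. g' x = g x"
    unfolding C2_on_def by metis
  then have "C2_on_open (\<lambda>x. f' x + g' x) (U \<inter> V)"
    by (metis C2_on_open_add C2_on_open_subset C2_on_open_def open_Int inf_le1 inf_le2)
  then show ?thesis unfolding C2_on_def using * by fastforce
qed

lemma C2_on_cmult: "C2_on f S \<Longrightarrow> C2_on (\<lambda>x. c * f x) S"
  unfolding C2_on_def by (metis C2_on_open_cmult)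

lemma C2_on_open_imp_continuous_on: "C2_on_open f U \<Longrightarrow> continuous_on U f"
  unfolding C2_on_open_def by (meson continuous_at_imp_continuous_on has_derivative_continuous)

lemma C2_on_imp_continuous_on: "C2_on f S \<Longrightarrow> continuous_on S f"
  unfolding C2_on_def
  by (metis C2_on_open_imp_continuous_on continuous_on_cong continuous_on_subset)

section \<open>Extensions that are constant along rays\<close>

lemma has_derivative_normalize:
  fixes y :: "'a::euclidean_space"
  assumes "y \<noteq> 0"
  shows "((\<lambda>y. y /\<^sub>R norm y) has_derivative
           (\<lambda>h. (h - ((y /\<^sub>R norm y) \<bullet> h) *\<^sub>R (y /\<^sub>R norm y)) /\<^sub>R norm y)) (at y)"
proof -
  have n: "(norm has_derivative (\<lambda>h. (y /\<^sub>R norm y) \<bullet> h)) (at y)"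
    using has_derivative_norm[OF assms] by (simp add: sgn_div_norm inner_commute)
  show ?thesis
    by (rule has_derivative_eq_rhs[OF has_derivative_scaleR[OF Deriv.has_derivative_inverse[OF _ n] has_derivative_ident]])
      (use assms in \<open>auto simp: fun_eq_iff algebra_simps divide_simps\<close>)
qed
text \<open>The gradient of the extension at \<open>y\<close> is the tangential part of the original
  gradient at \<open>N y\<close>, divided by \<open>norm y\<close>. From this formula it is
  orthogonal to \<open>y\<close> and homogeneous of degree -1; both facts are recorded because
  \<open>C2_on_open\<close> only asserts that some gradient exists.\<close>

lemma C2_normalize:
  fixes f :: "'a::euclidean_space \<Rightarrow> real"
  assumes "C2_on_open f U"
  defines "N \<equiv> \<lambda>y::'a. y /\<^sub>R norm y"
  defines "W \<equiv> {y. y \<noteq> 0 \<and> N y \<in> U}"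
  obtains G H where "open W"
    "\<And>y. y \<in> W \<Longrightarrow> ((\<lambda>y. f (N y)) has_derivative (\<lambda>h. G y \<bullet> h)) (at y)"
    "\<And>y. y \<in> W \<Longrightarrow> (G has_derivative H y) (at y)"
    "\<And>h. continuous_on W (\<lambda>y. H y h)"
    "\<And>y. y \<in> W \<Longrightarrow> G y \<bullet> y = 0"
    "\<And>c y. c > 0 \<Longrightarrow> y \<in> W \<Longrightarrow> c *\<^sub>R y \<in> W \<and> G (c *\<^sub>R y) = G y /\<^sub>R c"
proof -
  from assms(1) obtain g h where *: "open U"
    "\<And>x. x\<in>U \<Longrightarrow> (f has_derivative (\<lambda>k. g x \<bullet> k)) (at x)"
    "\<And>x. x\<in>U \<Longrightarrow> (g has_derivative h x) (at x)"
    "\<And>k. continuous_on U (\<lambda>x. h x k)"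
    unfolding C2_on_open_def by metis
  have N: "(N has_derivative (\<lambda>h. (h - (N y \<bullet> h) *\<^sub>R N y) /\<^sub>R norm y)) (at y)" if "y \<noteq> 0" for y
    using has_derivative_normalize[OF that] unfolding N_def .
  have contN: "continuous_on (- {0}) N"
    by (intro continuous_at_imp_continuous_on ballI has_derivative_continuous[OF N]) auto
  have W: "open W"
  proof -
    have "W = N -` U \<inter> - {0}" by (auto simp: W_def)
    then show ?thesis using continuous_on_open_vimage[of "-{0}" N] contN *(1) by auto
  qed
  have WU: "y \<noteq> 0" "N y \<in> U" if "y \<in> W" for y using that by (auto simp: W_def)
  define G where "G = (\<lambda>y. (g (N y) - (g (N y) \<bullet> N y) *\<^sub>R N y) /\<^sub>R norm y)"
  define DN where "DN = (\<lambda>y h. (h - (N y \<bullet> h) *\<^sub>R N y) /\<^sub>R norm y)"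
  define K where "K = (\<lambda>y k. h (N y) (DN y k))"
  define H where "H = (\<lambda>y k. inverse (norm y) *\<^sub>R (K y k - ((g (N y) \<bullet> N y) *\<^sub>R DN y k
       + (g (N y) \<bullet> DN y k + K y k \<bullet> N y) *\<^sub>R N y))
       + (- (inverse (norm y) * (N y \<bullet> k) * inverse (norm y))) *\<^sub>R (g (N y) - (g (N y) \<bullet> N y) *\<^sub>R N y))"
  have DN: "(N has_derivative DN y) (at y)" if "y \<noteq> 0" for y
    using N[OF that] unfolding DN_def .
  have NN: "N y \<bullet> N y = 1" if "y \<noteq> 0" for y
    using that by (simp add: N_def dot_square_norm power2_eq_square)
  have fd: "((\<lambda>y. f (N y)) has_derivative (\<lambda>h. G y \<bullet> h)) (at y)" if y: "y \<in> W" for y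
  proof -
    have "((\<lambda>y. f (N y)) has_derivative (\<lambda>k. g (N y) \<bullet> DN y k)) (at y)"
      using has_derivative_compose[OF DN *(2)] WU[OF y] by auto
    moreover have "(\<lambda>k. g (N y) \<bullet> DN y k) = (\<lambda>k. G y \<bullet> k)"
      by (auto simp: fun_eq_iff DN_def G_def algebra_simps)
    ultimately show ?thesis by simp
  qed
  have gd: "((\<lambda>y. g (N y)) has_derivative K y) (at y)" if y: "y \<in> W" for y
    unfolding K_def using has_derivative_compose[OF DN *(3)] WU[OF y] by auto
  have Gd: "(G has_derivative H y) (at y)" if y: "y \<in> W" for y
  proof -
    have n: "(norm has_derivative (\<lambda>h. N y \<bullet> h)) (at y)"
      using has_derivative_norm[OF WU(1)[OF y]] by (simp add: sgn_div_norm inner_commute N_def)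
    show ?thesis unfolding G_def H_def
      by (intro has_derivative_scaleR Deriv.has_derivative_inverse n has_derivative_diff gd[OF y]
          has_derivative_inner DN) (use WU[OF y] in auto)
  qed
  have hN: "continuous_on W (\<lambda>y. h (N y) b)" for b
    using continuous_on_compose2[OF *(4), of W N b] contN WU
    by (metis (no_types, lifting) ComplI continuous_on_subset image_subsetI singletonD subsetI)
  have gN: "continuous_on W (\<lambda>y. g (N y))"
    by (intro continuous_at_imp_continuous_on ballI has_derivative_continuous[OF gd])
  have cN: "continuous_on W N" using contN WU by (meson ComplI continuous_on_subset singletonD subsetI)
  have cDN: "continuous_on W (\<lambda>y. DN y k)" for k
    unfolding DN_def using WU by (intro continuous_intros cN) auto
  \<comment> \<open>The Hessian \<open>h\<close> is continuous only for a fixed direction, whereas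
    here the direction \<open>DN y k\<close> moves with \<open>y\<close>. Expanding it in the basis
    separates the two dependences.\<close>
  have cK: "continuous_on W (\<lambda>y. K y k)" for k
  proof -
    have "K y k = (\<Sum>b\<in>Basis. (DN y k \<bullet> b) *\<^sub>R h (N y) b)" if "y \<in> W" for y
    proof -
      have "linear (h (N y))" using *(3)[OF WU(2)[OF that]] has_derivative_linear by blast
      then have "h (N y) (\<Sum>b\<in>Basis. (DN y k \<bullet> b) *\<^sub>R b) = (\<Sum>b\<in>Basis. (DN y k \<bullet> b) *\<^sub>R h (N y) b)"
        by (simp add: linear_sum linear_scale)
      then show ?thesis by (simp add: K_def euclidean_representation)
    qed
    moreover have "continuous_on W (\<lambda>y. \<Sum>b\<in>Basis. (DN y k \<bullet> b) *\<^sub>R h (N y) b)"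
      by (intro continuous_intros cDN hN)
    ultimately show ?thesis by (simp cong: continuous_on_cong)
  qed
  have cH: "continuous_on W (\<lambda>y. H y k)" for k
    unfolding H_def using WU by (intro continuous_intros cN gN cK cDN) auto
  show thesis
  proof (rule that[OF W fd Gd cH])
    show "G y \<bullet> y = 0" if "y \<in> W" for y
    proof -
      have "y = norm y *\<^sub>R N y" using WU(1)[OF that] by (simp add: N_def)
      then have "G y \<bullet> y = norm y * (G y \<bullet> N y)" by (metis inner_scaleR_right)
      also have "G y \<bullet> N y = 0" using NN[OF WU(1)[OF that]] by (simp add: G_def inner_diff_left)
      finally show ?thesis by simp
    qed
    show "c *\<^sub>R y \<in> W \<and> G (c *\<^sub>R y) = G y /\<^sub>R c" if "c > 0" "y \<in> W" for c y
    proof -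
      have "N (c *\<^sub>R y) = N y" using that(1) by (simp add: N_def)
      then show ?thesis using that by (simp add: W_def G_def mult.commute)
    qed
  qed
qed

subsection \<open>The Neumann problem with a right-hand side\<close>

text \<open>A relation with a free right-hand side: the Laplacian of a monomial is not a multiple of
  it but also contains terms of lower degree. Eigenfunctions are the case
  \<open>v = - \<kappa> * u\<close>.\<close>

definition neumann_pair :: "((real ^ 'n) \<times> real \<Rightarrow> real) \<Rightarrow> ((real ^ 'n) \<times> real \<Rightarrow> real) \<Rightarrow> bool" where
  "neumann_pair u v \<longleftrightarrow> (\<forall>x. x \<notin> closed_hemisphere \<longrightarrow> u x = 0) \<and> C2_on u closed_hemisphere \<and>
     (\<forall>x\<in>hemisphere. sphere_laplacian u x = v x) \<and>
     (\<forall>x\<in>hemisphere_boundary. has_normal_derivative u 0 x)"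

lemma neumann_eigenspace_iff:
  "u \<in> neumann_eigenspace \<kappa> \<longleftrightarrow> neumann_pair u (\<lambda>x. - \<kappa> * u x)"
  unfolding neumann_eigenspace_def neumann_pair_def by (auto simp: eq_neg_iff_add_eq_0)

text \<open>\<open>deriv\<close> is a choice operator, so the first derivative must be identified on
  a whole neighbourhood before it can be differentiated again.\<close>

lemma deriv2_eqI:
  fixes h :: "real \<Rightarrow> real"
  assumes "open S" "a \<in> S" "\<And>s. s \<in> S \<Longrightarrow> (h has_real_derivative h' s) (at s)"
    and "(h' has_real_derivative D) (at a)"
  shows "(deriv ^^ 2) h a = D"
proof -
  have "deriv h s = h' s" if "s \<in> S" for s using assms(3)[OF that] by (rule DERIV_imp_deriv)
  then have "(deriv h has_real_derivative D) (at a)"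
    using has_field_derivative_transform_within_open[OF assms(4,1,2)] by metis
  then show ?thesis by (simp add: numeral_2_eq_2 DERIV_imp_deriv)
qed

lemma norm_great_circle:
  fixes x :: "(real ^ 'n) \<times> real"
  assumes "x \<in> hemisphere_boundary"
  shows "norm (cos s *\<^sub>R x + sin s *\<^sub>R (0, -1)) = 1"
proof -
  have "norm x = 1" "snd x = 0" using assms by (auto simp: hemisphere_boundary_def)
  then have "x \<bullet> x = 1" "\<And>r. x \<bullet> (0, r) = 0" by (auto simp: dot_square_norm inner_prod_def)
  then have "(cos s *\<^sub>R x + sin s *\<^sub>R (0, -1)) \<bullet> (cos s *\<^sub>R x + sin s *\<^sub>R (0, -1)) = (cos s)\<^sup>2 + (sin s)\<^sup>2"
    by (simp add: inner_add_left inner_add_right inner_commute power2_eq_square) 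
  then show ?thesis by (simp add: norm_eq_sqrt_inner)
qed

lemma great_circle_in_closed_hemisphere:
  fixes x :: "(real ^ 'n) \<times> real"
  assumes "x \<in> hemisphere_boundary" "s \<le> 0" "\<bar>s\<bar> < 1"
  shows "cos s *\<^sub>R x + sin s *\<^sub>R (0, -1) \<in> closed_hemisphere"
proof -
  have "sin s \<le> 0" using assms pi_gt3 sin_ge_zero[of "-s"] by auto
  then show ?thesis using norm_great_circle[OF assms(1), of s] assms(1)
    by (auto simp: closed_hemisphere_def hemisphere_boundary_def)
qed

lemma has_real_derivative_unique_atMost:
  fixes f :: "real \<Rightarrow> real"
  assumes "(f has_real_derivative D) (at a within {..a})" "(f has_real_derivative E) (at a within {..a})"
  shows "D = E"
proof (rule vector_derivative_unique_within)
  have "at a within {..<a} \<le> at a within {..a}" by (rule at_le) auto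
  then show "at a within {..a} \<noteq> bot" using trivial_limit_at_left_real[of a] by (metis bot.extremum_uniqueI trivial_limit_def)
qed (use assms in \<open>auto simp: has_real_derivative_iff_has_vector_derivative\<close>)

text \<open>Links \<open>sphere_laplacian\<close>, written with iterated \<open>deriv\<close>, to
  the Hessian used in Green's identity. It is stated on the open half-space, where \<open>f\<close>
  and the degree 0 extension of \<open>u\<close> agree near each point.\<close>

lemma second_derivative_along_line:
  fixes u f :: "(real ^ 'n) \<times> real \<Rightarrow> real"
  defines "N \<equiv> \<lambda>y :: (real ^ 'n) \<times> real. y /\<^sub>R norm y"
  assumes fu: "\<And>y. snd y > 0 \<Longrightarrow> f y = u (N y)"
    and fd: "\<And>y. snd y > 0 \<Longrightarrow> (f has_derivative (\<lambda>h. G y \<bullet> h)) (at y)"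
    and Gd: "\<And>y. snd y > 0 \<Longrightarrow> (G has_derivative H y) (at y)"
    and y: "snd y > 0"
  shows "(deriv ^^ 2) (\<lambda>s. u (N (y + s *\<^sub>R b))) 0 = H y b \<bullet> b"
proof (rule deriv2_eqI[where S="{s. snd (y + s *\<^sub>R b) > 0}" and h'="\<lambda>s. G (y + s *\<^sub>R b) \<bullet> b"])
  show op: "open {s. 0 < snd (y + s *\<^sub>R b)}"
    by (intro open_Collect_less continuous_intros)
  show "0 \<in> {s. 0 < snd (y + s *\<^sub>R b)}" using y by simp
  show "((\<lambda>s. u (N (y + s *\<^sub>R b))) has_real_derivative G (y + s *\<^sub>R b) \<bullet> b) (at s)"
    if s: "s \<in> {s. 0 < snd (y + s *\<^sub>R b)}" for s
  proof (rule has_field_derivative_transform_within_open[OF _ op s])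
    have "((\<lambda>s. f (y + s *\<^sub>R b)) has_derivative (\<lambda>t. G (y + s *\<^sub>R b) \<bullet> (t *\<^sub>R b))) (at s)"
      by (rule has_derivative_compose[where g=f and f="\<lambda>s. y + s *\<^sub>R b"])
        (auto intro!: derivative_eq_intros fd intro: s[simplified])
    then show "((\<lambda>s. f (y + s *\<^sub>R b)) has_real_derivative G (y + s *\<^sub>R b) \<bullet> b) (at s)"
      unfolding has_field_derivative_def by (simp add: mult.commute[of _ "_ \<bullet> _"])
    show "f (y + t *\<^sub>R b) = u (N (y + t *\<^sub>R b))" if "t \<in> {s. 0 < snd (y + s *\<^sub>R b)}" for t
      using that by (intro fu) simp
  qed
  have "(G has_derivative H y) (at (y + 0 *\<^sub>R b))" using Gd[OF y] by simp
  then have G': "((\<lambda>s. G (y + s *\<^sub>R b)) has_derivative (\<lambda>t. H y (t *\<^sub>R b))) (at 0)"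
    by (intro has_derivative_compose[where g=G and f="\<lambda>s. y + s *\<^sub>R b"])
      (auto intro!: derivative_eq_intros)
  have "linear (H y)" using Gd[OF y] has_derivative_linear by blast
  then show "((\<lambda>s. G (y + s *\<^sub>R b) \<bullet> b) has_real_derivative H y b \<bullet> b) (at 0)"
    using has_derivative_inner_left[OF G', of b]
    by (simp add: has_field_derivative_def linear_scale mult.commute[of _ "_ \<bullet> _"])
qed

text \<open>The data of a \<open>C\<^sup>2\<close> function \<open>f\<close>, with gradient \<open>G\<close> and Hessian \<open>H\<close>, that extends the function
  homogeneous of degree \<open>0\<close> with values \<open>u\<close> on the closed hemisphere past the boundary of the half-space.\<close>

definition radial_extension where
  "radial_extension u v W f G H \<longleftrightarrow> open W \<and>
     (\<forall>y :: (real ^ 'n) \<times> real. y \<noteq> 0 \<and> snd y \<ge> 0 \<longrightarrow> y \<in> W \<and> f y = (u (y /\<^sub>R norm y) :: real)) \<and>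
     (\<forall>y\<in>W. (f has_derivative (\<lambda>h. G y \<bullet> h)) (at y) \<and> (G has_derivative H y) (at y) \<and> G y \<bullet> y = 0) \<and>
     (\<forall>h. continuous_on W (\<lambda>y. H y h)) \<and>
     (\<forall>y. y \<noteq> 0 \<and> snd y = 0 \<longrightarrow> G y \<bullet> (0, 1) = 0) \<and>
     (\<forall>y. snd y > 0 \<longrightarrow> (\<Sum>b\<in>Basis. H y b \<bullet> b) = v (y /\<^sub>R norm y) / (norm y)\<^sup>2)"

lemma radial_extensionD:
  assumes "radial_extension u v W f G H"
  shows "open W" "\<And>y. y \<noteq> 0 \<Longrightarrow> snd y \<ge> 0 \<Longrightarrow> y \<in> W"
    "\<And>y. y \<noteq> 0 \<Longrightarrow> snd y \<ge> 0 \<Longrightarrow> f y = u (y /\<^sub>R norm y)"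
    "\<And>y. y \<in> W \<Longrightarrow> (f has_derivative (\<lambda>h. G y \<bullet> h)) (at y)"
    "\<And>y. y \<in> W \<Longrightarrow> (G has_derivative H y) (at y)"
    "\<And>h. continuous_on W (\<lambda>y. H y h)"
    "\<And>y. y \<in> W \<Longrightarrow> G y \<bullet> y = 0"
    "\<And>y. y \<noteq> 0 \<Longrightarrow> snd y = 0 \<Longrightarrow> G y \<bullet> (0, 1) = 0"
    "\<And>y. snd y > 0 \<Longrightarrow> (\<Sum>b\<in>Basis. H y b \<bullet> b) = v (y /\<^sub>R norm y) / (norm y)\<^sup>2"
  using assms unfolding radial_extension_def by blast+

text \<open>The equation and the boundary condition are given on the unit sphere only. Homogeneity
  carries them along rays: the gradient has degree -1 and the Hessian degree -2, whence the divisor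
  \<open>(norm y)\<^sup>2\<close>.\<close>

lemma neumann_pair_extension:
  fixes u v :: "(real ^ 'n) \<times> real \<Rightarrow> real"
  assumes "neumann_pair u v"
  obtains W f G H where "radial_extension u v W f G H"
proof -
  define N where "N = (\<lambda>y::(real ^ 'n) \<times> real. y /\<^sub>R norm y)"
  from assms obtain f0 U where f0: "C2_on_open f0 U" "closed_hemisphere \<subseteq> U"
    "\<And>x. x \<in> closed_hemisphere \<Longrightarrow> f0 x = u x"
    unfolding neumann_pair_def C2_on_def by metis
  obtain G H where *: "open {y. y \<noteq> 0 \<and> N y \<in> U}"
    "\<And>y. y \<in> {y. y \<noteq> 0 \<and> N y \<in> U} \<Longrightarrow> ((\<lambda>y. f0 (N y)) has_derivative (\<lambda>h. G y \<bullet> h)) (at y)"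
    "\<And>y. y \<in> {y. y \<noteq> 0 \<and> N y \<in> U} \<Longrightarrow> (G has_derivative H y) (at y)"
    "\<And>h. continuous_on {y. y \<noteq> 0 \<and> N y \<in> U} (\<lambda>y. H y h)"
    "\<And>y. y \<in> {y. y \<noteq> 0 \<and> N y \<in> U} \<Longrightarrow> G y \<bullet> y = 0"
    "\<And>c y. c > 0 \<Longrightarrow> y \<in> {y. y \<noteq> 0 \<and> N y \<in> U} \<Longrightarrow> c *\<^sub>R y \<in> {y. y \<noteq> 0 \<and> N y \<in> U} \<and> G (c *\<^sub>R y) = G y /\<^sub>R c"
    using C2_normalize[OF f0(1)] unfolding N_def by blast
  define W where "W = {y. y \<noteq> 0 \<and> N y \<in> U}"
  define f where "f = (\<lambda>y. f0 (N y))"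
  note * = *[folded W_def f_def]
  have N1: "norm (N y) = 1" if "y \<noteq> 0" for y using that by (simp add: N_def)
  have Nself: "N y = y" if "norm y = 1" for y using that by (simp add: N_def)
  have NC: "N y \<in> closed_hemisphere" if "y \<noteq> 0" "snd y \<ge> 0" for y
    using N1[OF that(1)] that by (auto simp: closed_hemisphere_def N_def)
  have W: "y \<in> W" if "y \<noteq> 0" "snd y \<ge> 0" for y
    using NC[OF that] f0(2) that by (auto simp: W_def)
  have fu: "f y = u (N y)" if "y \<noteq> 0" "snd y \<ge> 0" for y
    using f0(3)[OF NC[OF that]] by (simp add: f_def)
  have yN: "y = norm y *\<^sub>R N y" if "y \<noteq> 0" for y using that by (simp add: N_def)
  have d2: "(deriv ^^ 2) (\<lambda>s. u (N (y + s *\<^sub>R b))) 0 = H y b \<bullet> b" if y: "snd y > 0" for y b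
    unfolding N_def
  proof (rule second_derivative_along_line[where f=f and G=G])
    fix z :: "(real ^ 'n) \<times> real" assume "snd z > 0"
    then have z: "z \<noteq> 0" "snd z \<ge> 0" by auto
    show "f z = u (z /\<^sub>R norm z)" using fu[OF z] by (simp add: N_def)
    show "(f has_derivative (\<lambda>h. G z \<bullet> h)) (at z)" "(G has_derivative H z) (at z)"
      using *(2,3) W[OF z] by auto
  qed (rule y)
  have lap1: "(\<Sum>b\<in>Basis. H y b \<bullet> b) = v y" if y: "snd y > 0" "norm y = 1" for y
  proof -
    have "y \<in> hemisphere" using y by (simp add: hemisphere_def)
    then have "sphere_laplacian u y = v y" using assms by (simp add: neumann_pair_def)
    then show ?thesis using d2[OF y(1)]
      unfolding sphere_laplacian_def laplacian_def N_def by simp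
  qed
  \<comment> \<open>Differentiates \<open>G (c *\<^sub>R z) = G z /\<^sub>R c\<close> at
    \<open>y\<close> in two ways, with \<open>c\<close> the inverse of the norm of
    \<open>y\<close>.\<close>
  have Hscale: "H y k = H (N y) k /\<^sub>R (norm y)\<^sup>2" if y: "y \<noteq> 0" "snd y \<ge> 0" for y k
  proof -
    define c where "c = inverse (norm y)"
    have c: "c > 0" "c *\<^sub>R y = N y" using y by (auto simp: c_def N_def)
    have yW: "y \<in> W" "N y \<in> W" using W[OF y] *(6)[OF c(1), of y] c(2) by auto
    have "((\<lambda>z. G (c *\<^sub>R z)) has_derivative (\<lambda>k. H (N y) (c *\<^sub>R k))) (at y)"
      by (rule has_derivative_compose[where g=G and f="\<lambda>z. c *\<^sub>R z"])
        (auto intro!: derivative_eq_intros *(3) simp: c(2) yW)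
    moreover have "((\<lambda>z. G (c *\<^sub>R z)) has_derivative (\<lambda>k. H y k /\<^sub>R c)) (at y)"
    proof (rule has_derivative_transform_within_open[OF _ *(1) yW(1)])
      show "((\<lambda>z. G z /\<^sub>R c) has_derivative (\<lambda>k. H y k /\<^sub>R c)) (at y)"
        by (intro derivative_intros *(3) yW)
      show "G z /\<^sub>R c = G (c *\<^sub>R z)" if "z \<in> W" for z using *(6)[OF c(1) that] by simp
    qed
    ultimately have "(\<lambda>k. H (N y) (c *\<^sub>R k)) = (\<lambda>k. H y k /\<^sub>R c)" by (rule has_derivative_unique)
    moreover have "linear (H (N y))" using *(3)[OF yW(2)] has_derivative_linear by blast
    ultimately have "c *\<^sub>R H (N y) k = H y k /\<^sub>R c" by (metis linear_scale)
    then have "c *\<^sub>R c *\<^sub>R H (N y) k = c *\<^sub>R H y k /\<^sub>R c" by simp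
    then show ?thesis using c(1) y by (simp add: c_def power2_eq_square)
  qed
  have lap: "(\<Sum>b\<in>Basis. H y b \<bullet> b) = v (y /\<^sub>R norm y) / (norm y)\<^sup>2" if y: "snd y > 0" for y
  proof -
    have y0: "y \<noteq> 0" using y by auto
    have "(\<Sum>b\<in>Basis. H y b \<bullet> b) = (\<Sum>b\<in>Basis. H (N y) b \<bullet> b) / (norm y)\<^sup>2"
      using Hscale[OF y0] y by (simp add: sum_distrib_left divide_inverse mult.commute)
    also have "(\<Sum>b\<in>Basis. H (N y) b \<bullet> b) = v (N y)"
      using y y0 N1[OF y0] by (intro lap1) (auto simp: N_def)
    finally show ?thesis by (simp add: N_def)
  qed
  \<comment> \<open>By the chain rule the derivative along the great circle is the normal component
    of \<open>G x\<close>; by the Neumann condition it is 0. The comparison is one-sided because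
    \<open>f\<close> is known to agree with \<open>u\<close> only for
    \<open>s \<le> 0\<close>.\<close>
  have bd1: "G x \<bullet> (0, 1) = 0" if x: "x \<in> hemisphere_boundary" for x
  proof -
    have "norm x = 1" "snd x = 0" using x by (auto simp: hemisphere_boundary_def)
    then have "x \<in> W" by (intro W) auto
    let ?c = "\<lambda>s::real. cos s *\<^sub>R x + sin s *\<^sub>R (0, -1)"
    have "((\<lambda>s. f (?c s)) has_derivative (\<lambda>t. G (?c 0) \<bullet> (t *\<^sub>R (0, -1)))) (at 0 within {..0})"
      by (rule has_derivative_compose[where g=f and f="?c"])
        (use \<open>x \<in> W\<close> in \<open>auto intro!: derivative_eq_intros *(2) simp flip: zero_prod_def\<close>)
    moreover have "?c 0 = x" by (simp add: prod_eq_iff)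
    moreover have "(\<lambda>t. G x \<bullet> (t *\<^sub>R (0, -1))) = (*) (G x \<bullet> (0, -1))"
      by (auto simp: inner_prod_def fun_eq_iff)
    ultimately have "((\<lambda>s. f (?c s)) has_real_derivative (G x \<bullet> (0, -1))) (at 0 within {..0})"
      unfolding has_field_derivative_def by (simp only:)
    moreover have "((\<lambda>s. f (?c s)) has_real_derivative 0) (at 0 within {..0})"
    proof (rule has_field_derivative_transform_within[where d=1])
      show "((\<lambda>s. u (?c s)) has_real_derivative 0) (at 0 within {..0})"
        using assms x by (simp add: neumann_pair_def has_normal_derivative_def)
      fix s :: real assume s: "s \<in> {..0}" "dist s 0 < 1"
      have "?c s \<in> closed_hemisphere" using great_circle_in_closed_hemisphere[OF x] s by (simp add: dist_real_def)
      then show "u (?c s) = f (?c s)"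
        by (subst fu) (auto simp: closed_hemisphere_def Nself)
    qed auto
    ultimately have "G x \<bullet> (0, -1) = 0" by (rule has_real_derivative_unique_atMost)
    then show ?thesis by (simp add: inner_prod_def)
  qed
  have bd: "G y \<bullet> (0, 1) = 0" if y: "y \<noteq> 0" "snd y = 0" for y
  proof -
    have "N y \<in> hemisphere_boundary" using N1[OF y(1)] y by (simp add: hemisphere_boundary_def N_def)
    moreover have "N y \<in> W" using N1[OF y(1)] y by (intro W) (auto simp: N_def)
    then have "G (norm y *\<^sub>R N y) = G (N y) /\<^sub>R norm y" using *(6)[of "norm y" "N y"] y by simp
    then have "G y = G (N y) /\<^sub>R norm y" using yN[OF y(1)] by simp
    ultimately show ?thesis using bd1 by simp
  qed
  show thesis
  proof (rule that)
    show "radial_extension u v W f G H" unfolding radial_extension_def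
      using *(1-5) W fu[unfolded N_def] bd lap by blast
  qed
qed

text \<open>Additivity of \<open>sphere_laplacian\<close> is not formal, since \<open>deriv\<close>
  splits over a sum only where both derivatives exist. The C^2 extensions of the two functions
  supply this.\<close>

lemma neumann_pair_linear:
  fixes u v u' v' :: "(real ^ 'n) \<times> real \<Rightarrow> real"
  assumes "neumann_pair u v" "neumann_pair u' v'"
  shows "neumann_pair (\<lambda>x. a * u x + b * u' x) (\<lambda>x. a * v x + b * v' x)"
  unfolding neumann_pair_def
proof (intro conjI allI ballI impI)
  show "a * u x + b * u' x = 0" if "x \<notin> closed_hemisphere" for x
  proof -
    have "u x = 0" "u' x = 0" using assms that unfolding neumann_pair_def by blast+
    then show ?thesis by simp
  qed
  show "C2_on (\<lambda>x. a * u x + b * u' x) closed_hemisphere"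
    using assms unfolding neumann_pair_def by (intro C2_on_add C2_on_cmult) auto
  show "has_normal_derivative (\<lambda>x. a * u x + b * u' x) 0 x" if "x \<in> hemisphere_boundary" for x
    using assms that unfolding neumann_pair_def has_normal_derivative_def
    by (auto intro!: derivative_eq_intros)
  fix x :: "(real ^ 'n) \<times> real" assume x: "x \<in> hemisphere"
  then have x0: "snd x > 0" "norm x = 1" by (auto simp: hemisphere_def)
  obtain W1 f1 G1 H1 where "radial_extension u v W1 f1 G1 H1"
    using neumann_pair_extension[OF assms(1)] .
  note 1 = radial_extensionD[OF this]
  obtain W2 f2 G2 H2 where "radial_extension u' v' W2 f2 G2 H2"
    using neumann_pair_extension[OF assms(2)] .
  note 2 = radial_extensionD[OF this]
  have y0: "y \<noteq> 0" if "snd y > 0" for y :: "(real ^ 'n) \<times> real" using that by auto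
  have "(deriv ^^ 2) (\<lambda>s. a * u ((x + s *\<^sub>R e) /\<^sub>R norm (x + s *\<^sub>R e)) + b * u' ((x + s *\<^sub>R e) /\<^sub>R norm (x + s *\<^sub>R e))) 0
    = (a *\<^sub>R H1 x e + b *\<^sub>R H2 x e) \<bullet> e" for e
  proof (rule second_derivative_along_line[where u="\<lambda>x. a * u x + b * u' x" and f="\<lambda>y. a * f1 y + b * f2 y"
        and G="\<lambda>y. a *\<^sub>R G1 y + b *\<^sub>R G2 y" and H="\<lambda>y e. a *\<^sub>R H1 y e + b *\<^sub>R H2 y e"])
    fix y :: "(real ^ 'n) \<times> real" assume y: "snd y > 0"
    then have yW: "y \<in> W1" "y \<in> W2" using 1(2) 2(2) y0 by auto
    show "a * f1 y + b * f2 y = a * u (y /\<^sub>R norm y) + b * u' (y /\<^sub>R norm y)"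
      using 1(3) 2(3) y0[OF y] y by simp
    show "((\<lambda>y. a * f1 y + b * f2 y) has_derivative (\<lambda>h. (a *\<^sub>R G1 y + b *\<^sub>R G2 y) \<bullet> h)) (at y)"
      by (rule has_derivative_eq_rhs[OF has_derivative_add[OF has_derivative_mult_right has_derivative_mult_right]])
        (use 1(4)[OF yW(1)] 2(4)[OF yW(2)] in \<open>auto simp: inner_add_left\<close>)
    show "((\<lambda>y. a *\<^sub>R G1 y + b *\<^sub>R G2 y) has_derivative (\<lambda>e. a *\<^sub>R H1 y e + b *\<^sub>R H2 y e)) (at y)"
      by (intro derivative_intros 1(5) 2(5) yW)
  qed (use x0 in auto)
  then have "sphere_laplacian (\<lambda>x. a * u x + b * u' x) x = (\<Sum>e\<in>Basis. (a *\<^sub>R H1 x e + b *\<^sub>R H2 x e) \<bullet> e)"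
    unfolding sphere_laplacian_def laplacian_def by simp
  also have "\<dots> = a * (\<Sum>e\<in>Basis. H1 x e \<bullet> e) + b * (\<Sum>e\<in>Basis. H2 x e \<bullet> e)"
    by (simp add: inner_add_left sum.distrib sum_distrib_left)
  also have "\<dots> = a * v x + b * v' x" using 1(9) 2(9) x0 by simp
  finally show "sphere_laplacian (\<lambda>x. a * u x + b * u' x) x = a * v x + b * v' x" .
qed

subsection \<open>Integrals of directional derivatives\<close>

text \<open>By translation invariance the difference quotients of \<open>F\<close> have integral \<open>0\<close>; dominated convergence
  passes to the limit.\<close>

lemma integral_directional_derivative:
  fixes F g :: "'a::euclidean_space \<Rightarrow> real"
  assumes F[measurable]: "F \<in> borel_measurable borel" and g[measurable]: "g \<in> borel_measurable borel"
    and "e \<noteq> 0" and supp: "\<And>y. norm y > R \<Longrightarrow> F y = 0"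
    and Lip: "\<And>y s. \<bar>F (y + s *\<^sub>R e) - F y\<bar> \<le> M * \<bar>s\<bar>"
    and der: "AE y in lborel. ((\<lambda>s. F (y + s *\<^sub>R e)) has_real_derivative g y) (at 0)"
  shows "integrable lborel g \<and> integral\<^sup>L lborel g = 0"
proof -
  have M: "M \<ge> 0" using Lip[of 0 1] by simp
  \<comment> \<open>A step of length \<open>\<bar>R\<bar> + R + 1\<close> along \<open>e\<close>
    leads from any point of the ball of radius \<open>R\<close> out of the support, so the Lipschitz
    bound also bounds \<open>F\<close> itself.\<close>
  define B where "B = M * \<bar>(\<bar>R\<bar> + R + 1) / norm e\<bar>"
  have B: "\<bar>F y\<bar> \<le> B" for y
  proof (cases "norm y > R")
    case True
    then show ?thesis using supp M by (simp add: B_def)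
  next
    case False
    define s where "s = (\<bar>R\<bar> + R + 1) / norm e"
    have "norm (s *\<^sub>R e) = \<bar>R\<bar> + R + 1" using \<open>e \<noteq> 0\<close> by (simp add: s_def)
    moreover have "norm (s *\<^sub>R e) \<le> norm (y + s *\<^sub>R e) + norm y"
      using norm_triangle_ineq4[of "y + s *\<^sub>R e" y] by simp
    ultimately have "norm (y + s *\<^sub>R e) > R" using False by linarith
    then have "\<bar>F y\<bar> \<le> M * \<bar>s\<bar>" using supp Lip[of y s] by simp
    then show ?thesis by (simp add: s_def B_def)
  qed
  have intF: "integrable lborel F"
  proof (rule Bochner_Integration.integrable_bound)
    show "integrable lborel (\<lambda>y. indicator (cball (0::'a) R) y *\<^sub>R B)"
      using emeasure_lborel_cball_finite[of "0::'a" R] by (simp add: less_top)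
    show "AE y in lborel. norm (F y) \<le> norm (indicator (cball 0 R) y *\<^sub>R B)"
      using B supp by (intro AE_I2) (auto simp: indicator_def not_le intro: order_trans[OF B abs_ge_self])
  qed simp
  define \<tau> where "\<tau> = (\<lambda>k. inverse (real (Suc k)))"
  define q where "q = (\<lambda>k y. (F (y + \<tau> k *\<^sub>R e) - F y) / \<tau> k)"
  \<comment> \<open>The steps \<open>\<tau> k\<close> are at most 1, so every difference quotient
    vanishes outside the ball enlarged by \<open>norm e\<close>.\<close>
  define w where "w = (\<lambda>y. indicator (cball (0::'a) (R + norm e)) y *\<^sub>R M)"
  have \<tau>: "\<tau> k > 0" "\<tau> k \<le> 1" for k by (auto simp: \<tau>_def field_simps)
  have q0: "integral\<^sup>L lborel (q k) = 0" for k
  proof -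
    let ?T = "\<lambda>y. \<tau> k *\<^sub>R e + y"
    have "integrable (distr lborel borel ?T) F" using intF by (simp add: lborel_distr_plus)
    then have "integrable lborel (\<lambda>y. F (?T y))" by (subst (asm) integrable_distr_eq) auto
    moreover have "integral\<^sup>L lborel (\<lambda>y. F (?T y)) = integral\<^sup>L lborel F"
      using integral_distr[of ?T lborel borel F] by (simp add: lborel_distr_plus)
    ultimately show ?thesis using intF by (simp add: q_def add.commute)
  qed
  have *: "integrable lborel g" "(\<lambda>k. integral\<^sup>L lborel (q k)) \<longlonglongrightarrow> integral\<^sup>L lborel g"
  proof -
    have m: "g \<in> borel_measurable lborel" "\<And>k. q k \<in> borel_measurable lborel" by (auto simp: q_def)
    have wi: "integrable lborel w"
      using emeasure_lborel_cball_finite[of "0::'a" "R + norm e"] by (simp add: w_def less_top)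
    have lim: "AE y in lborel. (\<lambda>k. q k y) \<longlonglongrightarrow> g y"
      using der
    proof eventually_elim
      case (elim y)
      have "((\<lambda>h. (F (y + h *\<^sub>R e) - F y) / h) \<longlongrightarrow> g y) (at 0)"
        using elim by (simp add: DERIV_def)
      moreover have "filterlim \<tau> (at 0) sequentially"
        unfolding filterlim_at using \<tau>(1) LIMSEQ_inverse_real_of_nat
        by (auto simp: \<tau>_def eventually_sequentially simp del: of_nat_Suc)
      ultimately show ?case unfolding q_def by (rule filterlim_compose)
    qed
    have bd: "AE y in lborel. norm (q k y) \<le> w y" for k
    proof (rule AE_I2)
      fix y :: 'a
      show "norm (q k y) \<le> w y"
      proof (cases "norm y \<le> R + norm e")
        case True
        then show ?thesis using Lip[of y "\<tau> k"] \<tau>[of k] by (simp add: w_def q_def field_simps abs_divide)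
      next
        case False
        have "norm y \<le> norm (y + \<tau> k *\<^sub>R e) + norm (\<tau> k *\<^sub>R e)"
          using norm_triangle_ineq4[of "y + \<tau> k *\<^sub>R e" "\<tau> k *\<^sub>R e"] by simp
        also have "norm (\<tau> k *\<^sub>R e) \<le> norm e" using \<tau>[of k] by (simp add: mult_left_le_one_le)
        finally have "norm (y + \<tau> k *\<^sub>R e) > R" using False by simp
        moreover have "norm y > R" using False norm_ge_zero[of e] by linarith
        ultimately show ?thesis using supp M by (simp add: q_def w_def)
      qed
    qed
    show "integrable lborel g" by (rule integrable_dominated_convergence[OF m wi lim bd])
    show "(\<lambda>k. integral\<^sup>L lborel (q k)) \<longlonglongrightarrow> integral\<^sup>L lborel g"
      by (rule integral_dominated_convergence[OF m wi lim bd])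
  qed
  then show ?thesis using LIMSEQ_unique[of "\<lambda>k. 0" 0 "integral\<^sup>L lborel g"] by (simp add: q0)
qed

lemma AE_snd_neq_0: "AE y in lborel. snd (y :: (real ^ 'n) \<times> real) \<noteq> 0"
proof -
  have "negligible {y :: (real ^ 'n) \<times> real. (0, 1) \<bullet> y = 0}"
    by (rule negligible_hyperplane) (simp add: zero_prod_def)
  then have "negligible {y :: (real ^ 'n) \<times> real. snd y = 0}" by (simp add: inner_prod_def)
  moreover have "closed {y :: (real ^ 'n) \<times> real. snd y = 0}" by (intro closed_Collect_eq continuous_intros)
  ultimately have "{y :: (real ^ 'n) \<times> real. snd y = 0} \<in> null_sets lborel"
    by (simp add: negligible_iff_null_sets null_sets_completion_iff)
  then show ?thesis by (rule AE_I') auto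
qed

text \<open>Extended by 0 below the boundary, \<open>\<Phi>\<close> may jump, yet it stays Lipschitz
  along \<open>e\<close>: a horizontal line never crosses the boundary, and for the vertical
  direction \<open>\<Phi>\<close> vanishes there. Differentiability fails at most on the null set
  \<open>snd y = 0\<close>, which the almost-everywhere hypothesis of the previous integral lemma
  tolerates.\<close>

lemma integral_halfspace_derivative:
  fixes \<Phi> D :: "(real ^ 'n) \<times> real \<Rightarrow> real"
  assumes e: "e \<in> Basis"
    and der: "\<And>y. snd y \<ge> 0 \<Longrightarrow> ((\<lambda>s. \<Phi> (y + s *\<^sub>R e)) has_real_derivative D y) (at 0)"
    and c: "continuous_on {y. snd y > 0} \<Phi>" "continuous_on {y. snd y > 0} D"
    and bd: "\<And>y. snd y \<ge> 0 \<Longrightarrow> \<bar>D y\<bar> \<le> M"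
    and supp: "\<And>y. snd y \<ge> 0 \<Longrightarrow> norm y > R \<Longrightarrow> \<Phi> y = 0"
    and bdry: "\<And>y. snd e \<noteq> 0 \<Longrightarrow> snd y = 0 \<Longrightarrow> \<Phi> y = 0"
  shows "integrable lborel (\<lambda>y. indicator {y. snd y > 0} y *\<^sub>R D y) \<and>
    integral\<^sup>L lborel (\<lambda>y. indicator {y. snd y > 0} y *\<^sub>R D y) = 0"
proof -
  let ?H = "{y :: (real ^ 'n) \<times> real. snd y > 0}"
  have opH: "open ?H" by (intro open_Collect_less continuous_intros)
  have e01: "snd e = 0 \<or> snd e = 1" using e by (auto simp: Basis_prod_def)
  define F where "F = (\<lambda>y. indicator ?H y *\<^sub>R \<Phi> y)"
  have FM: "F \<in> borel_measurable borel" "(\<lambda>y. indicator ?H y *\<^sub>R D y) \<in> borel_measurable borel"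
    unfolding F_def using opH by (intro borel_measurable_continuous_on_indicator c; simp)+
  have M: "M \<ge> 0" using bd[of 0] by simp
  have L: "\<bar>\<Phi> (y + s *\<^sub>R e) - \<Phi> y\<bar> \<le> M * \<bar>s\<bar>" if y: "snd y \<ge> 0" "snd (y + s *\<^sub>R e) \<ge> 0" for y s
  proof -
    have "norm (\<Phi> (y + s *\<^sub>R e) - \<Phi> (y + 0 *\<^sub>R e)) \<le> M * norm (s - 0)"
    proof (rule field_differentiable_bound[where S="closed_segment 0 s" and f="\<lambda>s. \<Phi> (y + s *\<^sub>R e)"
          and f'="\<lambda>s. D (y + s *\<^sub>R e)"])
      fix t assume t: "t \<in> closed_segment 0 s"
      have "0 \<le> snd y + t * snd e"
      proof -
        obtain r where r: "0 \<le> r" "r \<le> 1" "t = r * s" using t by (auto simp: closed_segment_def)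
        have "snd y + t * snd e = (1 - r) * snd y + r * (snd y + s * snd e)"
          by (simp add: r(3) algebra_simps)
        moreover have "0 \<le> (1 - r) * snd y" "0 \<le> r * (snd y + s * snd e)"
          using r(1,2) y mult_nonneg_nonneg[of "1 - r" "snd y"] mult_nonneg_nonneg[of r "snd y + s * snd e"] by auto
        ultimately show ?thesis by linarith
      qed
      then have yt: "snd (y + t *\<^sub>R e) \<ge> 0" by simp
      show "norm (D (y + t *\<^sub>R e)) \<le> M" using bd[OF yt] by simp
      have "((\<lambda>s. \<Phi> (y + (s + t) *\<^sub>R e)) has_real_derivative D (y + t *\<^sub>R e)) (at 0)"
        using der[OF yt] by (simp add: scaleR_add_left ac_simps)
      then have "((\<lambda>s. \<Phi> (y + s *\<^sub>R e)) has_real_derivative D (y + t *\<^sub>R e)) (at t)"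
        using DERIV_shift[of "\<lambda>s. \<Phi> (y + s *\<^sub>R e)" "D (y + t *\<^sub>R e)" 0 t] by simp
      then show "((\<lambda>s. \<Phi> (y + s *\<^sub>R e)) has_real_derivative D (y + t *\<^sub>R e)) (at t within closed_segment 0 s)"
        by (rule has_field_derivative_at_within)
    qed auto
    then show ?thesis by simp
  qed
  have Lip1: "\<bar>F (y + s *\<^sub>R e) - F y\<bar> \<le> M * \<bar>s\<bar>" if y: "snd y > 0" for y s
  proof (cases "snd (y + s *\<^sub>R e) > 0")
    case True
    then show ?thesis using L[of y s] y by (simp add: F_def)
  next
    case False
    with y e01 have e1: "snd e = 1" by auto
    \<comment> \<open>The point at which the vertical line leaves the half-space; it is reached
      within distance \<open>\<bar>s\<bar>\<close>.\<close>
    have "\<Phi> (y + (- snd y) *\<^sub>R e) = 0" using e1 by (intro bdry) auto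
    with L[of y "- snd y"] y e1 have "\<bar>\<Phi> y\<bar> \<le> M * snd y" by simp
    also have "\<dots> \<le> M * \<bar>s\<bar>" using False e1 M by (intro mult_left_mono) auto
    finally show ?thesis using False y by (simp add: F_def)
  qed
  have Lip: "\<bar>F (y + s *\<^sub>R e) - F y\<bar> \<le> M * \<bar>s\<bar>" for y s
  proof (cases "snd y > 0 \<or> snd (y + s *\<^sub>R e) > 0")
    case True
    then show ?thesis using Lip1[of y s] Lip1[of "y + s *\<^sub>R e" "- s"] by (auto simp: abs_minus_commute)
  next
    case False
    then show ?thesis using M by (simp add: F_def)
  qed
  show ?thesis
  proof (rule integral_directional_derivative[OF FM])
    show "e \<noteq> 0" using e by auto
    show "F y = 0" if "norm y > R" for y using supp[OF _ that] by (auto simp: F_def indicator_def)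
    show "AE y in lborel. ((\<lambda>s. F (y + s *\<^sub>R e)) has_real_derivative indicator ?H y *\<^sub>R D y) (at 0)"
      using AE_snd_neq_0
    proof eventually_elim
      case (elim y)
      show ?case
      proof (cases "snd y > 0")
        case True
        have "open {s. 0 < snd (y + s *\<^sub>R e)}" by (intro open_Collect_less continuous_intros)
        from has_field_derivative_transform_within_open[OF der this]
        show ?thesis using True by (simp add: F_def)
      next
        case False
        have "open {s. snd (y + s *\<^sub>R e) < 0}" by (intro open_Collect_less continuous_intros)
        from has_field_derivative_transform_within_open[OF DERIV_const this, of 0 0]
        show ?thesis using False elim by (simp add: F_def)
      qed
    qed
  qed (rule Lip)
qed

subsection \<open>Green's identity\<close>

lemma DERIV_positive_part_square: "((\<lambda>x::real. (max 0 x)\<^sup>2) has_real_derivative 2 * max 0 x) (at x)"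
proof -
  consider "x > 0" | "x < 0" | "x = 0" by linarith
  then show ?thesis
  proof cases
    case 1
    have "((\<lambda>x::real. x\<^sup>2) has_real_derivative 2 * max 0 x) (at x)"
      using 1 by (auto intro!: derivative_eq_intros)
    from has_field_derivative_transform_within_open[OF this, of "{0<..}"] show ?thesis using 1 by auto
  next
    case 2
    have "((\<lambda>x::real. 0) has_real_derivative 2 * max 0 x) (at x)" using 2 by auto
    from has_field_derivative_transform_within_open[OF this, of "{..<0}"] show ?thesis using 2 by auto
  next
    case 3
    have "isCont (\<lambda>x::real. max 0 x) 0" by (intro continuous_intros)
    then show ?thesis unfolding 3 CARAT_DERIV
      by (intro exI[where x="\<lambda>x. max 0 x"]) (auto simp: max_def power2_eq_square)
  qed
qed

text \<open>A cutoff in the squared norm: its support \<open>1 \<le> s \<le> 4\<close> is the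
  annulus between the radii 1 and 2. Squaring the positive part makes it of class C^1, which
  suffices because the divergence differentiates it once.\<close>

definition bump :: "real \<Rightarrow> real" where "bump s = (max 0 ((s - 1) * (4 - s)))\<^sup>2"

definition bump_deriv :: "real \<Rightarrow> real" where
  "bump_deriv s = 2 * max 0 ((s - 1) * (4 - s)) * (5 - 2 * s)"

lemma DERIV_bump: "(bump has_real_derivative bump_deriv s) (at s)"
proof -
  have "((\<lambda>s. (s - 1) * (4 - s)) has_real_derivative 5 - 2 * s) (at s)"
    by (auto intro!: derivative_eq_intros simp: algebra_simps)
  from DERIV_chain2[OF DERIV_positive_part_square this]
  show ?thesis by (simp add: bump_def[abs_def] bump_deriv_def)
qed

lemma bump_nonneg: "bump s \<ge> 0" by (simp add: bump_def)

lemma bump_pos: "1 < s \<Longrightarrow> s < 4 \<Longrightarrow> bump s > 0" by (simp add: bump_def)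

lemma bump_eq_0:
  assumes "s \<le> 1 \<or> s \<ge> 4" shows "bump s = 0" "bump_deriv s = 0"
proof -
  have "(s - 1) * (4 - s) \<le> 0" using assms by (auto simp: mult_le_0_iff)
  then show "bump s = 0" "bump_deriv s = 0" by (auto simp: bump_def bump_deriv_def)
qed

lemma continuous_on_bump: "continuous_on A f \<Longrightarrow> continuous_on A (\<lambda>x. bump (f x))"
  unfolding bump_def by (intro continuous_intros)

lemma continuous_on_bump_deriv: "continuous_on A f \<Longrightarrow> continuous_on A (\<lambda>x. bump_deriv (f x))"
  unfolding bump_deriv_def by (intro continuous_intros)

lemma bump_inner_eq_0:
  fixes y :: "'a::real_inner"
  assumes "norm y \<le> 1 \<or> norm y \<ge> 2" shows "bump (y \<bullet> y) = 0" "bump_deriv (y \<bullet> y) = 0"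
proof -
  have "y \<bullet> y \<le> 1 \<or> y \<bullet> y \<ge> 4"
    using assms power_mono[of "norm y" 1 2] power_mono[of 2 "norm y" 2] by (auto simp: dot_square_norm)
  then show "bump (y \<bullet> y) = 0" "bump_deriv (y \<bullet> y) = 0" by (rule bump_eq_0)+
qed

lemma has_real_derivative_along_line:
  fixes f :: "'a::real_inner \<Rightarrow> real"
  assumes "(f has_derivative (\<lambda>h. G \<bullet> h)) (at y)"
  shows "((\<lambda>s. f (y + s *\<^sub>R e)) has_real_derivative G \<bullet> e) (at 0)"
proof -
  have "((\<lambda>s. f (y + s *\<^sub>R e)) has_derivative (\<lambda>t. G \<bullet> (t *\<^sub>R e))) (at 0)"
    by (rule has_derivative_compose[where g=f and f="\<lambda>s. y + s *\<^sub>R e"])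
      (use assms in \<open>auto intro!: derivative_eq_intros\<close>)
  moreover have "(\<lambda>t. G \<bullet> (t *\<^sub>R e)) = (*) (G \<bullet> e)" by (auto simp: fun_eq_iff)
  ultimately show ?thesis unfolding has_field_derivative_def by (simp only:)
qed

lemma has_real_derivative_gradient_along_line:
  fixes G :: "'a::real_inner \<Rightarrow> 'a"
  assumes "(G has_derivative H) (at y)"
  shows "((\<lambda>s. G (y + s *\<^sub>R e) \<bullet> e) has_real_derivative H e \<bullet> e) (at 0)"
proof -
  have "((\<lambda>s. G (y + s *\<^sub>R e)) has_derivative (\<lambda>t. H (t *\<^sub>R e))) (at 0)"
    by (rule has_derivative_compose[where g=G and f="\<lambda>s. y + s *\<^sub>R e"])
      (use assms in \<open>auto intro!: derivative_eq_intros\<close>)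
  from has_derivative_inner_left[OF this, of e]
  have "((\<lambda>s. G (y + s *\<^sub>R e) \<bullet> e) has_derivative (\<lambda>t. H (t *\<^sub>R e) \<bullet> e)) (at 0)" .
  moreover have "(\<lambda>t. H (t *\<^sub>R e) \<bullet> e) = (*) (H e \<bullet> e)"
    using has_derivative_linear[OF assms] by (auto simp: fun_eq_iff linear_scale)
  ultimately show ?thesis unfolding has_field_derivative_def by (simp only:)
qed

text \<open>The fields \<open>bump (|y|\<^sup>2) (U \<partial>\<^sub>e V - V \<partial>\<^sub>e U)\<close>, with \<open>U\<close>, \<open>V\<close> the extensions homogeneous of degree \<open>0\<close>,
  are compactly supported away from the origin, and the normal one vanishes on the boundary of the
  half-space. In the divergence the terms with \<open>bump_deriv\<close> drop out since \<open>U\<close> and \<open>V\<close> have no radial derivative.\<close>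

lemma neumann_green:
  fixes u v u' v' :: "(real ^ 'n) \<times> real \<Rightarrow> real"
  assumes "neumann_pair u v" "neumann_pair u' v'"
  defines "N \<equiv> \<lambda>y :: (real ^ 'n) \<times> real. y /\<^sub>R norm y"
  shows "integral\<^sup>L lborel (\<lambda>y. indicator {y. snd y > 0} y *\<^sub>R
    (bump (y \<bullet> y) / (norm y)\<^sup>2 * (u (N y) * v' (N y) - u' (N y) * v (N y)))) = 0"
proof -
  obtain W1 f1 G1 H1 where "radial_extension u v W1 f1 G1 H1"
    using neumann_pair_extension[OF assms(1)] .
  note 1 = radial_extensionD[OF this]
  obtain W2 f2 G2 H2 where "radial_extension u' v' W2 f2 G2 H2"
    using neumann_pair_extension[OF assms(2)] .
  note 2 = radial_extensionD[OF this]
  define S where "S = (\<lambda>e y. f1 y * (G2 y \<bullet> e) - f2 y * (G1 y \<bullet> e))"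
  define \<Phi> where "\<Phi> = (\<lambda>e y. bump (y \<bullet> y) * S e y)"
  \<comment> \<open>The derivative of \<open>\<Phi> e\<close> along \<open>e\<close>. The two terms
    \<open>(G1 y \<bullet> e) * (G2 y \<bullet> e)\<close> from differentiating \<open>S\<close>
    cancel by antisymmetry.\<close>
  define D where "D = (\<lambda>e y. bump_deriv (y \<bullet> y) * (2 * (y \<bullet> e)) * S e y +
     bump (y \<bullet> y) * (f1 y * (H2 y e \<bullet> e) - f2 y * (H1 y e \<bullet> e)))"
  have cont: "continuous_on W1 f1" "continuous_on W1 G1" "continuous_on W2 f2" "continuous_on W2 G2"
    using 1(4,5) 2(4,5) by (meson continuous_at_imp_continuous_on has_derivative_continuous)+
  have cS: "continuous_on (W1 \<inter> W2) (S e)" for e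
    unfolding S_def by (intro continuous_intros continuous_on_subset[OF cont(1)] continuous_on_subset[OF cont(2)]
      continuous_on_subset[OF cont(3)] continuous_on_subset[OF cont(4)]) auto
  have c\<Phi>: "continuous_on (W1 \<inter> W2) (\<Phi> e)" for e
    unfolding \<Phi>_def by (intro continuous_intros continuous_on_bump cS)
  have cD: "continuous_on (W1 \<inter> W2) (D e)" for e
    unfolding D_def by (intro continuous_intros continuous_on_bump continuous_on_bump_deriv cS continuous_on_subset[OF cont(1)]
      continuous_on_subset[OF cont(3)] continuous_on_subset[OF 1(6)] continuous_on_subset[OF 2(6)]) auto
  have HW: "{y. snd y > 0} \<subseteq> W1 \<inter> W2" using 1(2) 2(2) by (auto simp: zero_prod_def)
  have D0: "D e y = 0" "\<Phi> e y = 0" if "norm y \<le> 1 \<or> norm y \<ge> 2" for e y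
    using bump_inner_eq_0[OF that] by (auto simp: D_def \<Phi>_def)
  have der: "((\<lambda>s. \<Phi> e (y + s *\<^sub>R e)) has_real_derivative D e y) (at 0)" if y: "snd y \<ge> 0" for e y
  \<comment> \<open>The extensions are not controlled at the origin, but inside the unit ball the
    bump vanishes on a neighbourhood.\<close>
  proof (cases "norm y < 1")
    case True
    have "open {s. norm (y + s *\<^sub>R e) < 1}" by (intro open_Collect_less continuous_intros)
    from has_field_derivative_transform_within_open[OF DERIV_const this, of 0 0]
    show ?thesis using True D0[of y e] D0 by simp
  next
    case False
    then have "y \<noteq> 0" by auto
    then have yW: "y \<in> W1" "y \<in> W2" using 1(2) 2(2) y by auto
    have b: "((\<lambda>s. bump ((y + s *\<^sub>R e) \<bullet> (y + s *\<^sub>R e))) has_real_derivative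
        bump_deriv (y \<bullet> y) * (2 * (y \<bullet> e))) (at 0)"
    proof (rule DERIV_chain2[of bump])
      show "(bump has_real_derivative bump_deriv (y \<bullet> y)) (at ((y + 0 *\<^sub>R e) \<bullet> (y + 0 *\<^sub>R e)))"
        using DERIV_bump by simp
      show "((\<lambda>s. (y + s *\<^sub>R e) \<bullet> (y + s *\<^sub>R e)) has_real_derivative 2 * (y \<bullet> e)) (at 0)"
        by (auto simp: inner_add_left inner_add_right inner_commute intro!: derivative_eq_intros)
    qed
    note ds = has_real_derivative_along_line[OF 1(4)[OF yW(1)], of e] has_real_derivative_along_line[OF 2(4)[OF yW(2)], of e]
      has_real_derivative_gradient_along_line[OF 1(5)[OF yW(1)], of e] has_real_derivative_gradient_along_line[OF 2(5)[OF yW(2)], of e]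
    show ?thesis unfolding \<Phi>_def S_def D_def
      by (rule DERIV_cong[OF DERIV_mult[OF b DERIV_diff[OF DERIV_mult[OF ds(1,4)] DERIV_mult[OF ds(2,3)]]]])
        (simp add: algebra_simps)
  qed
  \<comment> \<open>\<open>D\<close> vanishes on the half-space outside this compact half-annulus,
    so a bound there is a global one.\<close>
  let ?A = "{y :: (real ^ 'n) \<times> real. snd y \<ge> 0 \<and> 1 \<le> norm y \<and> norm y \<le> 2}"
  have "closed ?A" by (intro closed_Collect_conj closed_Collect_le continuous_intros)
  moreover have "bounded ?A" unfolding bounded_iff by auto
  ultimately have cA: "compact ?A" by (simp add: compact_eq_bounded_closed)
  have AW: "?A \<subseteq> W1 \<inter> W2" using 1(2) 2(2) by (auto simp: norm_le_zero_iff[symmetric] simp del: norm_le_zero_iff)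
  have "\<exists>M. \<forall>y. snd y \<ge> 0 \<longrightarrow> \<bar>D e y\<bar> \<le> M" for e
  proof -
    have "bounded (D e ` ?A)"
      by (intro compact_imp_bounded compact_continuous_image continuous_on_subset[OF cD AW] cA)
    then obtain M where M: "M > 0" "\<And>y. y \<in> ?A \<Longrightarrow> \<bar>D e y\<bar> \<le> M" unfolding bounded_pos by auto
    have "\<bar>D e y\<bar> \<le> M" if "snd y \<ge> 0" for y
      using M D0(1)[of y e] that by (cases "y \<in> ?A") auto
    then show ?thesis by blast
  qed
  then obtain M where M: "\<And>e y. snd y \<ge> 0 \<Longrightarrow> \<bar>D e y\<bar> \<le> M e" by metis
  have int: "integrable lborel (\<lambda>y. indicator {y. snd y > 0} y *\<^sub>R D e y) \<and>
    integral\<^sup>L lborel (\<lambda>y. indicator {y. snd y > 0} y *\<^sub>R D e y) = 0" if e: "e \<in> Basis" for e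
  proof (rule integral_halfspace_derivative[where \<Phi>="\<Phi> e" and M="M e" and R=2, OF e])
    show "\<Phi> e y = 0" if "snd e \<noteq> 0" "snd y = 0" for y
    proof (cases "y = 0")
      case True
      then show ?thesis using D0 by simp
    next
      case False
      have "e = (0, 1)" using e that by (auto simp: Basis_prod_def)
      then show ?thesis using 1(8)[OF False] 2(8)[OF False] that by (simp add: \<Phi>_def S_def)
    qed
  qed (use der M D0 continuous_on_subset[OF c\<Phi> HW] continuous_on_subset[OF cD HW] in auto)
  have sum: "(\<Sum>e\<in>Basis. D e y) = bump (y \<bullet> y) / (norm y)\<^sup>2 * (u (N y) * v' (N y) - u' (N y) * v (N y))"
    if y: "snd y > 0" for y
  proof -
    have y0: "y \<noteq> 0" "snd y \<ge> 0" using y by auto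
    have "(\<Sum>e\<in>Basis. (y \<bullet> e) * S e y) = f1 y * (G2 y \<bullet> y) - f2 y * (G1 y \<bullet> y)"
      unfolding S_def euclidean_inner[of "G2 y" y] euclidean_inner[of "G1 y" y]
      by (simp add: sum_subtractf sum_distrib_left algebra_simps)
    also have "\<dots> = 0" using 1(7)[OF 1(2)[OF y0]] 2(7)[OF 2(2)[OF y0]] by simp
    finally have s1: "(\<Sum>e\<in>Basis. (y \<bullet> e) * S e y) = 0" .
    have "(\<Sum>e\<in>Basis. D e y) = 2 * bump_deriv (y \<bullet> y) * (\<Sum>e\<in>Basis. (y \<bullet> e) * S e y) +
      bump (y \<bullet> y) * (f1 y * (\<Sum>e\<in>Basis. H2 y e \<bullet> e) - f2 y * (\<Sum>e\<in>Basis. H1 y e \<bullet> e))"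
      unfolding D_def by (simp add: sum.distrib sum_subtractf sum_distrib_left algebra_simps)
    then show ?thesis unfolding N_def using s1 1(3)[OF y0] 2(3)[OF y0] 1(9)[OF y] 2(9)[OF y]
      by (simp add: diff_divide_distrib algebra_simps)
  qed
  have "integral\<^sup>L lborel (\<lambda>y. \<Sum>e\<in>Basis. indicator {y. snd y > 0} y *\<^sub>R D e y) = 0"
    using int by (subst Bochner_Integration.integral_sum) auto
  also have "(\<lambda>y. \<Sum>e\<in>Basis. indicator {y. snd y > 0} y *\<^sub>R D e y) =
     (\<lambda>y. indicator {y. snd y > 0} y *\<^sub>R
    (bump (y \<bullet> y) / (norm y)\<^sup>2 * (u (N y) * v' (N y) - u' (N y) * v (N y))))"
    using sum by (auto simp: fun_eq_iff indicator_def)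
  finally show ?thesis .
qed

subsection \<open>Monomials on the hemisphere\<close>

definition monomial :: "('n::finite \<Rightarrow> nat) \<Rightarrow> (real ^ 'n) \<times> real \<Rightarrow> real" where
  "monomial \<beta> x = (\<Prod>i\<in>UNIV. (fst x $ i) ^ \<beta> i)"

definition hemisphere_monomial :: "('n::finite \<Rightarrow> nat) \<Rightarrow> (real ^ 'n) \<times> real \<Rightarrow> real" where
  "hemisphere_monomial \<beta> x = (if x \<in> closed_hemisphere then monomial \<beta> x else 0)"

lemma monomial_scaleR: "monomial \<beta> (c *\<^sub>R x) = c ^ sum \<beta> UNIV * monomial \<beta> x"
  by (simp add: monomial_def power_mult_distrib prod.distrib power_sum)

lemma monomial_snd: "fst x = fst y \<Longrightarrow> monomial \<beta> x = monomial \<beta> y"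
  by (simp add: monomial_def)

lemma monomial_split: "monomial \<beta> x = (\<Prod>j\<in>-{i}. (fst x $ j) ^ \<beta> j) * (fst x $ i) ^ \<beta> i"
  unfolding monomial_def by (subst prod.remove[of _ i]) (auto simp: Compl_eq_Diff_UNIV mult.commute)

lemma C2_on_open_monomial: "C2_on_open (monomial \<beta>) UNIV"
proof -
  have "C2_on_open (\<lambda>x. \<Prod>i\<in>UNIV. (x \<bullet> (axis i 1, 0)) ^ \<beta> i) (UNIV :: ((real ^ 'a) \<times> real) set)"
    by (intro C2_on_open_prod C2_on_open_power C2_on_open_inner) auto
  moreover have "x \<bullet> (axis i 1, 0) = fst x $ i" for x :: "(real ^ 'a) \<times> real" and i
    by (simp add: inner_prod_def inner_axis)
  ultimately show ?thesis by (simp add: monomial_def[abs_def])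
qed

lemma sum_Basis_vec_prod:
  fixes f :: "(real ^ 'n) \<times> real \<Rightarrow> 'b::comm_monoid_add"
  shows "sum f Basis = (\<Sum>i\<in>UNIV. f (axis i 1, 0)) + f (0, 1)"
proof -
  have B: "(Basis :: ((real ^ 'n) \<times> real) set) = range (\<lambda>i. (axis i 1, 0)) \<union> {(0, 1)}"
    by (auto simp: Basis_prod_def Basis_vec_def)
  have "inj (\<lambda>i::'n. (axis i (1::real), 0::real))" by (auto simp: inj_on_def axis_eq_axis)
  then show ?thesis unfolding B
    by (subst sum.union_disjoint) (auto simp: sum.reindex axis_eq_axis)
qed

text \<open>The shape of a normalised monomial on a line through a unit vector in a coordinate
  direction: \<open>(a + s) ^ k\<close> comes from the coordinate that moves, the quadratic is the
  squared norm, and its power comes from homogeneity of degree \<open>d\<close>.\<close>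

lemma deriv2_power_quadratic:
  fixes a c :: real and k d :: nat
  assumes S: "open S" "0 \<in> S" "\<And>s. s \<in> S \<Longrightarrow> 1 + 2 * a * s + s\<^sup>2 > 0"
    and \<phi>: "\<And>s. s \<in> S \<Longrightarrow> \<phi> s = c * ((a + s) ^ k * (1 + 2 * a * s + s\<^sup>2) powr (- (real d / 2)))"
  shows "(deriv ^^ 2) \<phi> 0 = c * (real k * (real k - 1) * a ^ (k - 2) +
    a ^ k * (- 2 * real d * real k - real d + real d * (real d + 2) * a\<^sup>2))"
proof -
  define p where "p = - (real d / 2)"
  let ?Q = "\<lambda>s. 1 + 2 * a * s + s\<^sup>2"
  have Q: "(?Q has_real_derivative 2 * a + 2 * s) (at s)" for s
    by (auto intro!: derivative_eq_intros)
  have Qp: "((\<lambda>s. ?Q s powr q) has_real_derivative q * ?Q s powr (q - 1) * (2 * a + 2 * s)) (at s)"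
    if "s \<in> S" for s q
    using DERIV_chain2[OF DERIV_powr[OF DERIV_ident S(3)[OF that] DERIV_const] Q, of q] S(3)[OF that]
    by (simp add: powr_diff mult_ac)
  have pw: "((\<lambda>s. (a + s) ^ m) has_real_derivative real m * (a + s) ^ (m - 1)) (at s)" for m s
    by (auto intro!: derivative_eq_intros)
  show ?thesis
  proof (rule deriv2_eqI[OF S(1,2)])
    fix s assume s: "s \<in> S"
    show "(\<phi> has_real_derivative c * (real k * (a + s) ^ (k - 1) * ?Q s powr p +
        (a + s) ^ k * (p * ?Q s powr (p - 1) * (2 * a + 2 * s)))) (at s)"
    proof (rule has_field_derivative_transform_within_open[OF _ S(1) s])
      show "((\<lambda>s. c * ((a + s) ^ k * ?Q s powr p)) has_real_derivative c * (real k * (a + s) ^ (k - 1) * ?Q s powr p +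
        (a + s) ^ k * (p * ?Q s powr (p - 1) * (2 * a + 2 * s)))) (at s)"
        by (rule DERIV_cong[OF DERIV_cmult[OF DERIV_mult[OF pw Qp[OF s]]]]) (simp add: algebra_simps)
    qed (simp add: \<phi> p_def)
  next
    have lin: "((\<lambda>s. 2 * a + 2 * s) has_real_derivative 2) (at 0)" by (auto intro!: derivative_eq_intros)
    have A: "((\<lambda>s. c * (real k * ((a + s) ^ (k - 1) * ?Q s powr p) +
        (a + s) ^ k * (p * (?Q s powr (p - 1) * (2 * a + 2 * s))))) has_real_derivative
       c * (real k * (real (k - 1) * a ^ (k - 1 - 1) + a ^ (k - 1) * (p * (2 * a))) +
        (real k * a ^ (k - 1) * (p * (2 * a)) + a ^ k * (p * ((p - 1) * (2 * a) * (2 * a) + 2))))) (at 0)"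
      by (rule DERIV_cong[OF DERIV_cmult[OF DERIV_add[OF DERIV_cmult[OF DERIV_mult[OF pw Qp[OF S(2)]]]
          DERIV_mult[OF pw DERIV_cmult[OF DERIV_mult[OF Qp[OF S(2)] lin]]]]]]) (simp add: algebra_simps)
    \<comment> \<open>Truncated and real subtraction differ at \<open>k = 0\<close>; the factor
      \<open>real k\<close> absorbs the difference.\<close>
    have B: "real k * (real (k - 1) * a ^ (k - 1 - 1) + a ^ (k - 1) * (p * (2 * a))) +
        (real k * a ^ (k - 1) * (p * (2 * a)) + a ^ k * (p * ((p - 1) * (2 * a) * (2 * a) + 2))) =
      real k * (real k - 1) * a ^ (k - 2) +
      a ^ k * (- 2 * real d * real k - real d + real d * (real d + 2) * a\<^sup>2)"
      by (cases k) (auto simp: p_def field_simps power2_eq_square)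
    show "((\<lambda>s. c * (real k * (a + s) ^ (k - 1) * ?Q s powr p +
        (a + s) ^ k * (p * ?Q s powr (p - 1) * (2 * a + 2 * s)))) has_real_derivative
      c * (real k * (real k - 1) * a ^ (k - 2) +
      a ^ k * (- 2 * real d * real k - real d + real d * (real d + 2) * a\<^sup>2))) (at 0)"
      using A unfolding B by (simp only: mult.assoc)
  qed
qed

lemma norm_axis_line:
  fixes x b :: "'a::euclidean_space"
  assumes "norm x = 1" "b \<in> Basis"
  shows "(norm (x + s *\<^sub>R b))\<^sup>2 = 1 + 2 * (x \<bullet> b) * s + s\<^sup>2"
proof -
  have "x \<bullet> x = 1" using assms by (simp add: dot_square_norm)
  then show ?thesis using assms(2) unfolding power2_norm_eq_inner
    by (simp add: inner_add_left inner_add_right inner_commute power2_eq_square)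
qed

text \<open>The hypothesis on \<open>monomial\<close> treats both kinds of basis vectors at once:
  \<open>k = \<beta> i\<close> for the i-th axis, and \<open>k = 0\<close> for the last coordinate,
  on which monomials do not depend.\<close>

lemma monomial_second_derivative:
  fixes x b :: "(real ^ 'n) \<times> real" and \<beta> :: "'n::finite \<Rightarrow> nat"
  assumes x: "x \<in> hemisphere" and b: "b \<in> Basis"
    and m: "\<And>s. monomial \<beta> (x + s *\<^sub>R b) = c * ((x \<bullet> b) + s) ^ k"
  defines "d \<equiv> sum \<beta> UNIV"
  shows "(deriv ^^ 2) (\<lambda>s. hemisphere_monomial \<beta> ((x + s *\<^sub>R b) /\<^sub>R norm (x + s *\<^sub>R b))) 0 =
    c * (real k * (real k - 1) * (x \<bullet> b) ^ (k - 2) +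
    (x \<bullet> b) ^ k * (- 2 * real d * real k - real d + real d * (real d + 2) * (x \<bullet> b)\<^sup>2))"
proof (rule deriv2_power_quadratic[where S="{s. snd (x + s *\<^sub>R b) > 0}"])
  have x0: "snd x > 0" "norm x = 1" using x by (auto simp: hemisphere_def)
  show "open {s. snd (x + s *\<^sub>R b) > 0}" by (intro open_Collect_less continuous_intros)
  show "0 \<in> {s. snd (x + s *\<^sub>R b) > 0}" using x0 by simp
  fix s assume s: "s \<in> {s. snd (x + s *\<^sub>R b) > 0}"
  let ?y = "x + s *\<^sub>R b"
  have y0: "?y \<noteq> 0" using s by force
  have Q: "1 + 2 * (x \<bullet> b) * s + s\<^sup>2 = (norm ?y)\<^sup>2" using norm_axis_line[OF x0(2) b] by simp
  show "1 + 2 * (x \<bullet> b) * s + s\<^sup>2 > 0" unfolding Q using y0 by simp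
  have "(1 + 2 * (x \<bullet> b) * s + s\<^sup>2) powr (- (real d / 2)) = inverse (norm ?y) ^ d"
  proof -
    have "(norm ?y)\<^sup>2 = norm ?y powr 2" using y0 by (simp add: powr_numeral)
    then have "((norm ?y)\<^sup>2) powr (- (real d / 2)) = norm ?y powr (- real d)" by (simp only: powr_powr) simp
    also have "\<dots> = inverse (norm ?y) ^ d" using y0 by (simp add: powr_minus powr_realpow power_inverse)
    finally show ?thesis unfolding Q .
  qed
  moreover have "?y /\<^sub>R norm ?y \<in> closed_hemisphere"
  proof -
    have "norm (?y /\<^sub>R norm ?y) = 1" using y0 by simp
    moreover have "snd (?y /\<^sub>R norm ?y) \<ge> 0" using s by simp
    ultimately show ?thesis unfolding closed_hemisphere_def by blast
  qed
  ultimately show "hemisphere_monomial \<beta> (?y /\<^sub>R norm ?y) =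
    c * (((x \<bullet> b) + s) ^ k * (1 + 2 * (x \<bullet> b) * s + s\<^sup>2) powr (- (real d / 2)))"
    unfolding hemisphere_monomial_def by (simp add: monomial_scaleR m d_def)
qed

text \<open>Summing over the basis, the pure second derivatives give the Euclidean Laplacian of the
  monomial. The exponents add up to d and the squared coordinates to 1, so normalisation contributes
  the factor -2d^2 - d(n+1) + d(d+2) = -d(d+n-1). Where \<open>\<beta> i - 2\<close> is truncated,
  its coefficient is 0.\<close>

lemma neumann_pair_monomial:
  fixes \<beta> :: "'n::finite \<Rightarrow> nat"
  defines "d \<equiv> sum \<beta> UNIV"
  shows "neumann_pair (hemisphere_monomial \<beta>)
    (\<lambda>x. (\<Sum>i\<in>UNIV. real (\<beta> i) * (real (\<beta> i) - 1) * hemisphere_monomial (\<beta>(i := \<beta> i - 2)) x)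
       - real d * (real d + real CARD('n) - 1) * hemisphere_monomial \<beta> x)"
  unfolding neumann_pair_def
proof (intro conjI allI ballI impI)
  show "hemisphere_monomial \<beta> x = 0" if "x \<notin> closed_hemisphere" for x :: "(real ^ 'n) \<times> real"
    using that by (simp add: hemisphere_monomial_def)
  show "C2_on (hemisphere_monomial \<beta>) closed_hemisphere"
    unfolding C2_on_def using C2_on_open_monomial[of \<beta>]
    by (intro exI[where x="monomial \<beta>"] exI[where x=UNIV]) (simp add: hemisphere_monomial_def)
  show "has_normal_derivative (hemisphere_monomial \<beta>) 0 x" if x: "x \<in> hemisphere_boundary" for x :: "(real ^ 'n) \<times> real"
    unfolding has_normal_derivative_def
  proof (rule has_field_derivative_transform_within[where d=1])
    \<comment> \<open>Along the great circle the first n coordinates are merely multiplied by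
      \<open>cos s\<close>, which is stationary at 0.\<close>
    show "((\<lambda>s. cos s ^ d * monomial \<beta> x) has_real_derivative 0) (at 0 within {..0})"
      by (auto intro!: derivative_eq_intros)
    fix s :: real assume s: "s \<in> {..0}" "dist s 0 < 1"
    have "cos s *\<^sub>R x + sin s *\<^sub>R (0, -1) \<in> closed_hemisphere"
      using great_circle_in_closed_hemisphere[OF x] s by (simp add: dist_real_def)
    moreover have "monomial \<beta> (cos s *\<^sub>R x + sin s *\<^sub>R (0, -1)) = monomial \<beta> (cos s *\<^sub>R x)"
      by (rule monomial_snd) simp
    ultimately show "cos s ^ d * monomial \<beta> x = hemisphere_monomial \<beta> (cos s *\<^sub>R x + sin s *\<^sub>R (0, -1))"
      by (simp add: hemisphere_monomial_def monomial_scaleR d_def)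
  qed auto
  fix x :: "(real ^ 'n) \<times> real" assume x: "x \<in> hemisphere"
  then have x0: "snd x > 0" "norm x = 1" "x \<in> closed_hemisphere"
    by (auto simp: hemisphere_def closed_hemisphere_def)
  let ?m = "monomial \<beta> x" and ?w = "\<lambda>b. - real d + real d * (real d + 2) * (x \<bullet> b)\<^sup>2"
  let ?D = "\<lambda>b. (deriv ^^ 2) (\<lambda>s. hemisphere_monomial \<beta> ((x + s *\<^sub>R b) /\<^sub>R norm (x + s *\<^sub>R b))) 0"
  have D1: "?D (axis i 1, 0) = real (\<beta> i) * (real (\<beta> i) - 1) * monomial (\<beta>(i := \<beta> i - 2)) x +
      ?m * (- 2 * real d * real (\<beta> i) + ?w (axis i 1, 0))" for i
  proof -
    have xi: "x \<bullet> (axis i 1, 0) = fst x $ i" by (simp add: inner_prod_def inner_axis)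
    have bi: "(axis i 1, 0) \<in> (Basis :: ((real ^ 'n) \<times> real) set)"
      by (auto simp: Basis_prod_def Basis_vec_def)
    let ?c = "\<Prod>j\<in>-{i}. (fst x $ j) ^ \<beta> j"
    have "monomial \<beta> (x + s *\<^sub>R (axis i 1, 0)) = ?c * ((x \<bullet> (axis i 1, 0)) + s) ^ \<beta> i" for s
      unfolding xi by (subst monomial_split[of _ _ i]) (auto simp: axis_def intro!: prod.cong)
    from monomial_second_derivative[OF x bi this]
    have "?D (axis i 1, 0) = ?c * (real (\<beta> i) * (real (\<beta> i) - 1) * (fst x $ i) ^ (\<beta> i - 2) +
       (fst x $ i) ^ \<beta> i * (- 2 * real d * real (\<beta> i) - real d + real d * (real d + 2) * (fst x $ i)\<^sup>2))"
      unfolding d_def xi .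
    moreover have "monomial (\<beta>(i := \<beta> i - 2)) x = ?c * (fst x $ i) ^ (\<beta> i - 2)"
      by (subst monomial_split[of _ _ i]) (auto intro!: prod.cong)
    ultimately show ?thesis
      by (simp only: xi monomial_split[of \<beta> x i]) (simp add: algebra_simps)
  qed
  have D2: "?D (0, 1) = ?m * ?w (0, 1)"
  proof -
    have m: "monomial \<beta> (x + s *\<^sub>R (0, 1)) = ?m * ((x \<bullet> (0, 1)) + s) ^ 0" for s
      using monomial_snd[of "x + s *\<^sub>R (0, 1)" x \<beta>] by simp
    show ?thesis using monomial_second_derivative[OF x _ m] unfolding d_def
      by (simp add: Basis_prod_def)
  qed
  have "(\<Sum>b\<in>Basis. (x \<bullet> b)\<^sup>2) = 1"
    using euclidean_inner[of x x] x0(2) by (simp add: dot_square_norm power2_eq_square)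
  then have sq: "(\<Sum>i\<in>UNIV. (x \<bullet> (axis i 1, 0))\<^sup>2) + (x \<bullet> (0, 1))\<^sup>2 = 1"
    by (simp add: sum_Basis_vec_prod)
  have "(\<Sum>i\<in>UNIV. ?w (axis i 1, 0)) + ?w (0, 1) =
    - real d * (real CARD('n) + 1) + real d * (real d + 2) * ((\<Sum>i\<in>UNIV. (x \<bullet> (axis i 1, 0))\<^sup>2) + (x \<bullet> (0, 1))\<^sup>2)"
    by (simp add: sum.distrib sum_subtractf sum_distrib_left algebra_simps)
  then have w: "(\<Sum>i\<in>UNIV. ?w (axis i 1, 0)) + ?w (0, 1) =
    - real d * (real CARD('n) + 1) + real d * (real d + 2)" unfolding sq by simp
  have dd: "(\<Sum>i\<in>UNIV. real (\<beta> i)) = real d" by (simp add: d_def)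
  have "sphere_laplacian (hemisphere_monomial \<beta>) x = (\<Sum>i\<in>UNIV. ?D (axis i 1, 0)) + ?D (0, 1)"
    unfolding sphere_laplacian_def laplacian_def by (rule sum_Basis_vec_prod)
  also have "\<dots> = (\<Sum>i\<in>UNIV. real (\<beta> i) * (real (\<beta> i) - 1) * monomial (\<beta>(i := \<beta> i - 2)) x)
      + ?m * (- 2 * real d * (\<Sum>i\<in>UNIV. real (\<beta> i)) + ((\<Sum>i\<in>UNIV. ?w (axis i 1, 0)) + ?w (0, 1)))"
    unfolding D1 D2 by (simp only: sum.distrib sum_distrib_left[symmetric] distrib_left add.assoc)
  also have "\<dots> = (\<Sum>i\<in>UNIV. real (\<beta> i) * (real (\<beta> i) - 1) * monomial (\<beta>(i := \<beta> i - 2)) x)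
      - real d * (real d + real CARD('n) - 1) * ?m"
    unfolding w dd by (simp add: algebra_simps)
  finally show "sphere_laplacian (hemisphere_monomial \<beta>) x =
     (\<Sum>i\<in>UNIV. real (\<beta> i) * (real (\<beta> i) - 1) * hemisphere_monomial (\<beta>(i := \<beta> i - 2)) x)
       - real d * (real d + real CARD('n) - 1) * hemisphere_monomial \<beta> x"
    using x0(3) by (simp add: hemisphere_monomial_def)
qed

lemma sum_fun_eval: "(\<Sum>i\<in>I. f i) x = (\<Sum>i\<in>I. f i x)" for f :: "'i \<Rightarrow> 'a \<Rightarrow> real"
  by (induction I rule: infinite_finite_induct) auto

section \<open>The values of the eigenvalues\<close>

definition hemisphere_eigenvalue :: "nat \<Rightarrow> nat \<Rightarrow> real" where
  "hemisphere_eigenvalue n K = real K * (real K + real n - 1)"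

lemma hemisphere_eigenvalue_less:
  assumes "n > 0" "J < K" shows "hemisphere_eigenvalue n J < hemisphere_eigenvalue n K"
proof -
  have "real J * (real J + real n - 1) \<le> real J * (real K + real n - 1)"
    using assms by (intro mult_left_mono) auto
  also have "\<dots> < real K * (real K + real n - 1)"
    using assms by (intro mult_strict_right_mono) auto
  finally show ?thesis by (simp add: hemisphere_eigenvalue_def)
qed

lemma hemisphere_eigenvalue_inject:
  "n > 0 \<Longrightarrow> hemisphere_eigenvalue n J = hemisphere_eigenvalue n K \<longleftrightarrow> J = K"
  by (metis hemisphere_eigenvalue_less less_irrefl linorder_less_linear)

lemma neumann_pair_zero: "neumann_pair (\<lambda>x :: (real ^ 'n) \<times> real. 0) (\<lambda>x. 0)"
  using neumann_pair_linear[OF neumann_pair_monomial[of "\<lambda>_::'n. 0"] neumann_pair_monomial[of "\<lambda>_. 0"], of 0 0] by simp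

subsection \<open>Multi-indices\<close>

text \<open>The index type carries no order, so an enumeration of it is chosen. This turns the count
  into that of lists with given length and sum, the stars-and-bars theorem
  \<open>card_length_sum_list\<close>.\<close>

lemma bij_betw_multi_indices:
  "\<exists>h. bij_betw h {\<beta> :: 'n::finite \<Rightarrow> nat. sum \<beta> UNIV = K} {l. length l = CARD('n) \<and> sum_list l = K}"
proof -
  obtain g where g: "bij_betw g {0..<CARD('n)} (UNIV :: 'n set)"
    using ex_bij_betw_nat_finite[of "UNIV :: 'n set"] by auto
  let ?h = "\<lambda>\<beta>. map (\<beta> \<circ> g) [0..<CARD('n)]"
  have s: "sum_list (?h \<beta>) = sum \<beta> UNIV" for \<beta> :: "'n \<Rightarrow> nat"
    using sum.reindex_bij_betw[OF g, of \<beta>] by (simp add: sum_list_distinct_conv_sum_set o_def)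
  have inj: "inj ?h"
  proof (rule injI, rule ext)
    fix \<beta> \<gamma> i assume *: "?h \<beta> = ?h \<gamma>"
    obtain k where "k < CARD('n)" "g k = i"
      using g by (metis UNIV_I atLeastLessThan_iff bij_betw_def imageE)
    then show "\<beta> i = \<gamma> i" using arg_cong[OF *, of "\<lambda>l. l ! k"] by simp
  qed
  have "l \<in> ?h ` {\<beta>. sum \<beta> UNIV = K}" if l: "length l = CARD('n)" "sum_list l = K" for l
  proof -
    define \<beta> where "\<beta> = (\<lambda>i. l ! inv_into {0..<CARD('n)} g i)"
    have "?h \<beta> = l"
      by (rule nth_equalityI) (use l g in \<open>auto simp: \<beta>_def bij_betw_def inv_into_f_f\<close>)
    moreover from this have "sum \<beta> UNIV = K" using s[of \<beta>] l by simp
    ultimately show ?thesis by (metis (mono_tags, lifting) image_eqI mem_Collect_eq)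
  qed
  then have "bij_betw ?h {\<beta>. sum \<beta> UNIV = K} {l. length l = CARD('n) \<and> sum_list l = K}"
    using s inj by (auto simp: bij_betw_def intro: inj_on_subset)
  then show ?thesis by blast
qed

lemma finite_multi_indices: "finite {\<beta> :: 'n::finite \<Rightarrow> nat. sum \<beta> UNIV = K}"
proof -
  have "finite {l :: nat list. length l = CARD('n) \<and> sum_list l = K}"
  proof (rule finite_subset)
    show "{l :: nat list. length l = CARD('n) \<and> sum_list l = K} \<subseteq> {l. set l \<subseteq> {..K} \<and> length l = CARD('n)}"
      using member_le_sum_list by fastforce
  qed (simp add: finite_lists_length_eq)
  moreover obtain h where "bij_betw h {\<beta> :: 'n \<Rightarrow> nat. sum \<beta> UNIV = K} {l. length l = CARD('n) \<and> sum_list l = K}"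
    using bij_betw_multi_indices by blast
  ultimately show ?thesis using bij_betw_finite[of h] by simp
qed

lemma card_multi_indices: "card {\<beta> :: 'n::finite \<Rightarrow> nat. sum \<beta> UNIV = K} = chain_mult CARD('n) K"
proof -
  obtain h where "bij_betw h {\<beta> :: 'n \<Rightarrow> nat. sum \<beta> UNIV = K} {l. length l = CARD('n) \<and> sum_list l = K}"
    using bij_betw_multi_indices by blast
  from bij_betw_same_card[OF this]
  have "card {\<beta> :: 'n::finite \<Rightarrow> nat. sum \<beta> UNIV = K} = (K + CARD('n) - 1) choose K"
    by (simp only: card_length_sum_list)
  also have "\<dots> = (CARD('n) + K - 1) choose (CARD('n) - 1)"
  proof -
    have "CARD('n) > 0" by simp
    then have "K \<le> K + CARD('n) - 1" "K + CARD('n) - 1 - K = CARD('n) - 1" by linarith+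
    then show ?thesis using binomial_symmetric[of K "K + CARD('n) - 1"] by (simp only: add.commute)
  qed
  finally show ?thesis by (simp add: chain_mult_def)
qed

lemma finite_multi_indices_less: "finite {\<beta> :: 'n::finite \<Rightarrow> nat. sum \<beta> UNIV < K}"
proof -
  have "{\<beta> :: 'n \<Rightarrow> nat. sum \<beta> UNIV < K} = (\<Union>j<K. {\<beta>. sum \<beta> UNIV = j})" by auto
  then show ?thesis using finite_multi_indices by auto
qed

subsection \<open>Independence of the monomials\<close>

text \<open>Dedekind's argument. Monomials are multiplicative characters under the componentwise product, and
  small positive vectors are stable under multiplication by positive vectors with entries at most \<open>1\<close>.\<close>

lemma characters_independent:
  fixes A :: "'a set" and f :: "'i \<Rightarrow> 'a \<Rightarrow> real" and m :: "'a \<Rightarrow> 'a \<Rightarrow> 'a"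
  assumes "finite S"
    and mult: "\<And>i a x. a \<in> M \<Longrightarrow> x \<in> A \<Longrightarrow> m a x \<in> A \<and> f i (m a x) = f i a * f i x"
    and distinct: "\<And>i j. i \<noteq> j \<Longrightarrow> \<exists>a\<in>M. f i a \<noteq> f j a"
    and nz: "\<And>i. \<exists>x\<in>A. f i x \<noteq> 0"
    and "\<And>x. x \<in> A \<Longrightarrow> (\<Sum>i\<in>S. c i * f i x) = 0"
  shows "\<forall>i\<in>S. c i = 0"
  using assms(1,5)
proof (induction S arbitrary: c)
  case (insert j S)
  \<comment> \<open>The relation at \<open>m a x\<close> minus \<open>f j a\<close> times the
    relation at \<open>x\<close> no longer contains the index \<open>j\<close>.\<close>
  have *: "\<forall>i\<in>S. c i * (f i a - f j a) = 0" if a: "a \<in> M" for a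
  proof (rule insert.IH)
    fix x assume x: "x \<in> A"
    have "c j * f j (m a x) + (\<Sum>i\<in>S. c i * f i (m a x)) = 0"
      using insert.prems[of "m a x"] mult[OF a x] insert.hyps by simp
    then have "c j * (f j a * f j x) + (\<Sum>i\<in>S. c i * (f i a * f i x)) = 0"
      using mult[OF a x] by simp
    moreover have "f j a * (c j * f j x + (\<Sum>i\<in>S. c i * f i x)) = 0"
      using insert.prems[OF x] insert.hyps by simp
    ultimately show "(\<Sum>i\<in>S. c i * (f i a - f j a) * f i x) = 0"
      by (simp add: algebra_simps sum_subtractf sum_distrib_left)
  qed
  have S: "\<forall>i\<in>S. c i = 0"
  proof
    fix i assume i: "i \<in> S"
    then have "i \<noteq> j" using insert.hyps by auto
    then obtain a where "a \<in> M" "f i a \<noteq> f j a" using distinct by blast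
    then show "c i = 0" using *[of a] i by auto
  qed
  obtain x where "x \<in> A" "f j x \<noteq> 0" using nz by blast
  then have "c j = 0" using insert.prems[of x] insert.hyps S by simp
  then show ?case using S by simp
qed simp

lemma hemisphere_monomial_independent:
  fixes c :: "('n::finite \<Rightarrow> nat) \<Rightarrow> real"
  assumes "finite S" and sum: "\<And>x. (\<Sum>\<beta>\<in>S. c \<beta> * hemisphere_monomial \<beta> x) = 0"
  shows "\<forall>\<beta>\<in>S. c \<beta> = 0"
proof (rule characters_independent[where f="\<lambda>\<beta> (z :: real ^ 'n). \<Prod>i\<in>UNIV. (z $ i) ^ \<beta> i" and
      A="{z. \<forall>i. 0 < z $ i \<and> z $ i \<le> 1 / real CARD('n)}" and M="{z. \<forall>i. 0 < z $ i \<and> z $ i \<le> 1}" and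
      m="\<lambda>a z. \<chi> i. a $ i * z $ i"])
  fix \<beta> \<gamma> :: "'n \<Rightarrow> nat" assume "\<beta> \<noteq> \<gamma>"
  then obtain i where i: "\<beta> i \<noteq> \<gamma> i" by auto
  define a :: "real ^ 'n" where "a = (\<chi> j. if j = i then 1 / 2 else 1)"
  have p: "(\<Prod>j\<in>UNIV. (a $ j) ^ \<delta> j) = (1 / 2) ^ \<delta> i" for \<delta> :: "'n \<Rightarrow> nat"
  proof -
    have "(\<Prod>j\<in>UNIV. (a $ j) ^ \<delta> j) = (\<Prod>j\<in>UNIV. if j = i then (1 / 2) ^ \<delta> i else 1)"
      by (rule prod.cong) (auto simp: a_def)
    then show ?thesis by simp
  qed
  have "(1 / 2 :: real) ^ \<beta> i \<noteq> (1 / 2) ^ \<gamma> i" using i by (simp add: power_inject_exp')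
  then have "(\<Prod>j\<in>UNIV. (a $ j) ^ \<beta> j) \<noteq> (\<Prod>j\<in>UNIV. (a $ j) ^ \<gamma> j)" unfolding p .
  moreover have "a \<in> {z. \<forall>i. 0 < z $ i \<and> z $ i \<le> 1}" by (simp add: a_def)
  ultimately show "\<exists>a\<in>{z :: real ^ 'n. \<forall>i. 0 < z $ i \<and> z $ i \<le> 1}. (\<Prod>i\<in>UNIV. (a $ i) ^ \<beta> i) \<noteq> (\<Prod>i\<in>UNIV. (a $ i) ^ \<gamma> i)"
    by (rule bexI)
next
  fix z :: "real ^ 'n" assume z: "z \<in> {z. \<forall>i. 0 < z $ i \<and> z $ i \<le> 1 / real CARD('n)}"
  \<comment> \<open>The bound \<open>1 / CARD('n)\<close> on the entries is chosen for this: the sum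
    of their absolute values is at most 1, so \<open>z\<close> lies below a point of the closed
    hemisphere.\<close>
  have "norm z \<le> (\<Sum>i\<in>UNIV. \<bar>z $ i\<bar>)" by (rule norm_le_l1_cart)
  also have "\<dots> \<le> (\<Sum>i\<in>(UNIV::'n set). 1 / real CARD('n))"
    using z by (intro sum_mono) (auto simp: less_imp_le abs_of_pos)
  finally have "norm z \<le> 1" by simp
  then have n: "(norm z)\<^sup>2 \<le> 1" using power_mono[of "norm z" 1 2] by simp
  let ?x = "(z, sqrt (1 - (norm z)\<^sup>2))"
  have "norm ?x = 1" using n by (simp add: norm_prod_def)
  then have "?x \<in> closed_hemisphere" using n by (simp add: closed_hemisphere_def)
  then show "(\<Sum>\<beta>\<in>S. c \<beta> * (\<Prod>i\<in>UNIV. (z $ i) ^ \<beta> i)) = 0"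
    using sum[of ?x] by (simp add: hemisphere_monomial_def monomial_def)
next
  fix \<beta> :: "'n \<Rightarrow> nat"
  show "\<exists>x\<in>{z. \<forall>i. 0 < z $ i \<and> z $ i \<le> 1 / real CARD('n)}. (\<Prod>i\<in>UNIV. (x $ i) ^ \<beta> i) \<noteq> 0"
    by (intro bexI[where x="\<chi> i. 1 / real CARD('n)"]) auto
next
  fix \<beta> :: "'n \<Rightarrow> nat" and a x :: "real ^ 'n"
  assume a: "a \<in> {z. \<forall>i. 0 < z $ i \<and> z $ i \<le> 1}" and x: "x \<in> {z. \<forall>i. 0 < z $ i \<and> z $ i \<le> 1 / real CARD('n)}"
  have "a $ i * x $ i \<le> 1 * (1 / real CARD('n))" for i
    using a x by (intro mult_mono) (auto simp: less_imp_le)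
  then show "(\<chi> i. a $ i * x $ i) \<in> {z. \<forall>i. 0 < z $ i \<and> z $ i \<le> 1 / real CARD('n)} \<and>
    (\<Prod>i\<in>UNIV. ((\<chi> i. a $ i * x $ i) $ i) ^ \<beta> i) = (\<Prod>i\<in>UNIV. (a $ i) ^ \<beta> i) * (\<Prod>i\<in>UNIV. (x $ i) ^ \<beta> i)"
    using a x by (auto simp: power_mult_distrib prod.distrib)
qed (rule assms)

lemma inj_hemisphere_monomial: "inj (hemisphere_monomial :: ('n::finite \<Rightarrow> nat) \<Rightarrow> _)"
proof (rule injI, rule ccontr)
  fix \<beta> \<gamma> :: "'n \<Rightarrow> nat" assume *: "hemisphere_monomial \<beta> = hemisphere_monomial \<gamma>" "\<beta> \<noteq> \<gamma>"
  have "\<forall>\<delta>\<in>{\<beta>, \<gamma>}. (if \<delta> = \<beta> then 1 else - 1 :: real) = 0"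
    by (rule hemisphere_monomial_independent) (use * in auto)
  then show False by auto
qed

lemma independent_hemisphere_monomials:
  assumes "finite A"
  shows "real_fun.independent (hemisphere_monomial ` (A :: ('n::finite \<Rightarrow> nat) set))"
proof (rule real_fun.independent_if_scalars_zero)
  fix c v assume c: "(\<Sum>v\<in>hemisphere_monomial ` A. (\<lambda>x. c v * v x)) = 0" and v: "v \<in> hemisphere_monomial ` A"
  have "(\<Sum>\<beta>\<in>A. c (hemisphere_monomial \<beta>) * hemisphere_monomial \<beta> x) = 0" for x
  proof -
    have "(\<Sum>v\<in>hemisphere_monomial ` A. c v * v x) = 0"
      using fun_cong[OF c, of x] by (simp add: sum_fun_eval)
    then show ?thesis by (subst (asm) sum.reindex) (auto intro: inj_on_subset[OF inj_hemisphere_monomial])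
  qed
  from hemisphere_monomial_independent[OF assms this] show "c v = 0" using v by auto
qed (use assms in simp)

subsection \<open>Eigenpolynomials\<close>

text \<open>The strict bound makes the degree 0 case the zero space, where inductions start, and
  lets the terms below a leading monomial of degree \<open>K\<close> lie in
  \<open>polynomials_below K\<close>.\<close>

definition polynomials_below :: "nat \<Rightarrow> ((real ^ 'n::finite) \<times> real \<Rightarrow> real) set" where
  "polynomials_below K = real_fun.span (hemisphere_monomial ` {\<beta>. sum \<beta> UNIV < K})"

lemma polynomials_below_mono: "J \<le> K \<Longrightarrow> polynomials_below J \<subseteq> polynomials_below K"
  unfolding polynomials_below_def by (intro real_fun.span_mono image_mono) auto

lemma monomial_in_polynomials_below: "sum \<beta> UNIV < K \<Longrightarrow> hemisphere_monomial \<beta> \<in> polynomials_below K"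
  unfolding polynomials_below_def by (intro real_fun.span_base) auto

lemma polynomials_below_linear:
  assumes "p \<in> polynomials_below K" "q \<in> polynomials_below K"
  shows "(\<lambda>x. a * p x + b * q x) \<in> polynomials_below K"
proof -
  have "(\<lambda>x. a * p x) + (\<lambda>x. b * q x) \<in> polynomials_below K"
    using assms unfolding polynomials_below_def by (intro real_fun.span_add real_fun.span_scale)
  then show ?thesis by (simp add: plus_fun_def)
qed

lemma monomial_laplacian_in_polynomials_below:
  fixes \<beta> :: "'n::finite \<Rightarrow> nat"
  shows "(\<lambda>x. \<Sum>i\<in>UNIV. real (\<beta> i) * (real (\<beta> i) - 1) * hemisphere_monomial (\<beta>(i := \<beta> i - 2)) x)
    \<in> polynomials_below (sum \<beta> UNIV)"
proof -
  have "(\<Sum>i\<in>UNIV. (\<lambda>x. real (\<beta> i) * (real (\<beta> i) - 1) * hemisphere_monomial (\<beta>(i := \<beta> i - 2)) x))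
    \<in> polynomials_below (sum \<beta> UNIV)"
    unfolding polynomials_below_def
  proof (rule real_fun.span_sum)
    fix i
    show "(\<lambda>x. real (\<beta> i) * (real (\<beta> i) - 1) * hemisphere_monomial (\<beta>(i := \<beta> i - 2)) x)
      \<in> real_fun.span (hemisphere_monomial ` {\<gamma>. sum \<gamma> UNIV < sum \<beta> UNIV})"
    \<comment> \<open>For \<open>\<beta> i < 2\<close> truncated subtraction need not lower the
      degree, but then the coefficient is 0.\<close>
    proof (cases "\<beta> i < 2")
      case True
      then have "real (\<beta> i) * (real (\<beta> i) - 1) = 0" by (cases "\<beta> i = 0") auto
      then show ?thesis using real_fun.span_zero[unfolded zero_fun_def] by (simp only: mult_zero_left)
    next
      case False
      have "sum (\<beta>(i := \<beta> i - 2)) UNIV = sum \<beta> (UNIV - {i}) + (\<beta> i - 2)"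
        by (subst sum.remove[of _ i]) (auto intro!: sum.cong)
      also have "\<dots> < sum \<beta> UNIV" using False by (subst (2) sum.remove[of _ i]) auto
      finally show ?thesis by (intro real_fun.span_scale real_fun.span_base) auto
    qed
  qed
  moreover have "(\<Sum>i\<in>UNIV. (\<lambda>x. real (\<beta> i) * (real (\<beta> i) - 1) * hemisphere_monomial (\<beta>(i := \<beta> i - 2)) x))
    = (\<lambda>x. \<Sum>i\<in>UNIV. real (\<beta> i) * (real (\<beta> i) - 1) * hemisphere_monomial (\<beta>(i := \<beta> i - 2)) x)"
    by (rule ext) (simp add: sum_fun_eval)
  ultimately show ?thesis by (simp only:)
qed

text \<open>The Laplacian is triangular on polynomials: on the degree \<open>e\<close> it is \<open>- e (e + n - 1)\<close> up to lower degrees,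
  and these diagonal entries are pairwise distinct.\<close>

lemma shifted_laplacian_solvable:
  fixes p :: "(real ^ 'n) \<times> real \<Rightarrow> real"
  assumes "p \<in> polynomials_below d" "d \<le> K"
  shows "\<exists>r\<in>polynomials_below d. neumann_pair r (\<lambda>x. p x - hemisphere_eigenvalue CARD('n) K * r x)"
  using assms
proof (induction d arbitrary: p)
  case 0
  then have "p = 0" by (simp add: polynomials_below_def)
  then show ?case using neumann_pair_zero 0 by (intro bexI[where x=p]) (auto simp: zero_fun_def)
next
  case (Suc d)
  let ?l = "hemisphere_eigenvalue CARD('n) K"
  from Suc.prems(1) show ?case unfolding polynomials_below_def[of "Suc d"]
  proof (induction p rule: real_fun.span_induct_alt)
    case base
    show ?case using neumann_pair_zero real_fun.span_zero by (intro bexI[where x=0]) (auto simp: zero_fun_def)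
  next
    case (step c m q)
    then obtain \<beta> where \<beta>: "m = hemisphere_monomial \<beta>" "sum \<beta> UNIV \<le> d" by auto
    from step obtain r where r: "r \<in> polynomials_below (Suc d)" "neumann_pair r (\<lambda>x. q x - ?l * r x)"
      by (auto simp: polynomials_below_def)
    define e where "e = sum \<beta> UNIV"
    define L where "L = (\<lambda>x. \<Sum>i\<in>UNIV. real (\<beta> i) * (real (\<beta> i) - 1) * hemisphere_monomial (\<beta>(i := \<beta> i - 2)) x)"
    have Lm: "neumann_pair m (\<lambda>x. L x - hemisphere_eigenvalue CARD('n) e * m x)"
      using neumann_pair_monomial[of \<beta>] by (simp add: \<beta>(1) L_def e_def hemisphere_eigenvalue_def)
    have "L \<in> polynomials_below d"
      using monomial_laplacian_in_polynomials_below[of \<beta>] polynomials_below_mono[OF \<beta>(2)] unfolding L_def by blast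
    then obtain r1 where r1: "r1 \<in> polynomials_below d" "neumann_pair r1 (\<lambda>x. L x - ?l * r1 x)"
      using Suc.IH[of L] Suc.prems(2) by auto
    let ?k = "?l - hemisphere_eigenvalue CARD('n) e"
    have k: "?k > 0" using hemisphere_eigenvalue_less[of "CARD('n)" e K] \<beta>(2) Suc.prems(2) by (simp add: e_def)
    \<comment> \<open>The Laplacian plus \<open>?l\<close> maps \<open>m - r1\<close> to
      \<open>?k * m\<close>, since \<open>r1\<close> absorbs the lower-order part \<open>L\<close>.
      Dividing by the nonzero \<open>?k\<close> handles the summand \<open>c * m\<close>, and
      \<open>r\<close> handles \<open>q\<close>.\<close>
    define s where "s = (\<lambda>x. (c / ?k) * (1 * m x + (- 1) * r1 x) + 1 * r x)"
    have "neumann_pair s (\<lambda>x. (c / ?k) * (1 * (L x - hemisphere_eigenvalue CARD('n) e * m x) + (- 1) * (L x - ?l * r1 x)) + 1 * (q x - ?l * r x))"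
      unfolding s_def by (intro neumann_pair_linear Lm r1 r)
    also have "(\<lambda>x. (c / ?k) * (1 * (L x - hemisphere_eigenvalue CARD('n) e * m x) + (- 1) * (L x - ?l * r1 x)) + 1 * (q x - ?l * r x))
      = (\<lambda>x. (c * m x + q x) - ?l * s x)"
    proof
      fix x
      have "c * m x = (c / ?k) * (?k * m x)" using k by simp
      then show "(c / ?k) * (1 * (L x - hemisphere_eigenvalue CARD('n) e * m x) + (- 1) * (L x - ?l * r1 x)) + 1 * (q x - ?l * r x)
         = (c * m x + q x) - ?l * s x"
        unfolding s_def by (simp only:) (simp add: algebra_simps del: times_divide_eq_left times_divide_eq_right)
    qed
    finally have 1: "neumann_pair s (\<lambda>x. (c * m x + q x) - ?l * s x)" .
    have "m \<in> polynomials_below (Suc d)" "r1 \<in> polynomials_below (Suc d)"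
      using r1(1) polynomials_below_mono[of d "Suc d"] \<beta> by (auto simp: monomial_in_polynomials_below)
    from polynomials_below_linear[OF polynomials_below_linear[OF this, of 1 "-1"] r(1), of "c / ?k" 1]
    have "s \<in> polynomials_below (Suc d)" unfolding s_def .
    moreover have "neumann_pair s (\<lambda>x. ((\<lambda>x. c * m x) + q) x - ?l * s x)"
      using 1 by (simp only: plus_fun_apply)
    ultimately show ?case unfolding polynomials_below_def by (intro bexI[of _ s])
  qed
qed

text \<open>The Laplacian of the monomial has the right diagonal term and an error \<open>L\<close>
  of lower degree. Solving for that error among polynomials of lower degree corrects the monomial
  without changing its leading term.\<close>

lemma eigenpolynomial_exists:
  fixes \<beta> :: "'n::finite \<Rightarrow> nat"
  shows "\<exists>p. p \<in> neumann_eigenspace (hemisphere_eigenvalue CARD('n) (sum \<beta> UNIV)) \<and>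
    (\<lambda>x. hemisphere_monomial \<beta> x - p x) \<in> polynomials_below (sum \<beta> UNIV)"
proof -
  let ?K = "sum \<beta> UNIV"
  let ?l = "hemisphere_eigenvalue CARD('n) ?K"
  define L where "L = (\<lambda>x. \<Sum>i\<in>UNIV. real (\<beta> i) * (real (\<beta> i) - 1) * hemisphere_monomial (\<beta>(i := \<beta> i - 2)) x)"
  obtain r where r: "r \<in> polynomials_below ?K" "neumann_pair r (\<lambda>x. L x - ?l * r x)"
    using shifted_laplacian_solvable[OF monomial_laplacian_in_polynomials_below order_refl, of \<beta>] unfolding L_def by blast
  have "neumann_pair (hemisphere_monomial \<beta>) (\<lambda>x. L x - ?l * hemisphere_monomial \<beta> x)"
    using neumann_pair_monomial[of \<beta>] by (simp add: L_def hemisphere_eigenvalue_def)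
  from neumann_pair_linear[OF this r(2), of 1 "-1"]
  have "neumann_pair (\<lambda>x. hemisphere_monomial \<beta> x - r x) (\<lambda>x. - ?l * (hemisphere_monomial \<beta> x - r x))"
    by (simp add: algebra_simps)
  then have "(\<lambda>x. hemisphere_monomial \<beta> x - r x) \<in> neumann_eigenspace ?l"
    unfolding neumann_eigenspace_iff .
  moreover have "(\<lambda>x. hemisphere_monomial \<beta> x - (hemisphere_monomial \<beta> x - r x)) \<in> polynomials_below ?K"
    using r(1) by simp
  ultimately show ?thesis by blast
qed

definition eigenpolynomial :: "('n::finite \<Rightarrow> nat) \<Rightarrow> (real ^ 'n) \<times> real \<Rightarrow> real" where
  "eigenpolynomial \<beta> = (SOME p. p \<in> neumann_eigenspace (hemisphere_eigenvalue CARD('n) (sum \<beta> UNIV)) \<and>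
    (\<lambda>x. hemisphere_monomial \<beta> x - p x) \<in> polynomials_below (sum \<beta> UNIV))"

lemma eigenpolynomial:
  fixes \<beta> :: "'n::finite \<Rightarrow> nat"
  shows "eigenpolynomial \<beta> \<in> neumann_eigenspace (hemisphere_eigenvalue CARD('n) (sum \<beta> UNIV))"
    "(\<lambda>x. hemisphere_monomial \<beta> x - eigenpolynomial \<beta> x) \<in> polynomials_below (sum \<beta> UNIV)"
proof -
  note * = someI_ex[OF eigenpolynomial_exists[of \<beta>], folded eigenpolynomial_def]
  show "eigenpolynomial \<beta> \<in> neumann_eigenspace (hemisphere_eigenvalue CARD('n) (sum \<beta> UNIV))"
    using * by (rule conjunct1)
  show "(\<lambda>x. hemisphere_monomial \<beta> x - eigenpolynomial \<beta> x) \<in> polynomials_below (sum \<beta> UNIV)"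
    using * by (rule conjunct2)
qed

text \<open>Triangularity again: a monomial differs from its eigenpolynomial by terms of lower
  degree, which the induction covers.\<close>

lemma span_eigenpolynomials:
  "polynomials_below K \<subseteq> real_fun.span (eigenpolynomial ` {\<beta> :: 'n::finite \<Rightarrow> nat. sum \<beta> UNIV < K})"
proof (induction K)
  case 0
  then show ?case by (simp add: polynomials_below_def)
next
  case (Suc K)
  let ?S = "\<lambda>K. real_fun.span (eigenpolynomial ` {\<beta> :: 'n \<Rightarrow> nat. sum \<beta> UNIV < K})"
  have "hemisphere_monomial \<beta> \<in> ?S (Suc K)" if "sum \<beta> UNIV < Suc K" for \<beta> :: "'n \<Rightarrow> nat"
  proof -
    have "(\<lambda>x. hemisphere_monomial \<beta> x - eigenpolynomial \<beta> x) \<in> ?S K"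
      using eigenpolynomial(2)[of \<beta>] polynomials_below_mono[of "sum \<beta> UNIV" K] that Suc.IH by auto
    moreover have "?S K \<subseteq> ?S (Suc K)" by (intro real_fun.span_mono image_mono) auto
    moreover have "eigenpolynomial \<beta> \<in> ?S (Suc K)" using that by (intro real_fun.span_base) auto
    ultimately have "(\<lambda>x. hemisphere_monomial \<beta> x - eigenpolynomial \<beta> x) + eigenpolynomial \<beta> \<in> ?S (Suc K)"
      by (intro real_fun.span_add) auto
    moreover have "(\<lambda>x. hemisphere_monomial \<beta> x - eigenpolynomial \<beta> x) + eigenpolynomial \<beta> = hemisphere_monomial \<beta>"
      by (simp add: fun_eq_iff)
    ultimately show ?thesis by simp
  qed
  then show ?case unfolding polynomials_below_def[of "Suc K"]
    by (intro real_fun.span_minimal real_fun.subspace_span) auto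
qed

lemma independent_if_card_le_dim:
  fixes B :: "('a \<Rightarrow> real) set"
  assumes "finite B" "V \<subseteq> real_fun.span B" "card B \<le> real_fun.dim V"
  shows "real_fun.independent B"
proof -
  obtain B' where B': "B' \<subseteq> B" "real_fun.independent B'" "B \<subseteq> real_fun.span B'"
    using real_fun.maximal_independent_subset by blast
  have "V \<subseteq> real_fun.span B'"
    using assms(2) B'(3) real_fun.span_minimal[OF B'(3) real_fun.subspace_span] by blast
  then have "card B \<le> card B'"
    using real_fun.dim_le_card[of V B'] finite_subset[OF B'(1) assms(1)] assms(3) by linarith
  then have "B' = B" using card_seteq[OF assms(1) B'(1)] by simp
  then show ?thesis using B'(2) by simp
qed

text \<open>A dimension count: the eigenpolynomials span a space whose dimension is the number of
  indices, so no two of them coincide and no relation holds among them. Injectivity is needed to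
  count multiplicities by indices.\<close>

lemma eigenpolynomials_independent:
  fixes K :: nat
  defines "A \<equiv> {\<beta> :: 'n::finite \<Rightarrow> nat. sum \<beta> UNIV < K}"
  shows "inj_on eigenpolynomial A" "real_fun.independent (eigenpolynomial ` A)"
proof -
  have fin: "finite A" unfolding A_def by (rule finite_multi_indices_less)
  let ?V = "polynomials_below K :: ((real ^ 'n) \<times> real \<Rightarrow> real) set"
  have "real_fun.dim ?V = card (hemisphere_monomial ` A)"
    unfolding polynomials_below_def A_def[symmetric]
    by (intro real_fun.dim_span_eq_card_independent independent_hemisphere_monomials fin)
  also have "\<dots> = card A" by (intro card_image inj_on_subset[OF inj_hemisphere_monomial]) auto
  finally have d: "real_fun.dim ?V = card A" .
  have V: "?V \<subseteq> real_fun.span (eigenpolynomial ` A)" unfolding A_def by (rule span_eigenpolynomials)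
  have c: "card (eigenpolynomial ` A) \<le> card A" by (rule card_image_le[OF fin])
  show "real_fun.independent (eigenpolynomial ` A)"
    by (rule independent_if_card_le_dim[OF _ V]) (use fin c d in auto)
  have "card A \<le> card (eigenpolynomial ` A)" using real_fun.dim_le_card[OF V] fin d by simp
  then show "inj_on eigenpolynomial A" using c by (intro eq_card_imp_inj_on fin) simp
qed

subsection \<open>A weighted integral over the hemisphere\<close>

text \<open>The integrand of Green's identity. In polar coordinates its integral is a positive
  constant times the surface integral of \<open>h\<close>, so the mean of a product serves as the
  inner product of L^2 on the hemisphere.\<close>

definition hemisphere_weight :: "((real ^ 'n) \<times> real \<Rightarrow> real) \<Rightarrow> (real ^ 'n) \<times> real \<Rightarrow> real" where
  "hemisphere_weight h y =
     indicator {y. snd y > 0} y *\<^sub>R (bump (y \<bullet> y) / (norm y)\<^sup>2 * h (y /\<^sub>R norm y))"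

definition hemisphere_mean :: "((real ^ 'n) \<times> real \<Rightarrow> real) \<Rightarrow> real" where
  "hemisphere_mean h = integral\<^sup>L lborel (hemisphere_weight h)"

lemma normalize_in_closed_hemisphere:
  assumes "snd y > 0" shows "y /\<^sub>R norm y \<in> closed_hemisphere"
proof -
  have "y \<noteq> 0" using assms by auto
  then have "norm (y /\<^sub>R norm y) = 1" by simp
  moreover have "snd (y /\<^sub>R norm y) \<ge> 0" using assms by simp
  ultimately show ?thesis unfolding closed_hemisphere_def by blast
qed

lemma compact_closed_hemisphere: "compact (closed_hemisphere :: ((real ^ 'n) \<times> real) set)"
proof -
  have "closed (closed_hemisphere :: ((real ^ 'n) \<times> real) set)" unfolding closed_hemisphere_def
    by (intro closed_Collect_conj closed_Collect_eq closed_Collect_le continuous_intros)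
  moreover have "bounded (closed_hemisphere :: ((real ^ 'n) \<times> real) set)"
    unfolding bounded_iff closed_hemisphere_def by auto
  ultimately show ?thesis by (simp add: compact_eq_bounded_closed)
qed

lemma continuous_on_hemisphere_weight:
  assumes "continuous_on closed_hemisphere h"
  shows "continuous_on {y. snd y > 0} (\<lambda>y. bump (y \<bullet> y) / (norm y)\<^sup>2 * h (y /\<^sub>R norm y))"
proof -
  have "continuous_on {y. snd y > 0} (\<lambda>y. h (y /\<^sub>R norm y))"
    by (rule continuous_on_compose2[OF assms])
      (use normalize_in_closed_hemisphere in \<open>auto intro!: continuous_intros simp: zero_prod_def\<close>)
  then show ?thesis by (intro continuous_intros continuous_on_bump) (auto simp: zero_prod_def)
qed

text \<open>\<open>6\<close> is a convenient majorant of \<open>(9 / 4)\<^sup>2\<close>, the maximum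
  of the bump, attained at 5/2.\<close>

lemma bump_over_square_le: "bump (y \<bullet> y) / (norm y)\<^sup>2 \<le> 6" for y :: "'a::real_inner"
proof (cases "norm y \<le> 1")
  case True
  then show ?thesis by (simp add: bump_inner_eq_0)
next
  case False
  have q: "(s - 1) * (4 - s) \<le> 9 / 4" for s :: real
  proof -
    have "(s - 1) * (4 - s) = 9 / 4 - (s - 5 / 2)\<^sup>2" by (simp add: power2_eq_square field_simps)
    then show ?thesis by simp
  qed
  have "bump (y \<bullet> y) \<le> (9 / 4)\<^sup>2"
    unfolding bump_def by (intro power_mono max.boundedI q) auto
  then have "bump (y \<bullet> y) \<le> 6" by (simp add: power2_eq_square)
  moreover have "(norm y)\<^sup>2 \<ge> 1" using False by simp
  ultimately have "bump (y \<bullet> y) / (norm y)\<^sup>2 \<le> 6 / 1"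
    by (intro frac_le) auto
  then show ?thesis by simp
qed

lemma integrable_hemisphere_weight:
  fixes h :: "(real ^ 'n) \<times> real \<Rightarrow> real"
  assumes "continuous_on closed_hemisphere h"
  shows "integrable lborel (hemisphere_weight h)"
proof -
  obtain B where B: "B > 0" "\<And>x. x \<in> closed_hemisphere \<Longrightarrow> \<bar>h x\<bar> \<le> B"
    using compact_imp_bounded[OF compact_continuous_image[OF assms compact_closed_hemisphere]]
    unfolding bounded_pos by auto
  show ?thesis
  proof (rule Bochner_Integration.integrable_bound)
    show "integrable lborel (\<lambda>y. indicator (cball (0 :: (real ^ 'n) \<times> real) 2) y *\<^sub>R (6 * B))"
      using emeasure_lborel_cball_finite[of "0 :: (real ^ 'n) \<times> real" 2] by (simp add: less_top)
    have "open {y :: (real ^ 'n) \<times> real. snd y > 0}" by (intro open_Collect_less continuous_intros)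
    then have "hemisphere_weight h \<in> borel_measurable borel" unfolding hemisphere_weight_def[abs_def]
      by (intro borel_measurable_continuous_on_indicator continuous_on_hemisphere_weight assms) simp
    then show "hemisphere_weight h \<in> borel_measurable lborel" by simp
    show "AE y in lborel. norm (hemisphere_weight h y) \<le> norm (indicator (cball 0 2) y *\<^sub>R (6 * B))"
    proof (rule AE_I2)
      fix y :: "(real ^ 'n) \<times> real"
      show "norm (hemisphere_weight h y) \<le> norm (indicator (cball 0 2) y *\<^sub>R (6 * B))"
      proof (cases "snd y > 0 \<and> norm y \<le> 2")
        case True
        have "bump (y \<bullet> y) / (norm y)\<^sup>2 * \<bar>h (y /\<^sub>R norm y)\<bar> \<le> 6 * B"
          using B(1) B(2)[OF normalize_in_closed_hemisphere] True bump_over_square_le[of y]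
          by (intro mult_mono) auto
        then show ?thesis using True bump_nonneg[of "y \<bullet> y"] B(1)
          by (simp add: hemisphere_weight_def abs_mult)
      next
        case False
        then show ?thesis using bump_inner_eq_0[of y] by (auto simp: hemisphere_weight_def)
      qed
    qed
  qed
qed

lemma hemisphere_mean_linear:
  assumes "continuous_on closed_hemisphere f" "continuous_on closed_hemisphere g"
  shows "hemisphere_mean (\<lambda>x. a * f x + b * g x) = a * hemisphere_mean f + b * hemisphere_mean g"
proof -
  have "hemisphere_weight (\<lambda>x. a * f x + b * g x) = (\<lambda>y. a * hemisphere_weight f y + b * hemisphere_weight g y)"
    by (auto simp: hemisphere_weight_def fun_eq_iff algebra_simps add_divide_distrib)
  then show ?thesis unfolding hemisphere_mean_def
    using integrable_hemisphere_weight[OF assms(1)] integrable_hemisphere_weight[OF assms(2)] by simp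
qed

lemma hemisphere_mean_bound:
  fixes h :: "(real ^ 'n) \<times> real \<Rightarrow> real"
  assumes "continuous_on closed_hemisphere h" "\<And>x. x \<in> closed_hemisphere \<Longrightarrow> \<bar>h x\<bar> \<le> e"
  shows "\<bar>hemisphere_mean h\<bar> \<le> e * hemisphere_mean (\<lambda>_ :: (real ^ 'n) \<times> real. 1)"
proof -
  have "norm (hemisphere_mean h) \<le> integral\<^sup>L lborel (\<lambda>y :: (real ^ 'n) \<times> real. e * hemisphere_weight (\<lambda>_. 1) y)"
    unfolding hemisphere_mean_def
  proof (rule Bochner_Integration.integral_norm_bound_integral)
    fix y :: "(real ^ 'n) \<times> real"
    show "norm (hemisphere_weight h y) \<le> e * hemisphere_weight (\<lambda>_. 1) y"
    proof (cases "snd y > 0")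
      case True
      have "bump (y \<bullet> y) / (norm y)\<^sup>2 * \<bar>h (y /\<^sub>R norm y)\<bar> \<le> bump (y \<bullet> y) / (norm y)\<^sup>2 * e"
        using assms(2) normalize_in_closed_hemisphere[OF True] bump_nonneg by (intro mult_left_mono) auto
      then show ?thesis using True bump_nonneg[of "y \<bullet> y"]
        by (simp add: hemisphere_weight_def abs_mult mult.commute)
    qed (simp add: hemisphere_weight_def)
  qed (use integrable_hemisphere_weight[OF assms(1)] integrable_hemisphere_weight[OF continuous_on_const[of closed_hemisphere 1]] in auto)
  then show ?thesis by (simp add: hemisphere_mean_def)
qed

lemma hemisphere_subset_closure: "closed_hemisphere \<subseteq> closure (hemisphere :: ((real ^ 'n) \<times> real) set)"
proof
  fix x :: "(real ^ 'n) \<times> real" assume x: "x \<in> closed_hemisphere"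
  then have x0: "norm x = 1" "snd x \<ge> 0" by (auto simp: closed_hemisphere_def)
  define y where "y = (\<lambda>k. x + inverse (real (Suc k)) *\<^sub>R (0, 1))"
  have y: "snd (y k) > 0" for k using x0 by (simp add: y_def add_nonneg_pos)
  have "y \<longlonglongrightarrow> x + 0 *\<^sub>R (0, 1)"
    unfolding y_def by (intro tendsto_intros LIMSEQ_inverse_real_of_nat)
  then have "(\<lambda>k. y k /\<^sub>R norm (y k)) \<longlonglongrightarrow> (x + 0 *\<^sub>R (0, 1)) /\<^sub>R norm (x + 0 *\<^sub>R (0, 1))"
    by (intro tendsto_intros) (use x0 in \<open>auto simp flip: zero_prod_def\<close>)
  then have "(\<lambda>k. y k /\<^sub>R norm (y k)) \<longlonglongrightarrow> x" using x0 by (simp flip: zero_prod_def)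
  moreover have "y k /\<^sub>R norm (y k) \<in> hemisphere" for k
  proof -
    have "y k \<noteq> 0" using y[of k] by auto
    then have "norm (y k /\<^sub>R norm (y k)) = 1" "snd (y k /\<^sub>R norm (y k)) > 0"
      using y[of k] by auto
    then show ?thesis unfolding hemisphere_def by blast
  qed
  ultimately show "x \<in> closure hemisphere" unfolding closure_sequential
    by (intro exI[where x="\<lambda>k. y k /\<^sub>R norm (y k)"]) simp
qed

text \<open>A nonnegative integrand with zero integral vanishes almost everywhere. By continuity its
  nonzero set in the half-space is open, and a negligible open set is empty. Boundary values follow
  by passing to the closure.\<close>

lemma hemisphere_mean_square_eq_0:
  fixes u :: "(real ^ 'n) \<times> real \<Rightarrow> real"
  assumes u: "continuous_on closed_hemisphere u" and 0: "hemisphere_mean (\<lambda>x. u x * u x) = 0"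
    and x: "x \<in> closed_hemisphere"
  shows "u x = 0"
proof -
  have c: "continuous_on closed_hemisphere (\<lambda>x. u x * u x)" by (intro continuous_intros u)
  let ?w = "hemisphere_weight (\<lambda>x. u x * u x)"
  let ?H = "{y :: (real ^ 'n) \<times> real. snd y > 0}"
  have opH: "open ?H" by (intro open_Collect_less continuous_intros)
  have "AE y in lborel. ?w y = 0"
  proof (rule iffD1[OF integral_nonneg_eq_0_iff_AE[OF integrable_hemisphere_weight[OF c]]])
    show "AE y in lborel. 0 \<le> ?w y"
      by (intro AE_I2) (auto simp: hemisphere_weight_def bump_nonneg indicator_def)
    show "integral\<^sup>L lborel ?w = 0" using 0 by (simp add: hemisphere_mean_def)
  qed
  then have "AE y in lebesgue. ?w y = 0" by (rule AE_completion)
  then obtain N where N: "{y. ?w y \<noteq> 0} \<subseteq> N" "N \<in> null_sets lebesgue"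
    by (auto elim: AE_E simp: null_sets_def)
  have neg: "negligible {y. ?w y \<noteq> 0}"
    using N negligible_iff_null_sets negligible_subset by blast
  have hem: "u z = 0" if z: "z \<in> hemisphere" for z
  proof (rule ccontr)
    assume uz: "u z \<noteq> 0"
    have z0: "norm z = 1" "snd z > 0" using z by (auto simp: hemisphere_def)
    \<comment> \<open>The radius 3/2 lies in the annulus where the bump is positive.\<close>
    define y where "y = (3 / 2) *\<^sub>R z"
    have y: "y \<in> ?H" "norm y = 3 / 2" "y /\<^sub>R norm y = z" using z0 by (auto simp: y_def)
    have "bump (y \<bullet> y) > 0" by (rule bump_pos) (auto simp: dot_square_norm y(2) power2_eq_square)
    then have "?w y \<noteq> 0" using y uz by (auto simp: hemisphere_weight_def)
    have cw: "continuous_on ?H ?w"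
      using continuous_on_hemisphere_weight[OF c]
      by (rule continuous_on_eq) (auto simp: hemisphere_weight_def)
    have "open (?H \<inter> ?w -` (- {0}))"
      by (rule continuous_open_preimage[OF cw opH]) auto
    moreover have "?H \<inter> ?w -` (- {0}) \<noteq> {}" using y(1) \<open>?w y \<noteq> 0\<close> by blast
    moreover have "negligible (?H \<inter> ?w -` (- {0}))" by (rule negligible_subset[OF neg]) auto
    ultimately show False using open_not_negligible by blast
  qed
  show ?thesis
  proof (rule continuous_constant_on_closure[of hemisphere u 0, OF _ hem])
    have "closure hemisphere \<subseteq> (closed_hemisphere :: ((real ^ 'n) \<times> real) set)"
      by (rule closure_minimal)
        (use compact_imp_closed[OF compact_closed_hemisphere] in \<open>auto simp: hemisphere_def closed_hemisphere_def\<close>)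
    then show "continuous_on (closure hemisphere) u" using u continuous_on_subset by blast
    show "x \<in> closure hemisphere" using x hemisphere_subset_closure by blast
  qed
qed

subsection \<open>Density of the polynomials\<close>

lemma polynomials_below_mult:
  fixes p q :: "(real ^ 'n::finite) \<times> real \<Rightarrow> real"
  assumes "p \<in> polynomials_below J" "q \<in> polynomials_below K"
  shows "(\<lambda>x. p x * q x) \<in> polynomials_below (J + K)"
proof -
  have 1: "(\<lambda>x. hemisphere_monomial \<beta> x * q x) \<in> polynomials_below (J + K)" if \<beta>: "sum \<beta> UNIV < J" for \<beta> :: "'n \<Rightarrow> nat"
    using assms(2) unfolding polynomials_below_def[of K]
  proof (induction q rule: real_fun.span_induct_alt)
    case base
    then show ?case using real_fun.span_zero by (simp add: polynomials_below_def zero_fun_def)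
  next
    case (step c m q)
    then obtain \<gamma> where \<gamma>: "m = hemisphere_monomial \<gamma>" "sum \<gamma> UNIV < K" by auto
    have "(\<lambda>x. hemisphere_monomial \<beta> x * m x) = hemisphere_monomial (\<lambda>i. \<beta> i + \<gamma> i)"
      by (auto simp: \<gamma> hemisphere_monomial_def monomial_def fun_eq_iff power_add prod.distrib)
    also have "\<dots> \<in> polynomials_below (J + K)"
      using \<beta> \<gamma>(2) by (intro monomial_in_polynomials_below) (simp add: sum.distrib)
    finally have "(\<lambda>x. c * (hemisphere_monomial \<beta> x * m x) + 1 * (hemisphere_monomial \<beta> x * q x)) \<in> polynomials_below (J + K)"
      using step by (intro polynomials_below_linear)
    then show ?case by (simp add: algebra_simps)
  qed
  show ?thesis using assms(1) unfolding polynomials_below_def[of J]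
  proof (induction p rule: real_fun.span_induct_alt)
    case base
    then show ?case using real_fun.span_zero by (simp add: polynomials_below_def zero_fun_def)
  next
    case (step c m p)
    then obtain \<beta> where \<beta>: "m = hemisphere_monomial \<beta>" "sum \<beta> UNIV < J" by auto
    from polynomials_below_linear[OF 1[OF \<beta>(2)] step(2), of c 1]
    show ?case by (simp add: \<beta>(1) algebra_simps)
  qed
qed

lemma real_polynomial_function_on_hemisphere:
  fixes q :: "real ^ 'n \<Rightarrow> real"
  assumes "real_polynomial_function q"
  shows "\<exists>K. (\<lambda>x. if x \<in> closed_hemisphere then q (fst x) else 0) \<in> polynomials_below K"
  using assms
proof (induction q rule: real_polynomial_function.induct)
  case (linear q)
  define e where "e = (\<lambda>i j :: 'n. if j = i then 1 else 0 :: nat)"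
  have m: "monomial (e i) x = fst x $ i" for i and x :: "(real ^ 'n) \<times> real"
  proof -
    have "monomial (e i) x = (\<Prod>j\<in>UNIV. if j = i then fst x $ i else 1)"
      unfolding monomial_def by (rule prod.cong) (auto simp: e_def)
    then show ?thesis by simp
  qed
  have "(\<Sum>i\<in>UNIV. (\<lambda>x. q (axis i 1) * hemisphere_monomial (e i) x)) \<in> polynomials_below 2"
    unfolding polynomials_below_def by (intro real_fun.span_sum real_fun.span_scale real_fun.span_base) (auto simp: e_def)
  also have "(\<Sum>i\<in>UNIV. (\<lambda>x. q (axis i 1) * hemisphere_monomial (e i) x)) =
    (\<lambda>x. if x \<in> closed_hemisphere then q (fst x) else 0)"
  proof
    fix x :: "(real ^ 'n) \<times> real"
    have "q (fst x) = q (\<Sum>i\<in>UNIV. (fst x $ i) *\<^sub>R axis i 1)"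
      using basis_expansion[of "fst x"] by (simp add: scalar_mult_eq_scaleR)
    also have "\<dots> = (\<Sum>i\<in>UNIV. (fst x $ i) * q (axis i 1))"
      using bounded_linear.linear[OF linear] by (simp add: linear_sum linear_scale)
    finally have "q (fst x) = (\<Sum>i\<in>UNIV. q (axis i 1) * (fst x $ i))" by (simp add: mult.commute)
    then show "(\<Sum>i\<in>UNIV. (\<lambda>x. q (axis i 1) * hemisphere_monomial (e i) x)) x =
      (if x \<in> closed_hemisphere then q (fst x) else 0)"
      by (simp add: sum_fun_eval hemisphere_monomial_def m)
  qed
  finally show ?case by blast
next
  case (const c)
  have "(\<lambda>x. c * hemisphere_monomial (\<lambda>_::'n. 0) x) \<in> polynomials_below 1"
    unfolding polynomials_below_def by (intro real_fun.span_scale real_fun.span_base) auto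
  also have "(\<lambda>x. c * hemisphere_monomial (\<lambda>_::'n. 0) x) = (\<lambda>x. if x \<in> closed_hemisphere then c else 0)"
    by (auto simp: hemisphere_monomial_def monomial_def fun_eq_iff)
  finally show ?case by blast
next
  case (add f g)
  then obtain J K where *: "(\<lambda>x. if x \<in> closed_hemisphere then f (fst x) else 0) \<in> polynomials_below J"
    "(\<lambda>x. if x \<in> closed_hemisphere then g (fst x) else 0) \<in> polynomials_below K" by blast
  have "(\<lambda>x. 1 * (if x \<in> closed_hemisphere then f (fst x) else 0) + 1 * (if x \<in> closed_hemisphere then g (fst x) else 0))
    \<in> polynomials_below (max J K)"
    using * polynomials_below_mono[of J "max J K"] polynomials_below_mono[of K "max J K"]
    by (intro polynomials_below_linear[of _ "max J K"]) auto
  also have "(\<lambda>x. 1 * (if x \<in> closed_hemisphere then f (fst x) else 0) + 1 * (if x \<in> closed_hemisphere then g (fst x) else 0))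
    = (\<lambda>x. if x \<in> closed_hemisphere then f (fst x) + g (fst x) else 0)" by auto
  finally show ?case by blast
next
  case (mult f g)
  then obtain J K where *: "(\<lambda>x. if x \<in> closed_hemisphere then f (fst x) else 0) \<in> polynomials_below J"
    "(\<lambda>x. if x \<in> closed_hemisphere then g (fst x) else 0) \<in> polynomials_below K" by blast
  from polynomials_below_mult[OF this]
  have "(\<lambda>x. (if x \<in> closed_hemisphere then f (fst x) else 0) * (if x \<in> closed_hemisphere then g (fst x) else 0))
    \<in> polynomials_below (J + K)" .
  also have "(\<lambda>x. (if x \<in> closed_hemisphere then f (fst x) else 0) * (if x \<in> closed_hemisphere then g (fst x) else 0))
    = (\<lambda>x. if x \<in> closed_hemisphere then f (fst x) * g (fst x) else 0)" by auto
  finally show ?case by blast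
qed

text \<open>The closed hemisphere is a graph over the closed unit ball. The Stone-Weierstrass
  theorem is therefore applied on the ball in n variables, and monomials in the first n coordinates
  suffice.\<close>

lemma polynomials_dense:
  fixes u :: "(real ^ 'n) \<times> real \<Rightarrow> real"
  assumes "continuous_on closed_hemisphere u" "e > 0"
  obtains K p where "p \<in> polynomials_below K" "\<And>x. x \<in> closed_hemisphere \<Longrightarrow> \<bar>u x - p x\<bar> \<le> e"
proof -
  let ?g = "\<lambda>z. (z, sqrt (1 - (norm z)\<^sup>2)) :: (real ^ 'n) \<times> real"
  have g: "?g z \<in> closed_hemisphere" if "z \<in> cball 0 1" for z
  proof -
    have n: "(norm z)\<^sup>2 \<le> 1" using that power_mono[of "norm z" 1 2] by simp
    then have "norm (?g z) = 1" by (simp add: norm_prod_def)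
    then show ?thesis using n by (simp add: closed_hemisphere_def)
  qed
  have c: "continuous_on (cball 0 1) (\<lambda>z. u (?g z))"
    by (rule continuous_on_compose2[OF assms(1)]) (use g in \<open>auto intro!: continuous_intros\<close>)
  obtain q where q: "real_polynomial_function q" "\<And>z. z \<in> cball 0 1 \<Longrightarrow> \<bar>u (?g z) - q z\<bar> < e"
    using Stone_Weierstrass_real_polynomial_function[OF compact_cball c assms(2)] by blast
  obtain K where K: "(\<lambda>x. if x \<in> closed_hemisphere then q (fst x) else 0) \<in> polynomials_below K"
    using real_polynomial_function_on_hemisphere[OF q(1)] by blast
  show thesis
  proof (rule that[OF K])
    fix x :: "(real ^ 'n) \<times> real" assume x: "x \<in> closed_hemisphere"
    then have x0: "norm x = 1" "snd x \<ge> 0" by (auto simp: closed_hemisphere_def)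
    then have "(norm (fst x))\<^sup>2 + (snd x)\<^sup>2 = 1" using real_sqrt_eq_1_iff by (simp add: norm_prod_def)
    then have n: "1 - (norm (fst x))\<^sup>2 = (snd x)\<^sup>2" by simp
    then have "(norm (fst x))\<^sup>2 \<le> 1" using zero_le_power2[of "snd x"] by linarith
    then have "norm (fst x) \<le> 1" using power2_le_imp_le[of "norm (fst x)" 1] by simp
    moreover have "?g (fst x) = x" using x0 n by (simp add: prod_eq_iff)
    ultimately show "\<bar>u x - (if x \<in> closed_hemisphere then q (fst x) else 0)\<bar> \<le> e"
      using q(2)[of "fst x"] x by simp
  qed
qed

subsection \<open>Completeness of the eigenpolynomials\<close>

text \<open>Vanishing off the closed hemisphere makes the inner product definite on this space: a
  function of norm zero is the zero function.\<close>

definition hemisphere_continuous :: "((real ^ 'n) \<times> real \<Rightarrow> real) set" where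
  "hemisphere_continuous = {u. continuous_on closed_hemisphere u \<and> (\<forall>x. x \<notin> closed_hemisphere \<longrightarrow> u x = 0)}"

lemma subspace_hemisphere_continuous: "real_fun.subspace hemisphere_continuous"
  unfolding real_fun.subspace_def hemisphere_continuous_def
  by (auto simp: zero_fun_def plus_fun_def intro!: continuous_intros)

lemma neumann_eigenspace_continuous: "u \<in> neumann_eigenspace \<kappa> \<Longrightarrow> u \<in> hemisphere_continuous"
  unfolding neumann_eigenspace_def hemisphere_continuous_def using C2_on_imp_continuous_on by auto

lemma subspace_neumann_eigenspace:
  "real_fun.subspace (neumann_eigenspace \<kappa> :: ((real ^ 'n) \<times> real \<Rightarrow> real) set)"
  unfolding real_fun.subspace_def
proof (intro conjI allI ballI)
  show "0 \<in> (neumann_eigenspace \<kappa> :: ((real ^ 'n) \<times> real \<Rightarrow> real) set)"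
    using neumann_pair_zero unfolding neumann_eigenspace_iff by (simp add: zero_fun_def)
  fix u :: "(real ^ 'n) \<times> real \<Rightarrow> real" assume u: "u \<in> neumann_eigenspace \<kappa>"
  show "(\<lambda>x. c * u x) \<in> neumann_eigenspace \<kappa>" for c
    using neumann_pair_linear[OF u[unfolded neumann_eigenspace_iff] u[unfolded neumann_eigenspace_iff], of c 0]
    unfolding neumann_eigenspace_iff by (simp add: algebra_simps)
  show "u + v \<in> neumann_eigenspace \<kappa>" if v: "v \<in> neumann_eigenspace \<kappa>" for v
    using neumann_pair_linear[OF u[unfolded neumann_eigenspace_iff] v[unfolded neumann_eigenspace_iff], of 1 1]
    unfolding neumann_eigenspace_iff by (simp add: algebra_simps plus_fun_def)
qed

lemma hemisphere_mean_combination: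
  assumes "u \<in> hemisphere_continuous" "v \<in> hemisphere_continuous" "w \<in> hemisphere_continuous"
  shows "hemisphere_mean (\<lambda>x. (a * u x + b * v x) * w x) =
    a * hemisphere_mean (\<lambda>x. u x * w x) + b * hemisphere_mean (\<lambda>x. v x * w x)"
proof -
  have "(\<lambda>x. (a * u x + b * v x) * w x) = (\<lambda>x. a * (u x * w x) + b * (v x * w x))"
    by (simp add: fun_eq_iff algebra_simps)
  then show ?thesis
    using hemisphere_mean_linear[of "\<lambda>x. u x * w x" "\<lambda>x. v x * w x" a b] assms
    by (auto simp: hemisphere_continuous_def intro!: continuous_intros)
qed

lemma orthogonal_to_span:
  assumes u: "u \<in> hemisphere_continuous" and B: "B \<subseteq> hemisphere_continuous"
    and orth: "\<And>b. b \<in> B \<Longrightarrow> hemisphere_mean (\<lambda>x. b x * u x) = 0"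
    and p: "p \<in> real_fun.span B"
  shows "hemisphere_mean (\<lambda>x. p x * u x) = 0"
proof -
  let ?S = "{p \<in> hemisphere_continuous. hemisphere_mean (\<lambda>x. p x * u x) = 0}"
  have "real_fun.subspace ?S" unfolding real_fun.subspace_def
  proof (intro conjI allI ballI)
    have "hemisphere_mean (\<lambda>x. (0 * u x + 0 * u x) * u x) = 0"
      by (simp only: hemisphere_mean_combination[OF u u u])
    then show "0 \<in> ?S" using real_fun.subspace_0[OF subspace_hemisphere_continuous] by simp
    fix p assume p: "p \<in> ?S"
    show "(\<lambda>x. c * p x) \<in> ?S" for c
      using hemisphere_mean_combination[of p p u c 0] p u
        real_fun.subspace_scale[OF subspace_hemisphere_continuous, of p c] by simp
    show "p + q \<in> ?S" if q: "q \<in> ?S" for q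
      using hemisphere_mean_combination[of p q u 1 1] p q u
        real_fun.subspace_add[OF subspace_hemisphere_continuous, of p q] by (simp add: plus_fun_def)
  qed
  moreover have "B \<subseteq> ?S" using B orth by blast
  ultimately have "p \<in> ?S" using real_fun.span_minimal p by blast
  then show ?thesis by simp
qed

text \<open>Gram-Schmidt as an induction on \<open>B\<close>. The induction hypothesis is used
  twice, to project \<open>u\<close> and to project the new vector \<open>b\<close> onto the old
  span.\<close>

lemma orthogonal_projection_exists:
  assumes "finite B" "B \<subseteq> hemisphere_continuous" "u \<in> hemisphere_continuous"
  shows "\<exists>p\<in>real_fun.span B. \<forall>b\<in>B. hemisphere_mean (\<lambda>x. b x * (u x - p x)) = 0"
  using assms
proof (induction B arbitrary: u)
  case empty
  then show ?case using real_fun.span_zero by blast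
next
  case (insert b B)
  have spanC: "real_fun.span B \<subseteq> hemisphere_continuous"
    using real_fun.span_minimal[OF _ subspace_hemisphere_continuous] insert.prems by blast
  have spanB: "real_fun.span B \<subseteq> real_fun.span (insert b B)" by (rule real_fun.span_mono) auto
  have diff: "(\<lambda>x. v x - w x) \<in> hemisphere_continuous"
    if "v \<in> hemisphere_continuous" "w \<in> hemisphere_continuous" for v w :: "(real ^ 'a) \<times> real \<Rightarrow> real"
    using real_fun.subspace_diff[OF subspace_hemisphere_continuous that] by (simp add: fun_diff_def)
  obtain p where p: "p \<in> real_fun.span B" "\<And>b. b \<in> B \<Longrightarrow> hemisphere_mean (\<lambda>x. b x * (u x - p x)) = 0"
    using insert.IH[of u] insert.prems by auto
  obtain q where q: "q \<in> real_fun.span B" "\<And>b'. b' \<in> B \<Longrightarrow> hemisphere_mean (\<lambda>x. b' x * (b x - q x)) = 0"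
    using insert.IH[of b] insert.prems by auto
  define v where "v = (\<lambda>x. u x - p x)"
  define c where "c = (\<lambda>x. b x - q x)"
  have vC: "v \<in> hemisphere_continuous" and cC: "c \<in> hemisphere_continuous"
    using p(1) q(1) spanC insert.prems diff unfolding v_def c_def by auto
  have B: "B \<subseteq> hemisphere_continuous" using insert.prems by simp
  \<comment> \<open>If \<open>b\<close> already lies in the old span, then \<open>c\<close> is zero
    and division by zero yields \<open>t = 0\<close>; this case is treated separately in
    \<open>rc\<close>.\<close>
  define t where "t = hemisphere_mean (\<lambda>x. v x * c x) / hemisphere_mean (\<lambda>x. c x * c x)"
  define r where "r = (\<lambda>x. v x - t * c x)"
  have rC: "r \<in> hemisphere_continuous"
    using diff[OF vC real_fun.subspace_scale[OF subspace_hemisphere_continuous cC, of t]] by (simp add: r_def)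
  have r_mean: "hemisphere_mean (\<lambda>x. w x * r x) = hemisphere_mean (\<lambda>x. w x * v x) - t * hemisphere_mean (\<lambda>x. w x * c x)"
    if "w \<in> hemisphere_continuous" for w
    using hemisphere_mean_combination[OF vC cC that, of 1 "- t"] by (simp add: r_def mult.commute)
  have rB: "hemisphere_mean (\<lambda>x. b' x * r x) = 0" if "b' \<in> B" for b'
    using r_mean[of b'] p(2)[OF that] q(2)[OF that] B that by (auto simp: v_def c_def)
  have rc: "hemisphere_mean (\<lambda>x. c x * r x) = 0"
  proof (cases "hemisphere_mean (\<lambda>x. c x * c x) = 0")
    case True
    have "continuous_on closed_hemisphere c" "x \<notin> closed_hemisphere \<Longrightarrow> c x = 0" for x
      using cC unfolding hemisphere_continuous_def by blast+
    then have "c x = 0" for x using hemisphere_mean_square_eq_0[OF _ True, of x] by blast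
    then have "(\<lambda>x. c x * r x) = (\<lambda>x. (0 * c x + 0 * c x) * c x)" by simp
    then show ?thesis by (simp only: hemisphere_mean_combination[OF cC cC cC])
  next
    case False
    have "hemisphere_mean (\<lambda>x. c x * v x) = hemisphere_mean (\<lambda>x. v x * c x)" by (simp add: mult.commute)
    then show ?thesis using r_mean[OF cC] False by (simp add: t_def)
  qed
  have "hemisphere_mean (\<lambda>x. q x * r x) = 0" by (rule orthogonal_to_span[OF rC B rB q(1)])
  with rc hemisphere_mean_combination[OF cC _ rC, of q 1 1] q(1) spanC
  have rb: "hemisphere_mean (\<lambda>x. b x * r x) = 0" by (auto simp: c_def)
  define s where "s = (\<lambda>x. p x + t * c x)"
  have "c \<in> real_fun.span (insert b B)"
    using real_fun.span_diff[OF real_fun.span_base[of b "insert b B"] subsetD[OF spanB q(1)]]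
    by (simp add: c_def fun_diff_def)
  then have "p + (\<lambda>x. t * c x) \<in> real_fun.span (insert b B)"
    using p(1) spanB by (intro real_fun.span_add real_fun.span_scale) auto
  then have "s \<in> real_fun.span (insert b B)" by (simp add: s_def plus_fun_def)
  moreover have "u x - s x = r x" for x by (simp add: s_def r_def v_def)
  ultimately show ?case using rB rb by (intro bexI[of _ s]) auto
qed

lemma eigenfunctions_orthogonal:
  assumes "u \<in> neumann_eigenspace \<kappa>" "v \<in> neumann_eigenspace \<nu>" "\<kappa> \<noteq> \<nu>"
  shows "hemisphere_mean (\<lambda>x. v x * u x) = 0"
proof -
  have C: "u \<in> hemisphere_continuous" "v \<in> hemisphere_continuous"
    using assms neumann_eigenspace_continuous by blast+
  have "hemisphere_mean (\<lambda>x. u x * (- \<nu> * v x) - v x * (- \<kappa> * u x)) = 0"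
    using neumann_green[OF assms(1,2)[unfolded neumann_eigenspace_iff]]
    by (simp add: hemisphere_mean_def hemisphere_weight_def[abs_def])
  moreover have "(\<lambda>x. u x * (- \<nu> * v x) - v x * (- \<kappa> * u x)) = (\<lambda>x. ((\<kappa> - \<nu>) * v x + 0 * v x) * u x)"
    by (simp add: fun_eq_iff algebra_simps)
  ultimately have "(\<kappa> - \<nu>) * hemisphere_mean (\<lambda>x. v x * u x) = 0"
    by (simp only: hemisphere_mean_combination[OF C(2,2,1)])
  then show ?thesis using assms(3) by simp
qed

text \<open>Green's identity already gives orthogonality to eigenpolynomials with other eigenvalues.
  Thus \<open>u\<close> is orthogonal to all polynomials \<open>p\<close>, and the mean of
  \<open>u * u\<close> equals that of \<open>(u - p) * u\<close>, which density makes arbitrarily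
  small.\<close>

lemma eigenfunction_eq_0_if_orthogonal:
  fixes u :: "(real ^ 'n::finite) \<times> real \<Rightarrow> real"
  assumes u: "u \<in> neumann_eigenspace \<kappa>"
    and orth: "\<And>\<beta>. hemisphere_eigenvalue CARD('n) (sum \<beta> UNIV) = \<kappa> \<Longrightarrow>
      hemisphere_mean (\<lambda>x. eigenpolynomial \<beta> x * u x) = 0"
  shows "u = 0"
proof -
  have uC: "u \<in> hemisphere_continuous" by (rule neumann_eigenspace_continuous[OF u])
  then have cu: "continuous_on closed_hemisphere u" by (simp add: hemisphere_continuous_def)
  have EC: "eigenpolynomial \<beta> \<in> hemisphere_continuous" for \<beta> :: "'n \<Rightarrow> nat"
    using eigenpolynomial(1) neumann_eigenspace_continuous by blast
  have E: "hemisphere_mean (\<lambda>x. eigenpolynomial \<beta> x * u x) = 0" for \<beta>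
    using orth[of \<beta>] eigenfunctions_orthogonal[OF u eigenpolynomial(1)[of \<beta>]] by blast
  have P: "hemisphere_mean (\<lambda>x. p x * u x) = 0" "continuous_on closed_hemisphere p"
    if p: "p \<in> polynomials_below K" for p K
  proof -
    let ?B = "eigenpolynomial ` {\<beta> :: 'n \<Rightarrow> nat. sum \<beta> UNIV < K}"
    have *: "p \<in> real_fun.span ?B" using p span_eigenpolynomials by blast
    have B: "?B \<subseteq> hemisphere_continuous" using EC by auto
    show "hemisphere_mean (\<lambda>x. p x * u x) = 0"
      by (rule orthogonal_to_span[OF uC B _ *]) (use E in auto)
    have "p \<in> hemisphere_continuous"
      using real_fun.span_minimal[OF B subspace_hemisphere_continuous] * by blast
    then show "continuous_on closed_hemisphere p" by (simp add: hemisphere_continuous_def)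
  qed
  obtain b where b: "b > 0" "\<And>x. x \<in> closed_hemisphere \<Longrightarrow> \<bar>u x\<bar> \<le> b"
    using compact_imp_bounded[OF compact_continuous_image[OF cu compact_closed_hemisphere]]
    unfolding bounded_pos by auto
  define c where "c = b * hemisphere_mean (\<lambda>_ :: (real ^ 'n) \<times> real. 1)"
  have "\<bar>hemisphere_mean (\<lambda>x. u x * u x)\<bar> \<le> 0 + e" if "e > 0" for e
  proof -
    define d where "d = e / (\<bar>c\<bar> + 1)"
    have "d > 0" using that by (simp add: d_def)
    then obtain K p where p: "p \<in> polynomials_below K" "\<And>x. x \<in> closed_hemisphere \<Longrightarrow> \<bar>u x - p x\<bar> \<le> d"
      using polynomials_dense[OF cu] by blast
    have "hemisphere_mean (\<lambda>x. 1 * (u x * u x) + (- 1) * (p x * u x)) = hemisphere_mean (\<lambda>x. u x * u x)"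
      using P[OF p(1)] cu by (subst hemisphere_mean_linear) (auto intro!: continuous_intros)
    moreover have "(\<lambda>x. 1 * (u x * u x) + (- 1) * (p x * u x)) = (\<lambda>x. (u x - p x) * u x)"
      by (simp add: fun_eq_iff algebra_simps)
    ultimately have "\<bar>hemisphere_mean (\<lambda>x. u x * u x)\<bar> = \<bar>hemisphere_mean (\<lambda>x. (u x - p x) * u x)\<bar>" by simp
    also have "\<dots> \<le> (d * b) * hemisphere_mean (\<lambda>_ :: (real ^ 'n) \<times> real. 1)"
    proof (rule hemisphere_mean_bound)
      show "continuous_on closed_hemisphere (\<lambda>x. (u x - p x) * u x)" by (intro continuous_intros cu P[OF p(1)])
      show "\<bar>(u x - p x) * u x\<bar> \<le> d * b" if "x \<in> closed_hemisphere" for x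
        unfolding abs_mult using p(2)[OF that] b that \<open>d > 0\<close> by (intro mult_mono) auto
    qed
    also have "\<dots> = d * c" by (simp add: c_def)
    also have "\<dots> \<le> d * (\<bar>c\<bar> + 1)" using \<open>d > 0\<close> by (intro mult_left_mono) auto
    also have "\<dots> = e" by (simp add: d_def)
    finally show ?thesis by simp
  qed
  then have "\<bar>hemisphere_mean (\<lambda>x. u x * u x)\<bar> \<le> 0" by (rule field_le_epsilon)
  then have "u x = 0" if "x \<in> closed_hemisphere" for x
    using hemisphere_mean_square_eq_0[OF cu _ that] by simp
  then show "u = 0" using uC by (auto simp: hemisphere_continuous_def fun_eq_iff)
qed

text \<open>An eigenfunction minus its projection stays in the eigenspace and is orthogonal to the
  eigenpolynomials there. When no index has the eigenvalue \<open>\<kappa>\<close>, the span is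
  trivial, which excludes further eigenvalues.\<close>

lemma neumann_eigenspace_span:
  fixes \<kappa> :: real
  defines "A \<equiv> {\<beta> :: 'n::finite \<Rightarrow> nat. hemisphere_eigenvalue CARD('n) (sum \<beta> UNIV) = \<kappa>}"
  assumes "finite A"
  shows "real_fun.span (eigenpolynomial ` A) = neumann_eigenspace \<kappa>"
proof
  have E: "eigenpolynomial ` A \<subseteq> neumann_eigenspace \<kappa>" using eigenpolynomial(1) by (auto simp: A_def)
  show sub: "real_fun.span (eigenpolynomial ` A) \<subseteq> neumann_eigenspace \<kappa>"
    by (rule real_fun.span_minimal[OF E subspace_neumann_eigenspace])
  show "neumann_eigenspace \<kappa> \<subseteq> real_fun.span (eigenpolynomial ` A)"
  proof
    fix u :: "(real ^ 'n) \<times> real \<Rightarrow> real" assume u: "u \<in> neumann_eigenspace \<kappa>"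
    obtain p where p: "p \<in> real_fun.span (eigenpolynomial ` A)"
      "\<And>b. b \<in> eigenpolynomial ` A \<Longrightarrow> hemisphere_mean (\<lambda>x. b x * (u x - p x)) = 0"
      using orthogonal_projection_exists[of "eigenpolynomial ` A" u] assms(2) E u neumann_eigenspace_continuous by blast
    have "u - p \<in> neumann_eigenspace \<kappa>"
      using sub p(1) by (intro real_fun.subspace_diff[OF subspace_neumann_eigenspace u]) blast
    then have "u - p = 0"
      by (rule eigenfunction_eq_0_if_orthogonal) (use p(2) in \<open>auto simp: A_def\<close>)
    then show "u \<in> real_fun.span (eigenpolynomial ` A)" using p(1) by simp
  qed
qed

lemma neumann_eigenspace_basis:
  obtains B :: "((real ^ 'n::finite) \<times> real \<Rightarrow> real) set" where "finite B" "real_fun.independent B"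
    "real_fun.span B = neumann_eigenspace (hemisphere_eigenvalue CARD('n) K)" "card B = chain_mult CARD('n) K"
proof -
  let ?A = "{\<beta> :: 'n \<Rightarrow> nat. sum \<beta> UNIV = K}"
  have eq: "{\<beta> :: 'n \<Rightarrow> nat. hemisphere_eigenvalue CARD('n) (sum \<beta> UNIV) = hemisphere_eigenvalue CARD('n) K} = ?A"
    by (simp add: hemisphere_eigenvalue_inject)
  have fin: "finite ?A" by (rule finite_multi_indices)
  have sub: "?A \<subseteq> {\<beta>. sum \<beta> UNIV < Suc K}" by auto
  show thesis
  proof (rule that[of "eigenpolynomial ` ?A"])
    show "real_fun.independent (eigenpolynomial ` ?A)"
      by (rule real_fun.independent_mono[OF eigenpolynomials_independent(2) image_mono[OF sub]])
    show "real_fun.span (eigenpolynomial ` ?A) = neumann_eigenspace (hemisphere_eigenvalue CARD('n) K)"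
      using neumann_eigenspace_span[where 'n='n, of "hemisphere_eigenvalue CARD('n) K"] fin unfolding eq .
    have "inj_on eigenpolynomial ?A"
      by (rule inj_on_subset[OF eigenpolynomials_independent(1) sub])
    then show "card (eigenpolynomial ` ?A) = chain_mult CARD('n) K"
      by (simp add: card_image card_multi_indices)
  qed (use fin in simp)
qed

lemma neumann_eigenspace_trivial:
  assumes "\<And>K. \<kappa> \<noteq> hemisphere_eigenvalue CARD('n::finite) K"
  shows "neumann_eigenspace \<kappa> = ({0} :: ((real ^ 'n) \<times> real \<Rightarrow> real) set)"
proof -
  have "{\<beta> :: 'n \<Rightarrow> nat. hemisphere_eigenvalue CARD('n) (sum \<beta> UNIV) = \<kappa>} = {}"
    using assms by (auto simp: eq_commute)
  then show ?thesis using neumann_eigenspace_span[where 'n='n, of \<kappa>] by simp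
qed

subsection \<open>The ordered spectrum\<close>

lemma chain_lowest_0: "chain_lowest n 0 = 0"
  by (simp add: chain_lowest_def)

lemma chain_lowest_Suc: "chain_lowest n (Suc K) = chain_lowest n K + chain_mult n K"
  by (simp add: chain_lowest_def)

lemma chain_mult_pos: "chain_mult n K > 0"
  by (simp add: chain_mult_def)

text \<open>The source of \<open>k + 1\<close> in the lower estimate. The subtraction in
  \<open>chain_highest\<close> is harmless because every chain is nonempty.\<close>

lemma chain_highest_Suc: "chain_highest n K + 1 = chain_lowest n (Suc K)"
proof -
  have "chain_highest n K = chain_lowest n (Suc K) - 1"
    by (simp add: chain_highest_def chain_lowest_def lessThan_Suc_atMost)
  then show ?thesis using chain_mult_pos[of n K] by (simp add: chain_lowest_Suc)
qed

lemma chain_lowest_mono: "J \<le> K \<Longrightarrow> chain_lowest n J \<le> chain_lowest n K"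
  by (rule lift_Suc_mono_le[of "chain_lowest n"]) (auto simp: chain_lowest_Suc)

lemma le_chain_lowest: "K \<le> chain_lowest n K"
proof (induction K)
  case (Suc K)
  then show ?case using chain_mult_pos[of n K] by (simp add: chain_lowest_Suc)
qed simp

definition chain_index :: "nat \<Rightarrow> nat \<Rightarrow> nat" where
  "chain_index n k = (LEAST K. k < chain_lowest n (Suc K))"

lemma chain_index_bounds:
  "chain_lowest n (chain_index n k) \<le> k" "k < chain_lowest n (Suc (chain_index n k))"
proof -
  have ex: "k < chain_lowest n (Suc k)" using le_chain_lowest[of "Suc k" n] by simp
  show "k < chain_lowest n (Suc (chain_index n k))"
    unfolding chain_index_def by (rule LeastI[of _ k]) (rule ex)
  show "chain_lowest n (chain_index n k) \<le> k"
  proof (cases "chain_index n k")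
    case (Suc J)
    then have "\<not> k < chain_lowest n (Suc J)" 
      using not_less_Least[of J "\<lambda>K. k < chain_lowest n (Suc K)"] by (simp add: chain_index_def)
    then show ?thesis using Suc by simp
  qed (simp add: chain_lowest_0)
qed

lemma chain_index_eq_iff:
  "chain_index n k = K \<longleftrightarrow> chain_lowest n K \<le> k \<and> k < chain_lowest n (Suc K)"
proof
  assume K: "chain_lowest n K \<le> k \<and> k < chain_lowest n (Suc K)"
  note b = chain_index_bounds[where n=n and k=k]
  show "chain_index n k = K"
  proof (rule ccontr)
    assume "chain_index n k \<noteq> K"
    then consider "Suc (chain_index n k) \<le> K" | "Suc K \<le> chain_index n k" by linarith
    then show False
      using chain_lowest_mono[of "Suc (chain_index n k)" K n] chain_lowest_mono[of "Suc K" "chain_index n k" n] b K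
      by cases auto
  qed
qed (use chain_index_bounds in auto)

lemma finite_initial_segment:
  assumes "finite D" "\<And>i j. j \<in> D \<Longrightarrow> i \<le> j \<Longrightarrow> i \<in> D"
  shows "D = {..<card D}"
proof (cases "D = {}")
  case False
  have "D = {..Max D}" using assms False by (auto intro: assms(2)[OF Max_in])
  then have "D = {..<Suc (Max D)}" by (simp add: lessThan_Suc_atMost)
  then show ?thesis by (metis card_lessThan)
qed simp

text \<open>Both directions are needed to evaluate the description defining
  \<open>neumann_eigenvalue\<close>. For uniqueness, the multiplicities determine how many indices
  lie below each eigenvalue, and monotonicity determines which ones.\<close>

lemma neumann_spectrum_enum_iff:
  "neumann_spectrum_enum TYPE('n::finite) \<mu> \<longleftrightarrow>
    \<mu> = (\<lambda>k. hemisphere_eigenvalue CARD('n) (chain_index CARD('n) k))"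
proof
  let ?n = "CARD('n)"
  let ?l = "hemisphere_eigenvalue ?n"
  have n: "?n > 0" by simp
  assume \<mu>: "neumann_spectrum_enum TYPE('n) \<mu>"
  \<comment> \<open>The basis in the definition is only asserted to exist; its size is compared with
    that of a basis of eigenpolynomials.\<close>
  have level: "finite {k. \<mu> k = ?l K} \<and> card {k. \<mu> k = ?l K} = chain_mult ?n K" for K
  proof -
    obtain B :: "((real ^ 'n) \<times> real \<Rightarrow> real) set" where B: "real_fun.independent B"
      "real_fun.span B = neumann_eigenspace (?l K)" "{k. \<mu> k = ?l K} \<approx> B"
      using \<mu> unfolding neumann_spectrum_enum_def by metis
    obtain B' :: "((real ^ 'n) \<times> real \<Rightarrow> real) set" where B': "finite B'" "real_fun.independent B'"
      "real_fun.span B' = neumann_eigenspace (?l K)" "card B' = chain_mult ?n K"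
      by (rule neumann_eigenspace_basis)
    have "B \<subseteq> real_fun.span B'" using real_fun.span_superset[of B] B(2) B'(3) by simp
    then have fin: "finite B" using real_fun.independent_span_bound[OF B'(1) B(1)] by blast
    have "card B = card B'"
      using real_fun.dim_span_eq_card_independent[OF B(1)] real_fun.dim_span_eq_card_independent[OF B'(2)] B(2) B'(3)
      by simp
    then show ?thesis using B(3) fin B'(4) eqpoll_finite_iff eqpoll_iff_card by metis
  qed
  have vals: "\<exists>K. \<mu> k = ?l K" for k
  proof (rule ccontr)
    assume "\<nexists>K. \<mu> k = ?l K"
    then have triv: "neumann_eigenspace (\<mu> k) = ({0} :: ((real ^ 'n) \<times> real \<Rightarrow> real) set)"
      by (intro neumann_eigenspace_trivial) auto
    obtain B :: "((real ^ 'n) \<times> real \<Rightarrow> real) set" where B: "real_fun.independent B"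
      "real_fun.span B = neumann_eigenspace (\<mu> k)" "{j. \<mu> j = \<mu> k} \<approx> B"
      using \<mu> unfolding neumann_spectrum_enum_def by metis
    have "B \<subseteq> {0}" using real_fun.span_superset[of B] B(2) triv by simp
    moreover have "0 \<notin> B" using B(1) real_fun.dependent_zero by blast
    ultimately have "B = {}" by blast
    then have "{j. \<mu> j = \<mu> k} = {}" using B(3) by simp
    then show False by blast
  qed
  have mono: "mono \<mu>" using \<mu> by (simp add: neumann_spectrum_enum_def)
  \<comment> \<open>A union of level sets of known sizes, and an initial segment of the natural
    numbers by monotonicity.\<close>
  have sublevel: "{j. \<mu> j \<le> ?l K} = {..<chain_lowest ?n (Suc K)}" for K
  proof -
    have *: "{j. \<mu> j \<le> ?l K} = (\<Union>J\<in>{..K}. {j. \<mu> j = ?l J})"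
    proof -
      have "?l J \<le> ?l K \<longleftrightarrow> J \<le> K" for J
        using hemisphere_eigenvalue_less[OF n, of J K] hemisphere_eigenvalue_less[OF n, of K J]
        by (cases J K rule: linorder_cases) auto
      then show ?thesis using vals by fastforce
    qed
    have fin: "finite {j. \<mu> j \<le> ?l K}" unfolding * using level by auto
    have "card {j. \<mu> j \<le> ?l K} = (\<Sum>J\<le>K. card {j. \<mu> j = ?l J})"
      unfolding * by (rule card_UN_disjoint) (use level hemisphere_eigenvalue_inject[OF n] in auto)
    also have "\<dots> = chain_lowest ?n (Suc K)"
      using level by (simp add: chain_lowest_def lessThan_Suc_atMost)
    finally have "card {j. \<mu> j \<le> ?l K} = chain_lowest ?n (Suc K)" .
    moreover have "i \<in> {j. \<mu> j \<le> ?l K}" if "j \<in> {j. \<mu> j \<le> ?l K}" "i \<le> j" for i j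
      using that monoD[OF mono that(2)] by auto
    ultimately show ?thesis using finite_initial_segment[OF fin] by metis
  qed
  show "\<mu> = (\<lambda>k. ?l (chain_index ?n k))"
  proof
    fix k
    obtain K where K: "\<mu> k = ?l K" using vals by blast
    have "k \<in> {j. \<mu> j \<le> ?l K}" using K by simp
    then have "k < chain_lowest ?n (Suc K)" unfolding sublevel by simp
    moreover have "chain_lowest ?n K \<le> k"
    proof (cases K)
      case (Suc J)
      have "\<not> \<mu> k \<le> ?l J" using hemisphere_eigenvalue_less[OF n, of J K] K Suc by simp
      then have "k \<notin> {j. \<mu> j \<le> ?l J}" by simp
      then show ?thesis unfolding sublevel Suc by simp
    qed (simp add: chain_lowest_0)
    ultimately show "\<mu> k = ?l (chain_index ?n k)" using chain_index_eq_iff K by metis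
  qed
next
  let ?n = "CARD('n)"
  let ?l = "hemisphere_eigenvalue ?n"
  have n: "?n > 0" by simp
  assume \<mu>: "\<mu> = (\<lambda>k. ?l (chain_index ?n k))"
  show "neumann_spectrum_enum TYPE('n) \<mu>"
    unfolding neumann_spectrum_enum_def
  proof (intro conjI allI)
    show "mono \<mu>"
    proof (rule monoI)
      fix j k :: nat assume jk: "j \<le> k"
      have "chain_index ?n j \<le> chain_index ?n k"
        unfolding chain_index_def[of _ j] by (rule Least_le) (use jk chain_index_bounds(2)[of k ?n] in simp)
      then show "\<mu> j \<le> \<mu> k" unfolding \<mu>
        using hemisphere_eigenvalue_less[OF n, of "chain_index ?n j" "chain_index ?n k"] by (auto simp: le_less)
    qed
    fix \<kappa>
    show "\<exists>B :: ((real ^ 'n) \<times> real \<Rightarrow> real) set. real_fun.independent B \<and>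
        real_fun.span B = neumann_eigenspace \<kappa> \<and> {k. \<mu> k = \<kappa>} \<approx> B"
    proof (cases "\<exists>K. \<kappa> = ?l K")
      case True
      then obtain K where K: "\<kappa> = ?l K" by blast
      obtain B :: "((real ^ 'n) \<times> real \<Rightarrow> real) set" where B: "finite B" "real_fun.independent B"
        "real_fun.span B = neumann_eigenspace (?l K)" "card B = chain_mult ?n K"
        by (rule neumann_eigenspace_basis)
      have "{k. \<mu> k = \<kappa>} = {chain_lowest ?n K..<chain_lowest ?n (Suc K)}"
        by (auto simp: \<mu> K hemisphere_eigenvalue_inject chain_index_eq_iff)
      then have "{k. \<mu> k = \<kappa>} \<approx> B"
        using B(1,4) by (simp add: eqpoll_iff_card chain_lowest_Suc)
      then show ?thesis using B K by blast
    next
      case False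
      then have "neumann_eigenspace \<kappa> = ({0} :: ((real ^ 'n) \<times> real \<Rightarrow> real) set)"
        by (intro neumann_eigenspace_trivial) auto
      moreover have "{k. \<mu> k = \<kappa>} = {}" using False by (auto simp: \<mu>)
      ultimately show ?thesis using real_fun.independent_empty by (intro exI[of _ "{}"]) simp
    qed
  qed
qed

lemma neumann_eigenvalue_eq:
  "neumann_eigenvalue TYPE('n::finite) k = hemisphere_eigenvalue CARD('n) (chain_index CARD('n) k)"
  unfolding neumann_eigenvalue_def neumann_spectrum_enum_iff by simp

subsection \<open>The Weyl constant\<close>

lemma unit_ball_vol_add_2:
  assumes "x \<ge> 0" shows "unit_ball_vol (x + 2) = unit_ball_vol x * (2 * pi / (x + 2))"
proof -
  have G: "Gamma ((x + 2) / 2 + 1) = (x / 2 + 1) * Gamma (x / 2 + 1)"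
    using Gamma_plus1[of "x / 2 + 1"] assms by (simp add: add_divide_distrib nonpos_Ints_def add.assoc)
  have "pi powr ((x + 2) / 2) = pi powr (x / 2) * pi" by (simp add: add_divide_distrib powr_add)
  then show ?thesis unfolding unit_ball_vol_def G using assms
    by (simp add: field_simps)
qed

text \<open>In the product of two consecutive volumes the half-integer Gamma values combine into a
  factorial, which avoids a distinction by parity. The recursion in steps of two replaces one factor
  by the next.\<close>

lemma unit_ball_vol_mult_Suc:
  "unit_ball_vol (real n) * unit_ball_vol (real (Suc n)) = 2 ^ Suc n * pi ^ n / fact (Suc n)"
proof (induction n)
  case (Suc n)
  have "unit_ball_vol (real (Suc (Suc n))) = unit_ball_vol (real n) * (2 * pi / (real n + 2))"
    using unit_ball_vol_add_2[of "real n"] by (simp add: add.commute)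
  then have "unit_ball_vol (real (Suc n)) * unit_ball_vol (real (Suc (Suc n))) =
    (unit_ball_vol (real n) * unit_ball_vol (real (Suc n))) * (2 * pi / (real n + 2))" by (simp only: mult_ac)
  also have "\<dots> = 2 ^ Suc n * pi ^ n / fact (Suc n) * (2 * pi / (real n + 2))" by (simp only: Suc.IH)
  also have "\<dots> = 2 ^ Suc (Suc n) * pi ^ Suc n / fact (Suc (Suc n))"
    by (simp add: field_simps)
  finally show ?case .
qed simp

text \<open>The cone over the hemisphere is the upper half of the unit ball. Reflection in the
  origin maps it to the lower half, and the equatorial disc is negligible.\<close>

lemma sphere_measure_hemisphere:
  "sphere_measure (hemisphere :: ((real ^ 'n::finite) \<times> real) set) =
     (real CARD('n) + 1) * unit_ball_vol (real CARD('n) + 1) / 2"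
proof -
  let ?P = "{y :: (real ^ 'n) \<times> real. snd y > 0} \<inter> cball 0 1"
  let ?M = "{y :: (real ^ 'n) \<times> real. snd y < 0} \<inter> cball 0 1"
  have cone: "{r *\<^sub>R x | r x. 0 < r \<and> r \<le> 1 \<and> x \<in> (hemisphere :: ((real ^ 'n) \<times> real) set)} = ?P"
  proof (intro equalityI subsetI)
    fix y assume "y \<in> {r *\<^sub>R x | r x. 0 < r \<and> r \<le> 1 \<and> x \<in> (hemisphere :: ((real ^ 'n) \<times> real) set)}"
    then obtain r x where r: "y = r *\<^sub>R x" "0 < r" "r \<le> 1" "norm x = 1" "snd x > 0"
      by (auto simp: hemisphere_def)
    then show "y \<in> ?P" by simp
  next
    fix y assume y: "y \<in> ?P"
    then have y0: "y \<noteq> 0" by auto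
    then have "norm (y /\<^sub>R norm y) = 1" "snd (y /\<^sub>R norm y) > 0" using y by auto
    then have "y /\<^sub>R norm y \<in> hemisphere" unfolding hemisphere_def by blast
    moreover have "y = norm y *\<^sub>R (y /\<^sub>R norm y)" "0 < norm y" "norm y \<le> 1" using y y0 by auto
    ultimately show "y \<in> {r *\<^sub>R x | r x. 0 < r \<and> r \<le> 1 \<and> x \<in> (hemisphere :: ((real ^ 'n) \<times> real) set)}"
      by blast
  qed
  have op: "open {y :: (real ^ 'n) \<times> real. snd y > 0}" "open {y :: (real ^ 'n) \<times> real. snd y < 0}"
    by (intro open_Collect_less continuous_intros)+
  have lm: "?P \<in> lmeasurable" "?M \<in> lmeasurable"
    using op by (auto intro!: fmeasurable_Int_fmeasurable simp: Int_commute[of _ "cball 0 1"] lmeasurable_cball)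
  have "(\<lambda>y. (-1) *\<^sub>R y + 0) ` ?P = ?M"
  proof (intro equalityI subsetI)
    fix y assume "y \<in> (\<lambda>y. (-1) *\<^sub>R y + 0) ` ?P"
    then obtain z where "y = - z" "z \<in> ?P" by auto
    then show "y \<in> ?M" by simp
  next
    fix y assume "y \<in> ?M"
    then have "- y \<in> ?P" by simp
    then show "y \<in> (\<lambda>y. (-1) *\<^sub>R y + 0) ` ?P" by (rule rev_image_eqI) simp
  qed
  then have "measure lebesgue ?M = \<bar>-1\<bar> ^ DIM((real ^ 'n) \<times> real) * measure lebesgue ?P"
    using measure_lebesgue_affine[of "-1" 0 ?P] by simp
  then have PM: "measure lebesgue ?M = measure lebesgue ?P" by simp
  have "measure lebesgue (cball (0 :: (real ^ 'n) \<times> real) 1) = measure lebesgue (?P \<union> ?M)"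
  proof (rule measure_negligible_symdiff)
    have "negligible {y :: (real ^ 'n) \<times> real. (0, 1) \<bullet> y = 0}"
      by (rule negligible_hyperplane) (simp add: zero_prod_def)
    then show "negligible ((?P \<union> ?M) - cball 0 1 \<union> (cball 0 1 - (?P \<union> ?M)))"
      by (rule negligible_subset) (auto simp: inner_prod_def)
  qed (use lm in auto)
  also have "\<dots> = measure lebesgue ?P + measure lebesgue ?M"
    by (rule measure_Union) (use lm in \<open>auto simp: fmeasurable_def less_top[symmetric]\<close>)
  finally have "measure lebesgue ?P = measure lebesgue (cball (0 :: (real ^ 'n) \<times> real) 1) / 2" using PM by simp
  also have "measure lebesgue (cball (0 :: (real ^ 'n) \<times> real) 1) = unit_ball_vol (real CARD('n) + 1)"
    using content_cball[of 1 "0 :: (real ^ 'n) \<times> real"] by (simp add: add.commute)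
  finally show ?thesis unfolding sphere_measure_def cone by (simp add: add.commute)
qed

text \<open>The volumes of the unit ball and the hemisphere multiply to (2 pi)^n / n!, so the factor
  4 pi^2 cancels.\<close>

lemma weyl_constant_hemisphere:
  assumes "n = CARD('n::finite)"
  shows "weyl_constant n (sphere_measure (hemisphere :: ((real ^ 'n) \<times> real) set)) = fact n powr (2 / real n)"
proof -
  have n: "real n > 0" using assms by simp
  have "unit_ball_vol (real n) * sphere_measure (hemisphere :: ((real ^ 'n) \<times> real) set) =
    (real n + 1) / 2 * (unit_ball_vol (real n) * unit_ball_vol (real (Suc n)))"
    unfolding sphere_measure_hemisphere assms[symmetric] by (simp add: add.commute)
  also have "\<dots> = (2 * pi) ^ n / fact n"
  proof -
    have "a / 2 * (2 * x * p / (a * f)) = x * p / f" if "a > 0" for a x p f :: real using that by simp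
    from this[of "real n + 1" "2 ^ n" "pi ^ n" "fact n"] show ?thesis
      unfolding unit_ball_vol_mult_Suc fact_Suc power_Suc power_mult_distrib by (simp add: add.commute)
  qed
  also have "\<dots> = (2 * pi) powr real n / fact n" by (simp add: powr_realpow)
  finally have "weyl_constant n (sphere_measure (hemisphere :: ((real ^ 'n) \<times> real) set)) =
    4 * pi\<^sup>2 / (((2 * pi) powr real n / fact n) powr (2 / real n))" by (simp add: weyl_constant_def)
  also have "((2 * pi) powr real n / fact n) powr (2 / real n) = (2 * pi) powr 2 / fact n powr (2 / real n)"
    using n by (simp add: powr_divide powr_powr)
  also have "(2 * pi) powr 2 = 4 * pi\<^sup>2" by (simp add: powr_numeral power_mult_distrib)
  finally show ?thesis by simp
qed

subsection \<open>The geometric mean of a chain\<close>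

text \<open>The hockey-stick identity for binomial coefficients, in rising factorials.\<close>

lemma fact_mult_chain_lowest:
  assumes "n > 0" shows "fact n * real (chain_lowest n K) = pochhammer (real K) n"
proof (induction K)
  case 0
  then show ?case using assms by (simp add: chain_lowest_0 pochhammer_0_left)
next
  case (Suc K)
  obtain m where m: "n = Suc m" using assms by (cases n) auto
  have "real (chain_mult n K) = of_nat (K + m) gchoose m"
    by (simp add: chain_mult_def m binomial_gbinomial add.commute)
  also have "\<dots> = pochhammer (real K + 1) m / fact m" by (simp add: gbinomial_pochhammer')
  finally have "fact n * real (chain_mult n K) = (real m + 1) * pochhammer (real K + 1) m"
    by (simp add: m field_simps)
  then have "fact n * real (chain_lowest n (Suc K)) = pochhammer (real K) n + (real m + 1) * pochhammer (real K + 1) m"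
    using Suc.IH by (simp add: chain_lowest_Suc distrib_left)
  also have "\<dots> = (real K + 1 + real m) * pochhammer (real K + 1) m"
    by (simp add: m pochhammer_rec algebra_simps)
  also have "\<dots> = pochhammer (real (Suc K)) n" by (simp add: m pochhammer_Suc add.commute mult.commute)
  finally show ?case .
qed

definition chain_gm :: "nat \<Rightarrow> nat \<Rightarrow> real" where
  "chain_gm n K = pochhammer (real K) n powr (1 / real n)"

text \<open>Pairing the factors \<open>K + i\<close> and \<open>K + n - 1 - i\<close> makes the products \<open>y\<^sup>2 - d\<^sup>2\<close> with
  \<open>y = K + (n - 1) / 2\<close>, whose arithmetic mean is known exactly.\<close>

lemma chain_gm_square:
  assumes "n > 0"
  shows "(chain_gm n K)\<^sup>2 = (\<Prod>i<n. (real K + (real n - 1) / 2)\<^sup>2 - (real i - (real n - 1) / 2)\<^sup>2) powr (1 / real n)"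
proof -
  let ?P = "pochhammer (real K) n"
  have P: "?P = (\<Prod>i<n. real K + real i)"
    by (simp add: pochhammer_prod lessThan_atLeast0)
  also have "\<dots> = (\<Prod>i<n. real K + (real n - 1 - real i))"
    by (subst prod.nat_diff_reindex[symmetric]) (auto intro!: prod.cong simp: of_nat_diff)
  finally have "?P * ?P = (\<Prod>i<n. (real K + real i) * (real K + (real n - 1 - real i)))"
    unfolding prod.distrib using P by simp
  also have "\<dots> = (\<Prod>i<n. (real K + (real n - 1) / 2)\<^sup>2 - (real i - (real n - 1) / 2)\<^sup>2)"
    by (intro prod.cong refl) (simp add: power2_eq_square field_simps)
  finally have PP: "?P * ?P = (\<Prod>i<n. (real K + (real n - 1) / 2)\<^sup>2 - (real i - (real n - 1) / 2)\<^sup>2)" .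
  have "?P \<ge> 0" unfolding P by (intro prod_nonneg) auto
  then show ?thesis unfolding PP[symmetric] chain_gm_def by (simp add: powr_mult power2_eq_square)
qed

lemma chain_deviation_bounds:
  assumes "i < n"
  shows "(real i - (real n - 1) / 2)\<^sup>2 \<le> ((real n - 1) / 2)\<^sup>2"
proof -
  have "real i \<le> real n - 1" using assms by linarith
  then show ?thesis by (intro abs_le_square_iff[THEN iffD1]) (auto simp: abs_le_iff field_simps)
qed

lemma sum_chain_deviation:
  "(\<Sum>i<n. (real i - (real n - 1) / 2)\<^sup>2) = real n * (((real n)\<^sup>2 - 1) / 12)"
proof -
  \<comment> \<open>The centre \<open>a\<close> is kept free, since \<open>(real n - 1) / 2\<close>
    would move during the induction.\<close>
  have "(\<Sum>i<m. (real i - a)\<^sup>2) = real m * (real m - 1) * (2 * real m - 1) / 6 - a * real m * (real m - 1) + real m * a\<^sup>2" for m a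
    by (induction m) (auto simp: field_simps power2_eq_square)
  from this[of "(real n - 1) / 2" n] show ?thesis by (simp add: field_simps power2_eq_square)
qed

lemma chain_gm_square_upper:
  assumes "n > 0"
  shows "(chain_gm n K)\<^sup>2 \<le> (real K + (real n - 1) / 2)\<^sup>2 - ((real n)\<^sup>2 - 1) / 12"
proof -
  let ?y = "real K + (real n - 1) / 2" and ?d = "\<lambda>i. real i - (real n - 1) / 2"
  have nn: "?y\<^sup>2 - (?d i)\<^sup>2 \<ge> 0" if "i < n" for i
  proof -
    have "((real n - 1) / 2)\<^sup>2 \<le> ?y\<^sup>2" using assms by (intro power_mono) auto
    then show ?thesis using chain_deviation_bounds[OF that] by linarith
  qed
  have "(chain_gm n K)\<^sup>2 \<le> (\<Sum>i<n. (?y\<^sup>2 - (?d i)\<^sup>2) / real n)"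
    unfolding chain_gm_square[OF assms]
    using arith_geom_mean[of "{..<n}" "\<lambda>i. ?y\<^sup>2 - (?d i)\<^sup>2"] nn assms by auto
  also have "\<dots> = ?y\<^sup>2 - (\<Sum>i<n. (?d i)\<^sup>2) / real n"
    using assms by (simp add: sum_subtractf diff_divide_distrib flip: sum_divide_distrib)
  also have "\<dots> = ?y\<^sup>2 - ((real n)\<^sup>2 - 1) / 12" using assms by (simp add: sum_chain_deviation)
  finally show ?thesis .
qed

text \<open>Among the paired products the outermost one, of \<open>K\<close> and
  \<open>K + n - 1\<close>, is the smallest, and it is the eigenvalue.\<close>

lemma chain_gm_square_ge_eigenvalue:
  assumes "n > 0"
  shows "hemisphere_eigenvalue n K \<le> (chain_gm n K)\<^sup>2"
proof -
  let ?y = "real K + (real n - 1) / 2" and ?d = "\<lambda>i. real i - (real n - 1) / 2"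
  have e: "hemisphere_eigenvalue n K = ?y\<^sup>2 - ((real n - 1) / 2)\<^sup>2"
    by (simp add: hemisphere_eigenvalue_def power2_eq_square field_simps)
  have e0: "hemisphere_eigenvalue n K \<ge> 0" using assms by (simp add: hemisphere_eigenvalue_def)
  have "hemisphere_eigenvalue n K = (hemisphere_eigenvalue n K ^ n) powr (1 / real n)"
    using e0 assms by (cases "hemisphere_eigenvalue n K = 0") (auto simp: powr_powr simp flip: powr_realpow)
  also have "\<dots> \<le> (chain_gm n K)\<^sup>2" unfolding chain_gm_square[OF assms]
  proof (intro powr_mono2)
    have "(\<Prod>i<n. hemisphere_eigenvalue n K) \<le> (\<Prod>i<n. ?y\<^sup>2 - (?d i)\<^sup>2)"
      by (intro prod_mono) (use e e0 chain_deviation_bounds in auto)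
    then show "hemisphere_eigenvalue n K ^ n \<le> (\<Prod>i<n. ?y\<^sup>2 - (?d i)\<^sup>2)" by simp
  qed (use e0 in auto)
  finally show ?thesis .
qed

text \<open>By the inequality between geometric and harmonic mean, for the same paired products.\<close>

lemma chain_gm_square_lower:
  assumes "n > 0" "K > 0"
  defines "y \<equiv> real K + (real n - 1) / 2" and "V \<equiv> ((real n)\<^sup>2 - 1) / 12" and "D \<equiv> ((real n - 1) / 2)\<^sup>2"
  shows "y\<^sup>2 * (y\<^sup>2 - D) / (y\<^sup>2 - D + V) \<le> (chain_gm n K)\<^sup>2"
proof -
  let ?d = "\<lambda>i. real i - (real n - 1) / 2"
  let ?p = "\<lambda>i. y\<^sup>2 - (?d i)\<^sup>2"
  have yD: "y\<^sup>2 - D > 0"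
  proof -
    have "D < y\<^sup>2" unfolding D_def y_def using assms(1,2) by (intro power_strict_mono) auto
    then show ?thesis by simp
  qed
  have y2: "y\<^sup>2 > 0" using yD zero_le_power2[of "(real n - 1) / 2"] unfolding D_def by linarith
  have V: "V \<ge> 0" using assms(1) by (simp add: V_def)
  have d: "(?d i)\<^sup>2 \<le> D" if "i < n" for i using chain_deviation_bounds[OF that] by (simp add: D_def)
  have p: "?p i > 0" if "i < n" for i using d[OF that] yD by linarith
  \<comment> \<open>Replacing the deviation in the denominator by its extreme value \<open>D\<close>
    leaves a bound linear in the squared deviation, so that averaging produces only the variance
    \<open>V\<close>.\<close>
  have inv: "1 / ?p i \<le> 1 / y\<^sup>2 + (?d i)\<^sup>2 / (y\<^sup>2 * (y\<^sup>2 - D))" if i: "i < n" for i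
  proof -
    have "1 / ?p i = 1 / y\<^sup>2 + (?d i)\<^sup>2 / (y\<^sup>2 * ?p i)"
    proof -
      have "1 / (a - b) = 1 / a + b / (a * (a - b))" if "a > 0" "a - b > 0" for a b :: real
        using that by (simp add: divide_simps)
      then show ?thesis using p[OF i] y2 by blast
    qed
    also have "(?d i)\<^sup>2 / (y\<^sup>2 * ?p i) \<le> (?d i)\<^sup>2 / (y\<^sup>2 * (y\<^sup>2 - D))"
      using p[OF i] y2 yD d[OF i] by (intro divide_left_mono mult_left_mono mult_pos_pos) auto
    finally show ?thesis by simp
  qed
  have "(\<Prod>i<n. 1 / ?p i) powr (1 / real n) \<le> (\<Sum>i<n. (1 / ?p i) / real n)"
    using arith_geom_mean[of "{..<n}" "\<lambda>i. 1 / ?p i"] p assms(1) by (force simp: less_imp_le)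
  also have "\<dots> \<le> (\<Sum>i<n. (1 / y\<^sup>2 + (?d i)\<^sup>2 / (y\<^sup>2 * (y\<^sup>2 - D))) / real n)"
    using inv by (intro sum_mono divide_right_mono) auto
  also have "\<dots> = 1 / y\<^sup>2 + ((\<Sum>i<n. (?d i)\<^sup>2) / real n) / (y\<^sup>2 * (y\<^sup>2 - D))"
    using assms(1) by (simp add: sum.distrib add_divide_distrib mult.commute flip: sum_divide_distrib)
  also have "(\<Sum>i<n. (?d i)\<^sup>2) / real n = V" using assms(1) by (simp add: sum_chain_deviation V_def)
  also have "1 / y\<^sup>2 + V / (y\<^sup>2 * (y\<^sup>2 - D)) = (y\<^sup>2 - D + V) / (y\<^sup>2 * (y\<^sup>2 - D))"
    using y2 yD by (simp add: add_divide_distrib)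
  finally have *: "(\<Prod>i<n. 1 / ?p i) powr (1 / real n) \<le> (y\<^sup>2 - D + V) / (y\<^sup>2 * (y\<^sup>2 - D))" .
  have gm: "(chain_gm n K)\<^sup>2 = (\<Prod>i<n. ?p i) powr (1 / real n)"
    unfolding chain_gm_square[OF assms(1)] y_def ..
  have pos: "(\<Prod>i<n. ?p i) > 0" using p by (intro prod_pos) auto
  have "(\<Prod>i<n. 1 / ?p i) powr (1 / real n) = 1 / (chain_gm n K)\<^sup>2"
    unfolding gm by (simp add: prod_dividef powr_divide)
  with * have "1 / (chain_gm n K)\<^sup>2 \<le> (y\<^sup>2 - D + V) / (y\<^sup>2 * (y\<^sup>2 - D))" by simp
  moreover have "(chain_gm n K)\<^sup>2 > 0"
    unfolding gm powr_gt_zero using pos by (rule less_imp_neq[THEN not_sym])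
  moreover have "y\<^sup>2 - D + V > 0" "y\<^sup>2 * (y\<^sup>2 - D) > 0" using yD V y2 by (simp_all add: add_pos_nonneg)
  ultimately show ?thesis by (simp add: field_simps)
qed

text \<open>Squeezed between the arithmetic and harmonic bounds for the paired products, whose gap
  is of order \<open>1 / (y K)\<^sup>2\<close>.\<close>

lemma chain_gm_square_asymptotics:
  assumes "n > 0"
  shows "(\<lambda>K. (chain_gm n K)\<^sup>2 - (real K + (real n - 1) / 2)\<^sup>2) \<longlonglongrightarrow> - (((real n)\<^sup>2 - 1) / 12)"
proof -
  define y where "y = (\<lambda>K. real K + (real n - 1) / 2)"
  define V where "V = ((real n)\<^sup>2 - 1) / 12"
  define D where "D = ((real n - 1) / 2)\<^sup>2"
  have V: "V \<ge> 0" using assms by (simp add: V_def)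
  have y_lim: "filterlim y at_top sequentially"
    using filterlim_tendsto_add_at_top[OF tendsto_const filterlim_real_sequentially, of "(real n - 1) / 2"]
    by (simp add: y_def add.commute)
  have y2_lim: "filterlim (\<lambda>K. (y K)\<^sup>2 - D + V) at_top sequentially"
  proof -
    have "filterlim (\<lambda>K. (V - D) + (y K)\<^sup>2) at_top sequentially"
      by (rule filterlim_tendsto_add_at_top[OF tendsto_const filterlim_pow_at_top[OF _ y_lim]]) simp
    then show ?thesis by (simp add: algebra_simps)
  qed
  have "(\<lambda>K. - V - V * ((D - V) / ((y K)\<^sup>2 - D + V))) \<longlonglongrightarrow> - V - V * 0"
    by (intro tendsto_intros tendsto_divide_0[OF tendsto_const] filterlim_at_top_imp_at_infinity y2_lim)
  then have low: "(\<lambda>K. - V - V * ((D - V) / ((y K)\<^sup>2 - D + V))) \<longlonglongrightarrow> - V" by simp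
  have "(\<lambda>K. (chain_gm n K)\<^sup>2 - (y K)\<^sup>2) \<longlonglongrightarrow> - V"
  proof (rule tendsto_sandwich[OF _ _ low tendsto_const])
    show "\<forall>\<^sub>F K in sequentially. (chain_gm n K)\<^sup>2 - (y K)\<^sup>2 \<le> - V"
    proof (intro always_eventually allI)
      show "(chain_gm n K)\<^sup>2 - (y K)\<^sup>2 \<le> - V" for K
        using chain_gm_square_upper[OF assms, of K] unfolding y_def V_def by linarith
    qed
    show "\<forall>\<^sub>F K in sequentially. - V - V * ((D - V) / ((y K)\<^sup>2 - D + V)) \<le> (chain_gm n K)\<^sup>2 - (y K)\<^sup>2"
      using eventually_gt_at_top[of 0]
    proof eventually_elim
      case (elim K)
      have "D < (y K)\<^sup>2" unfolding D_def y_def using assms elim by (intro power_strict_mono) auto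
      then have pos: "(y K)\<^sup>2 - D + V > 0" using V by linarith
      have "(y K)\<^sup>2 * ((y K)\<^sup>2 - D) / ((y K)\<^sup>2 - D + V) - (y K)\<^sup>2 = - V - V * ((D - V) / ((y K)\<^sup>2 - D + V))"
        using pos by (simp add: field_simps)
      then show ?case using chain_gm_square_lower[OF assms elim] by (simp add: y_def V_def D_def)
    qed
  qed
  then show ?thesis by (simp add: y_def V_def)
qed

section \<open>Estimates and limits for the geometric means of consecutive chains\<close>

lemma chain_gm_eq:
  assumes "n > 0"
  shows "(fact n * real (chain_lowest n K)) powr (1 / real n) = chain_gm n K"
  by (simp only: fact_mult_chain_lowest[OF assms] chain_gm_def)

lemma chain_gm_Suc_bounds:
  assumes "n > 0"
  shows "real K + 1 \<le> chain_gm n (Suc K)" "chain_gm n (Suc K) \<le> real K + (real n + 1) / 2"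
proof -
  have "(real K + 1) ^ n \<le> pochhammer (real (Suc K)) n"
  proof -
    have "(\<Prod>i<n. real K + 1) \<le> (\<Prod>i<n. real (Suc K) + real i)" by (intro prod_mono) auto
    then show ?thesis by (simp add: pochhammer_prod lessThan_atLeast0)
  qed
  then have "((real K + 1) ^ n) powr (1 / real n) \<le> chain_gm n (Suc K)"
    unfolding chain_gm_def by (intro powr_mono2) auto
  moreover have "((real K + 1) ^ n) powr (1 / real n) = real K + 1"
    using assms by (simp add: powr_powr flip: powr_realpow)
  ultimately show "real K + 1 \<le> chain_gm n (Suc K)" by simp
  have "(chain_gm n (Suc K))\<^sup>2 \<le> (real (Suc K) + (real n - 1) / 2)\<^sup>2"
  proof -
    have "((real n)\<^sup>2 - 1) / 12 \<ge> 0" using one_le_power[of "real n" 2] assms by simp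
    then show ?thesis by (intro order_trans[OF chain_gm_square_upper[OF assms, of "Suc K"]]) simp
  qed
  also have "real (Suc K) + (real n - 1) / 2 = real K + (real n + 1) / 2" by (simp add: field_simps)
  finally show "chain_gm n (Suc K) \<le> real K + (real n + 1) / 2" by (rule power2_le_imp_le) simp
qed

text \<open>With \<open>x = K + (n + 1) / 2\<close> and \<open>h\<^sup>2 = x\<^sup>2 - (n\<^sup>2 - 1) / 12\<close>, the claim for \<open>h\<close> in place of the
  geometric mean reduces to \<open>x - h \<le> (n - 1) / 2\<close>.\<close>

lemma chain_gm_Suc_shifted_square:
  assumes "n > 0"
  shows "(chain_gm n (Suc K))\<^sup>2 - 2 * chain_gm n (Suc K) \<le> hemisphere_eigenvalue n K + (real n - 2) * (real n + 5) / 6"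
proof -
  define x where "x = real K + (real n + 1) / 2"
  define g where "g = chain_gm n (Suc K)"
  define h where "h = sqrt (x\<^sup>2 - ((real n)\<^sup>2 - 1) / 12)"
  have n1: "real n \<ge> 1" using assms by linarith
  have x: "x \<ge> (real n + 1) / 2" by (simp add: x_def)
  have "x\<^sup>2 \<ge> ((real n + 1) / 2)\<^sup>2" using x n1 by (intro power_mono) auto
  moreover have "((real n + 1) / 2)\<^sup>2 - ((real n)\<^sup>2 - 1) / 12 = (real n + 1) * (real n + 2) / 6"
    by (simp add: power2_eq_square field_simps)
  moreover have "(real n + 1) * (real n + 2) / 6 \<ge> 0" by simp
  ultimately have hp: "x\<^sup>2 - ((real n)\<^sup>2 - 1) / 12 \<ge> 0" by linarith
  have h2: "h\<^sup>2 = x\<^sup>2 - ((real n)\<^sup>2 - 1) / 12" unfolding h_def using hp by simp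
  have h0: "h \<ge> 0" unfolding h_def using hp by simp
  have "real (Suc K) + (real n - 1) / 2 = x" by (simp add: x_def field_simps)
  then have "g\<^sup>2 \<le> h\<^sup>2" using chain_gm_square_upper[OF assms, of "Suc K"] unfolding h2 g_def by simp
  then have gh: "g \<le> h" using h0 by (rule power2_le_imp_le)
  have g1: "g \<ge> 1" using chain_gm_Suc_bounds(1)[OF assms, of K] by (simp add: g_def)
  have "(g - 1)\<^sup>2 \<le> (h - 1)\<^sup>2" using g1 gh by (intro power_mono) auto
  then have 1: "g\<^sup>2 - 2 * g \<le> h\<^sup>2 - 2 * h" by (simp add: power2_eq_square algebra_simps)
  have prod: "(real n + 1) * (real n - 1) / 12 = (x - h) * (x + h)"
    using h2 by (simp add: power2_eq_square algebra_simps)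
  \<comment> \<open>The product of \<open>x - h\<close> and \<open>x + h\<close> is (n^2 - 1)/12. If
    the first factor exceeded (n - 1)/2, the second, at least (n + 1)/2, would force the product up
    to (n^2 - 1)/4. This is absurd for n > 1; for n = 1 the product is 0, so
    \<open>x = h\<close>.\<close>
  have "x - h \<le> (real n - 1) / 2"
  proof (rule ccontr)
    assume gt: "\<not> x - h \<le> (real n - 1) / 2"
    then have "(real n - 1) / 2 * ((real n + 1) / 2) \<le> (x - h) * (x + h)"
      using x h0 n1 by (intro mult_mono) auto
    then have "(real n - 1) * (real n + 1) \<le> 0" unfolding prod[symmetric] by (simp add: field_simps)
    then have "real n = 1" using n1 mult_pos_pos[of "real n - 1" "real n + 1"] by linarith
    then have "(x - h) * (x + h) = 0" using prod by simp
    moreover have "x + h > 0" using h0 by (intro add_pos_nonneg less_le_trans[OF _ x]) auto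
    ultimately show False using gt \<open>real n = 1\<close> by simp
  qed
  then have "2 * x - 2 * h \<le> real n - 1" by (simp add: field_simps)
  then have "h\<^sup>2 - 2 * h \<le> x\<^sup>2 - ((real n)\<^sup>2 - 1) / 12 - 2 * x + (real n - 1)" unfolding h2 by simp
  \<comment> \<open>\<open>x - 1\<close> is the centre of the factors of the \<open>K\<close>-chain,
    so its square is the eigenvalue plus \<open>((real n - 1) / 2)\<^sup>2\<close>. The remaining
    constants collect to (n - 2)(n + 5)/6.\<close>
  also have "\<dots> = hemisphere_eigenvalue n K + (real n - 2) * (real n + 5) / 6"
    by (simp add: x_def hemisphere_eigenvalue_def power2_eq_square field_simps)
  finally show ?thesis using 1 by (simp add: g_def)
qed

text \<open>The limit is the squared half-width of the chain, ((n - 1)/2)^2, minus the variance (n^2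
  - 1)/12.\<close>

lemma chain_lowest_limit:
  assumes "n > 0"
  shows "(\<lambda>K. (chain_gm n K)\<^sup>2 - hemisphere_eigenvalue n K) \<longlonglongrightarrow> (real n - 1) * (real n - 2) / 6"
proof -
  have "(\<lambda>K. ((chain_gm n K)\<^sup>2 - (real K + (real n - 1) / 2)\<^sup>2) + ((real n - 1) / 2)\<^sup>2)
    \<longlonglongrightarrow> - (((real n)\<^sup>2 - 1) / 12) + ((real n - 1) / 2)\<^sup>2"
    by (intro tendsto_intros chain_gm_square_asymptotics assms)
  moreover have "((chain_gm n K)\<^sup>2 - (real K + (real n - 1) / 2)\<^sup>2) + ((real n - 1) / 2)\<^sup>2 =
    (chain_gm n K)\<^sup>2 - hemisphere_eigenvalue n K" for K
    by (simp add: hemisphere_eigenvalue_def power2_eq_square field_simps)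
  moreover have "- (((real n)\<^sup>2 - 1) / 12) + ((real n - 1) / 2)\<^sup>2 = (real n - 1) * (real n - 2) / 6"
    by (simp add: power2_eq_square field_simps)
  ultimately show ?thesis by (simp only:)
qed

text \<open>The numerator is the convergent remainder of the next chain plus the gap 2K + n between
  consecutive eigenvalues, and the gap is asymptotic to twice the geometric mean.\<close>

lemma chain_highest_limit:
  assumes "n > 0"
  shows "(\<lambda>K. ((chain_gm n (Suc K))\<^sup>2 - hemisphere_eigenvalue n K) / (2 * chain_gm n (Suc K))) \<longlonglongrightarrow> 1"
proof -
  let ?g = "\<lambda>K. chain_gm n (Suc K)"
  let ?r = "\<lambda>K. (?g K)\<^sup>2 - hemisphere_eigenvalue n (Suc K)"
  have K: "filterlim (\<lambda>K. real K + 1) at_top sequentially"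
    using filterlim_tendsto_add_at_top[OF tendsto_const filterlim_real_sequentially, of 1] by (simp add: add.commute)
  have g_lim: "filterlim ?g at_top sequentially"
    by (rule filterlim_at_top_mono[OF K]) (use chain_gm_Suc_bounds(1)[OF assms] in auto)
  have gpos: "?g K > 0" for K using chain_gm_Suc_bounds(1)[OF assms, of K] by linarith
  have r: "?r \<longlonglongrightarrow> (real n - 1) * (real n - 2) / 6"
    using chain_lowest_limit[OF assms] by (rule LIMSEQ_Suc)
  have inv: "(\<lambda>K. 1 / ?g K) \<longlonglongrightarrow> 0"
    by (intro tendsto_divide_0[OF tendsto_const] filterlim_at_top_imp_at_infinity g_lim)
  have "(\<lambda>K. 1 - ((real n - 1) / 2) * (1 / ?g K)) \<longlonglongrightarrow> 1 - ((real n - 1) / 2) * 0"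
    by (intro tendsto_intros inv)
  then have low: "(\<lambda>K. 1 - ((real n - 1) / 2) * (1 / ?g K)) \<longlonglongrightarrow> 1" by simp
  have q: "(\<lambda>K. (real K + 1) / ?g K) \<longlonglongrightarrow> 1"
  proof (rule tendsto_sandwich[OF _ _ low tendsto_const])
    show "\<forall>\<^sub>F K in sequentially. (real K + 1) / ?g K \<le> 1"
      using chain_gm_Suc_bounds(1)[OF assms] gpos by (intro always_eventually) (simp add: divide_le_eq)
    show "\<forall>\<^sub>F K in sequentially. 1 - ((real n - 1) / 2) * (1 / ?g K) \<le> (real K + 1) / ?g K"
    proof (intro always_eventually allI)
      fix K
      have "(?g K - (real n - 1) / 2) / ?g K \<le> (real K + 1) / ?g K"
        using chain_gm_Suc_bounds(2)[OF assms, of K] gpos[of K] by (intro divide_right_mono) (auto simp: field_simps)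
      then show "1 - ((real n - 1) / 2) * (1 / ?g K) \<le> (real K + 1) / ?g K"
        using gpos[of K] by (simp add: diff_divide_distrib)
    qed
  qed
  have "(\<lambda>K. (1 / 2) * (?r K * (1 / ?g K)) + (real K + 1) / ?g K + ((real n - 2) / 2) * (1 / ?g K)) \<longlonglongrightarrow>
    (1 / 2) * ((real n - 1) * (real n - 2) / 6 * 0) + 1 + ((real n - 2) / 2) * 0"
    by (intro tendsto_intros r inv q)
  moreover have "(1 / 2) * (?r K * (1 / ?g K)) + (real K + 1) / ?g K + ((real n - 2) / 2) * (1 / ?g K) =
    ((?g K)\<^sup>2 - hemisphere_eigenvalue n K) / (2 * ?g K)" for K
  proof -
    have "(1 / 2) * (?r K * (1 / ?g K)) + (real K + 1) / ?g K + ((real n - 2) / 2) * (1 / ?g K) =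
      (?r K + 2 * (real K + 1) + (real n - 2)) / (2 * ?g K)"
    proof -
      have "(1 / 2) * (r * (1 / g)) + a / g + (b / 2) * (1 / g) = (r + 2 * a + b) / (2 * g)" if "g > 0" for r g a b :: real
        using that by (simp add: field_simps)
      then show ?thesis using gpos[of K] by blast
    qed
    also have "?r K + 2 * (real K + 1) + (real n - 2) = (?g K)\<^sup>2 - hemisphere_eigenvalue n K"
      by (simp add: hemisphere_eigenvalue_def algebra_simps)
    finally show ?thesis .
  qed
  ultimately show ?thesis by simp
qed

section \<open>From geometric means to the orders of the eigenvalues\<close>

theorem theorem4:
  fixes n :: nat and C :: real and \<mu> :: "nat \<Rightarrow> real"
  assumes n: "n = CARD('n::finite)" "n \<ge> 2"
    and C: "C = weyl_constant n (sphere_measure (hemisphere :: ((real ^ 'n) \<times> real) set))"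
    and \<mu>: "\<mu> = neumann_eigenvalue TYPE('n)"
  shows "(\<forall>k::nat.
            C * (real k + 1) powr (2 / real n) - 2 * sqrt C * (real k + 1) powr (1 / real n)
              - (real n - 2) * (real n + 5) / 6 \<le> \<mu> k \<and>
            \<mu> k \<le> C * real k powr (2 / real n)) \<and>
         \<mu> 0 = C * real 0 powr (2 / real n) \<and>
         (n = 2 \<longrightarrow> (\<forall>j k::nat. k = j * (j + 1) div 2 \<longrightarrow> \<mu> k = C * real k powr (2 / real n))) \<and>
         (\<lambda>K. C * real (chain_lowest n K) powr (2 / real n) - \<mu> (chain_lowest n K))
            \<longlonglongrightarrow> (real n - 1) * (real n - 2) / 6 \<and>
         (\<lambda>K. (C * (real (chain_highest n K) + 1) powr (2 / real n) - \<mu> (chain_highest n K)) /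
               (2 * sqrt C * (real (chain_highest n K) + 1) powr (1 / real n)))
            \<longlonglongrightarrow> 1"
proof -
  have n0: "n > 0" using n(2) by simp
  let ?g = "\<lambda>t. (fact n * t) powr (1 / real n)"
  have C: "C = fact n powr (2 / real n)" unfolding C by (rule weyl_constant_hemisphere[OF n(1)])
  have sqrtC: "sqrt C = fact n powr (1 / real n)"
    unfolding C using n0 by (intro real_sqrt_unique) (auto simp: power2_eq_square simp flip: powr_add)
  have g1: "sqrt C * t powr (1 / real n) = ?g t" if "t \<ge> 0" for t
    unfolding sqrtC using that by (simp add: powr_mult)
  have g2: "C * t powr (2 / real n) = (?g t)\<^sup>2" if "t \<ge> 0" for t
  proof -
    have "s powr (2 / real n) = s powr (1 / real n) * s powr (1 / real n)" for s :: real
      by (simp flip: powr_add)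
    then show ?thesis unfolding C using that by (simp add: powr_mult power2_eq_square)
  qed
  have \<mu>: "\<mu> k = hemisphere_eigenvalue n (chain_index n k)" for k
    unfolding \<mu> n(1) by (rule neumann_eigenvalue_eq)
  have \<mu>_lowest: "\<mu> (chain_lowest n K) = hemisphere_eigenvalue n K" for K
  proof -
    have "chain_index n (chain_lowest n K) = K"
      using chain_mult_pos[of n K] by (simp add: chain_index_eq_iff chain_lowest_Suc)
    then show ?thesis by (simp add: \<mu>)
  qed
  have \<mu>_highest: "\<mu> (chain_highest n K) = hemisphere_eigenvalue n K" for K
  proof -
    have "chain_index n (chain_highest n K) = K"
      using chain_highest_Suc[of n K] chain_mult_pos[of n K] by (simp add: chain_index_eq_iff chain_lowest_Suc)
    then show ?thesis by (simp add: \<mu>)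
  qed
  have highest: "real (chain_highest n K) + 1 = real (chain_lowest n (Suc K))" for K
    using chain_highest_Suc[of n K] by linarith
  have lower: "C * (real k + 1) powr (2 / real n) - 2 * sqrt C * (real k + 1) powr (1 / real n)
      - (real n - 2) * (real n + 5) / 6 \<le> \<mu> k" for k
  proof -
    define K where "K = chain_index n k"
    define z where "z = ?g (real k + 1)"
    have k: "real k + 1 \<le> real (chain_lowest n (Suc K))"
      using chain_index_bounds(2)[of k n] by (simp add: K_def)
    have "(1 :: real) \<le> fact n * (real k + 1)"
      using fact_ge_1[of n, where 'a=real] mult_mono[of 1 "fact n" 1 "real k + 1"] by simp
    then have z1: "1 \<le> z" unfolding z_def by (intro ge_one_powr_ge_zero) auto
    have "z \<le> ?g (real (chain_lowest n (Suc K)))"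
      unfolding z_def using k by (intro powr_mono2 mult_left_mono) auto
    then have zg: "z \<le> chain_gm n (Suc K)" unfolding chain_gm_eq[OF n0] .
    \<comment> \<open>Monotonicity of \<open>t\<^sup>2 - 2 * t\<close> is used on t >= 1 only, which
      is why \<open>z1\<close> is established; this moves the estimate to the end of the
      chain.\<close>
    have "(z - 1)\<^sup>2 \<le> (chain_gm n (Suc K) - 1)\<^sup>2" using z1 zg by (intro power_mono) auto
    then have "z\<^sup>2 - 2 * z \<le> (chain_gm n (Suc K))\<^sup>2 - 2 * chain_gm n (Suc K)"
      by (simp add: power2_eq_square algebra_simps)
    also have "\<dots> \<le> \<mu> k + (real n - 2) * (real n + 5) / 6"
      unfolding \<mu> K_def[symmetric] by (rule chain_gm_Suc_shifted_square[OF n0])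
    finally show ?thesis using g1[of "real k + 1"] g2[of "real k + 1"] by (simp add: z_def)
  qed
  have upper: "\<mu> k \<le> C * real k powr (2 / real n)" for k
  proof -
    have "\<mu> k \<le> (chain_gm n (chain_index n k))\<^sup>2"
      unfolding \<mu> by (rule chain_gm_square_ge_eigenvalue[OF n0])
    also have "\<dots> = (?g (real (chain_lowest n (chain_index n k))))\<^sup>2" unfolding chain_gm_eq[OF n0] ..
    also have "\<dots> \<le> (?g (real k))\<^sup>2"
      using chain_index_bounds(1)[of n k] by (intro power_mono powr_mono2 mult_left_mono) auto
    finally show ?thesis by (simp add: g2)
  qed
  have zero: "\<mu> 0 = C * real 0 powr (2 / real n)"
    using \<mu>_lowest[of 0] by (simp add: chain_lowest_0 hemisphere_eigenvalue_def)
  have two: "\<mu> k = C * real k powr (2 / real n)" if "n = 2" "k = j * (j + 1) div 2" for j k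
  proof -
    \<comment> \<open>For n = 2 the two factors \<open>j\<close> and \<open>j + 1\<close> are paired
      with each other, so the estimate by the smallest pair is an equality.\<close>
    have "2 * real (chain_lowest 2 j) = real j * (real j + 1)"
      using fact_mult_chain_lowest[of 2 j] by (simp add: numeral_2_eq_2 pochhammer_Suc)
    then have "real (2 * chain_lowest 2 j) = real (j * (j + 1))" by (simp add: distrib_left)
    then have "2 * chain_lowest 2 j = j * (j + 1)" by (simp only: of_nat_eq_iff)
    then have k: "k = chain_lowest n j" using that by simp
    have "\<mu> k = real j * (real j + 1)" unfolding k \<mu>_lowest using that(1) by (simp add: hemisphere_eigenvalue_def)
    moreover have "C * real k powr (2 / real n) = 2 * real (chain_lowest 2 j)"
      using that(1) by (simp add: C k fact_2)
    ultimately show ?thesis using \<open>2 * real (chain_lowest 2 j) = real j * (real j + 1)\<close> by simp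
  qed
  have "C * real (chain_lowest n K) powr (2 / real n) - \<mu> (chain_lowest n K)
      = (chain_gm n K)\<^sup>2 - hemisphere_eigenvalue n K" for K
    unfolding \<mu>_lowest g2[OF of_nat_0_le_iff] chain_gm_eq[OF n0] ..
  moreover have "(C * (real (chain_highest n K) + 1) powr (2 / real n) - \<mu> (chain_highest n K)) /
       (2 * sqrt C * (real (chain_highest n K) + 1) powr (1 / real n))
      = ((chain_gm n (Suc K))\<^sup>2 - hemisphere_eigenvalue n K) / (2 * chain_gm n (Suc K))" for K
    unfolding \<mu>_highest highest g2[OF of_nat_0_le_iff] mult.assoc g1[OF of_nat_0_le_iff] chain_gm_eq[OF n0] ..
  ultimately show ?thesis
    using lower upper zero two chain_lowest_limit[OF n0] chain_highest_limit[OF n0] by simp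
qed

end
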